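(* Let $n$ be a positive integer. The generating function $X_n(r,s,t)$ of $n\times n$ diagonally symmetric alternating sign matrices at $t=1$ is given by $$X_n(r,s,1)=s^{\chi_{\mathrm{odd}}(n)}\operatorname*{Pf}_{\chi_{\mathrm{odd}}(n)\le i<j\le n-1}\biggl([u^iv^j]\,\frac{v-u}{1-uv}\biggl(s^2+\frac{r(1+u)(1+v)}{(1-ru)(1-rv)-uv}\biggr)\biggr),$$ where the coefficients which comprise the entries for the Pfaffian are given explicitly, for $0\le i<j$, by $$\begin{aligned} &[u^iv^j]\,\frac{v-u}{1-uv}\biggl(s^2+\frac{r(1+u)(1+v)}{(1-ru)(1-rv)-uv}\biggr)\\ &=s^2\,\delta_{i+1,j}+\sum_{0\le l\le k\le i}\biggl[\biggl(\binom{k}{l}\binom{j-i+k-1}{l}-\binom{k-1}{l}\binom{j-i+k}{l}\biggr)r^{j-i+2k-2l}\\ &\qquad+\biggl(\binom{k}{l}\binom{j-i+k-2}{l}-\binom{k-2}{l}\binom{j-i+k}{l}\biggr)r^{j-i+2k-2l-1}\\ &\qquad+\biggl(\binom{k-1}{l}\binom{j-i+k-2}{l}-\binom{k-2}{l}\binom{j-i+k-1}{l}\biggr)r^{j-i+2k-2l-2}\biggr]. \end{aligned}$$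
   Context: An alternating sign matrix (ASM) is a square matrix with entries in $\{0,1,-1\}$ such that along each row and each column the nonzero entries alternate in sign and have sum $1$. A diagonally symmetric alternating sign matrix (DSASM) is an ASM which equals its transpose. $\mathrm{DSASM}(n)$ denotes the set of $n\times n$ DSASMs. For $A\in\mathrm{DSASM}(n)$ let $R(A)=\sum_{1\le i<j\le n}|A_{ij}|$ (number of nonzero strictly upper triangular entries), $S(A)=\sum_{i=1}^n|A_{ii}|$ (number of nonzero diagonal entries), and $T(A)=$ the column number of the unique $1$ in the first row of $A$. For indeterminates $r,s,t$, $X_n(r,s,t)=\sum_{A\in\mathrm{DSASM}(n)}r^{R(A)}s^{S(A)}t^{T(A)}$. Conventions: $\chi_{\mathrm{odd}}(n)$ is $1$ if $n$ is odd and $0$ if $n$ is even. $\delta_{i,j}$ is the Kronecker delta. $[u^iv^j]f(u,v)$ is the coefficient of $u^iv^j$ in the power series expansion of $f$ about $u=v=0$. For integers $n,k$, $\binom nk=\frac{n!}{k!(n-k)!}$ if $0\le k\le n$, and $\binom nk=0$ otherwise (in particular it is $0$ whenever $n<0$). $\operatorname{Pf}_{a\le i<j\le b}(B_{ij})$ is the Pfaffian of the skew-symmetric matrix with rows and columns indexed by $a,\ldots,b$ whose strictly upper triangular part is $(B_{ij})_{a\le i<j\le b}$; an empty Pfaffian is $1$. *)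

theory Defs
  imports
    "Jordan_Normal_Form.Matrix"
    "HOL-Combinatorics.Permutations"
    "HOL-Computational_Algebra.Formal_Power_Series"
begin

text \<open>
  Matrices and vectors of \<^theory>\<open>Jordan_Normal_Form.Matrix\<close> are indexed from 0.
  In \<open>asm_line\<close>, two nonzero entries are consecutive among the nonzero entries
  when everything strictly between them is 0.
\<close>

definition asm_line :: "int vec \<Rightarrow> bool" where
  "asm_line v \<longleftrightarrow>
     (\<forall>i j. i < j \<and> j < dim_vec v \<and> v $ i \<noteq> 0 \<and> v $ j \<noteq> 0 \<and> (\<forall>k. i < k \<and> k < j \<longrightarrow> v $ k = 0)
        \<longrightarrow> sgn (v $ j) = - sgn (v $ i)) \<and>
     (\<Sum>i<dim_vec v. v $ i) = 1"

definition ASM :: "nat \<Rightarrow> int mat set" where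
  "ASM n = {A \<in> carrier_mat n n. elements_mat A \<subseteq> {0, 1, -1} \<and>
     (\<forall>i<n. asm_line (row A i)) \<and> (\<forall>j<n. asm_line (col A j))}"

definition DSASM :: "nat \<Rightarrow> int mat set" where
  "DSASM n = {A \<in> ASM n. transpose_mat A = A}"

definition R_stat :: "int mat \<Rightarrow> nat" where
  "R_stat A = (\<Sum>(i, j) \<in> {(i, j). i < j \<and> j < dim_row A}. nat \<bar>A $$ (i, j)\<bar>)"

definition S_stat :: "int mat \<Rightarrow> nat" where
  "S_stat A = (\<Sum>i<dim_row A. nat \<bar>A $$ (i, i)\<bar>)"

text \<open>Column numbers in \<open>T_stat\<close> are counted from 1, hence the \<open>Suc\<close>.\<close>

definition T_stat :: "int mat \<Rightarrow> nat" where
  "T_stat A = Suc (THE j. j < dim_col A \<and> A $$ (0, j) = 1)"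

text \<open>
  \<open>X_gf\<close> takes values of \<open>r, s, t\<close> in any commutative ring; the generating function in
  indeterminates is the instance where \<open>r, s, t\<close> are the generators of a polynomial ring or of
  its field of fractions.
\<close>

definition X_gf :: "nat \<Rightarrow> 'a::comm_ring_1 \<Rightarrow> 'a \<Rightarrow> 'a \<Rightarrow> 'a" where
  "X_gf n r s t = (\<Sum>A \<in> DSASM n. r ^ R_stat A * s ^ S_stat A * t ^ T_stat A)"

definition chi_odd :: "nat \<Rightarrow> nat" where
  "chi_odd n = (if odd n then 1 else 0)"

lemma finite_DSASM: "finite (DSASM n)"
proof -
  let ?F = "({..<n} \<times> {..<n}) \<rightarrow>\<^sub>E {0, 1, -1 :: int}"
  have "DSASM n \<subseteq> mat n n ` ?F"
  proof
    fix A assume A: "A \<in> DSASM n"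
    hence c: "A \<in> carrier_mat n n" and e: "elements_mat A \<subseteq> {0, 1, -1}"
      by (auto simp: DSASM_def ASM_def)
    let ?f = "restrict (($$) A) ({..<n} \<times> {..<n})"
    have "A = mat n n ?f"
      using c by (intro eq_matI) auto
    moreover have "?f \<in> ?F"
      using c e by (force simp: elements_mat_def)
    ultimately show "A \<in> mat n n ` ?F" by blast
  qed
  thus ?thesis by (rule finite_subset) (intro finite_imageI finite_PiE; simp)
qed

text \<open>
  The Pfaffian of the skew-symmetric matrix on the index set \<open>{a..b}\<close> with strictly upper
  triangular part \<open>B\<close>, as the signed sum over perfect matchings. A matching is encoded by the
  unique permutation \<open>p\<close> whose consecutive pairs \<open>p (a + 2 * k), p (a + 2 * k + 1)\<close> are its
  blocks, with each block increasing and the blocks ordered by their minima. So only values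
  \<open>B i j\<close> with \<open>i < j\<close> occur; an index set of odd size gives 0, and the empty one gives 1.
\<close>

definition pfaffian_perms :: "nat \<Rightarrow> nat \<Rightarrow> (nat \<Rightarrow> nat) set" where
  "pfaffian_perms a b = {p. p permutes {a..b} \<and>
     (\<forall>k < card {a..b} div 2. p (a + 2 * k) < p (a + 2 * k + 1)) \<and>
     (\<forall>k. Suc k < card {a..b} div 2 \<longrightarrow> p (a + 2 * k) < p (a + 2 * Suc k))}"

definition pfaffian :: "nat \<Rightarrow> nat \<Rightarrow> (nat \<Rightarrow> nat \<Rightarrow> 'a::comm_ring_1) \<Rightarrow> 'a" where
  "pfaffian a b B =
     (if even (card {a..b}) then
        \<Sum>p \<in> pfaffian_perms a b. of_int (sign p) *
          (\<Prod>k < card {a..b} div 2. B (p (a + 2 * k)) (p (a + 2 * k + 1)))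
      else 0)"

text \<open>
  The convention is 0 for a negative upper entry, unlike \<^const>\<open>gbinomial\<close>. In the explicit
  coefficient formula, the exponent \<open>j - i + 2k - 2l - 2\<close> of \<open>r\<close> can be \<open>-1\<close> (for
  \<open>j = i + 1\<close>, \<open>l = k\<close>), but then both products of binomials in front of it are 0, so
  truncating exponents with \<^const>\<open>nat\<close> is harmless.
\<close>

definition binom :: "int \<Rightarrow> int \<Rightarrow> nat" where
  "binom n k = (if 0 \<le> k \<and> k \<le> n then nat n choose nat k else 0)"

text \<open>
  Power series in \<open>u, v\<close> are series in \<open>u\<close> whose coefficients are series in \<open>v\<close>. The
  denominators below have constant term 1, so over a field \<open>/\<close> is
  genuine division of power series.
\<close>

definition fps_u :: "'a::comm_ring_1 fps fps" where
  "fps_u = fps_X"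

definition fps_v :: "'a::comm_ring_1 fps fps" where
  "fps_v = fps_const fps_X"

definition const_uv :: "'a::comm_ring_1 \<Rightarrow> 'a fps fps" where
  "const_uv c = fps_const (fps_const c)"

definition coeff_uv :: "'a::comm_ring_1 fps fps \<Rightarrow> nat \<Rightarrow> nat \<Rightarrow> 'a" where
  "coeff_uv f i j = fps_nth (fps_nth f i) j"

definition dsasm_series :: "'a::field \<Rightarrow> 'a \<Rightarrow> 'a fps fps" where
  "dsasm_series r s =
     (let u = fps_u; v = fps_v; r' = const_uv r; s' = const_uv s in
      (v - u) / (1 - u * v) *
      (s'\<^sup>2 + r' * (1 + u) * (1 + v) / ((1 - r' * u) * (1 - r' * v) - u * v)))"

lemma dsasm_series_denominators:
  fixes r :: "'a::field" and f :: "'a fps fps"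
  shows "f / (1 - fps_u * fps_v) * (1 - fps_u * fps_v) = f"
    and "f / ((1 - const_uv r * fps_u) * (1 - const_uv r * fps_v) - fps_u * fps_v) *
         ((1 - const_uv r * fps_u) * (1 - const_uv r * fps_v) - fps_u * fps_v) = f"
proof -
  have div: "f / g * g = f" if "fps_nth (fps_nth g 0) 0 = 1" for g :: "'a fps fps"
  proof -
    have g0: "fps_nth g 0 \<noteq> 0" using that by auto
    have "inverse (fps_nth g 0) * fps_nth g 0 = 1"
      using that by (intro inverse_mult_eq_1) auto
    hence "inverse g * g = 1"
      using fps_left_inverse'[of "inverse (fps_nth g 0)" g "inverse (fps_nth g 0)"]
      by (simp add: fps_inverse_def[of g] mult.commute)
    thus ?thesis using g0 by (simp add: fps_divide_unit mult.assoc)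
  qed
  show "f / (1 - fps_u * fps_v) * (1 - fps_u * fps_v) = f"
    by (rule div) (simp add: fps_u_def fps_v_def)
  show "f / ((1 - const_uv r * fps_u) * (1 - const_uv r * fps_v) - fps_u * fps_v) *
         ((1 - const_uv r * fps_u) * (1 - const_uv r * fps_v) - fps_u * fps_v) = f"
    by (rule div) (simp add: fps_u_def fps_v_def const_uv_def)
qed

end

theory Submission
  imports
    Defs
    "Jordan_Normal_Form.Char_Poly"
    "HOL-Computational_Algebra.Computational_Algebra"
begin

text \<open>
  A symmetric matrix is determined by its entries on and above the diagonal. Reading them row
  by row, and remembering for each column whether its entries so far sum to 0 or to 1, turns a
  diagonally symmetric alternating sign matrix into a configuration of a six-vertex model on a
  triangle: line \<open>i\<close> comes down column \<open>i\<close>, is reflected at the diagonal and leaves along row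
  \<open>i\<close>. Its state is a partial sum, False for 0 and True for 1; it starts as False and ends as
  True. Give line \<open>i\<close> a spectral parameter \<open>u\<^sub>i\<close>. The weights of \<open>part_fn\<close> are such that
  at \<open>u = 0\<close> a nonzero entry contributes \<open>r\<close> off the diagonal and \<open>s\<close> on it, and every zero
  entry contributes 1. So \<open>X_gf n r s 1\<close> is the partition function at \<open>u = 0\<close>
  (\<open>X_gf_partition\<close>).

  For general parameters the model is integrable: a crossing of two neighbouring lines can be
  pulled from the top boundary through rows (\<open>row_sum_YBE\<close>) and through the diagonal
  (\<open>part_fn_YBE\<close>) to the right boundary, where it disappears. Hence the partition function is
  symmetric in the parameters. It is a polynomial of degree at most \<open>n - 1\<close> in each of them,
  and when the parameters \<open>x\<close> and \<open>y\<close> of two lines satisfy \<open>(1 - x * y) * weight_a r x y = 0\<close>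
  both lines are frozen, which leaves a product times the partition function of the other
  \<open>n - 2\<close> lines (\<open>part_fn0_Cons_Cons_inverse\<close>, \<open>part_fn0_weight_a_zero\<close>).

  The Pfaffian of the matrix with entries \<open>pair_num / pair_den\<close> has poles at exactly these
  places, and its residues are given by smaller Pfaffians of the same kind. Multiply it by the
  product of all denominators, and the partition function by the Vandermonde product of the
  parameters; then both sides become polynomials of degree at most \<open>2 * (n - 1)\<close> in the first
  parameter. They agree at the \<open>2 * (n - 1)\<close> zeros of the denominators and, because both sides
  are alternating, also when the first parameter equals one of the other \<open>n - 1\<close>; so they are
  equal (\<open>cleared_all\<close>, \<open>partition_pfaffian_even\<close>). An odd number of lines is reduced to an
  even one by adding a line with parameter -1, which must turn at its diagonal vertex and is
  then frozen (\<open>partition_pfaffian_odd\<close>).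

  To reach \<open>u = 0\<close>, put \<open>u\<^sub>i = c\<^sub>i * X\<close> with distinct constants. The lowest
  coefficient of the Pfaffian is the Vandermonde determinant of the \<open>c\<^sub>i\<close> times the
  Pfaffian of the power series coefficients, by an expansion of Cauchy-Binet type
  (\<open>pfsum_lowest_coeff\<close>), and the Vandermonde product on the other side cancels it. All this
  is done with \<open>pfsum\<close>, the sum over all permutations, which is \<open>2 ^ m * fact m\<close> times the
  Pfaffian (\<open>pfsum_pfaffian\<close>) and is visibly alternating. Cancelling that factor uses
  characteristic 0 and the specialisation uses that \<open>r\<close>, \<open>s\<close> and \<open>1 + r\<close> are nonzero; so the
  identity is proved over the fraction field of the integer polynomials in two indeterminates,
  where it is an identity of integer polynomials, and these can be evaluated in any ring
  (\<open>X_gf_pfaffian_explicit\<close>).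

  The explicit coefficients come from
  \<open>1 / ((1 - r * u) * (1 - r * v) - u * v) = (\<Sum>l. (u * v) ^ l / ((1 - r * u) * (1 - r * v)) ^ (l + 1))\<close>,
  and division by \<open>1 - u * v\<close> sums coefficients along diagonals.
\<close>

section \<open>The six-vertex weights and the Yang-Baxter equation\<close>

text \<open>
  At the crossing of two lines with parameters \<open>x\<close> and \<open>y\<close>, the weight is \<open>weight_a\<close> if the
  states of the two lines differ, and \<open>1 - x * y\<close> if they agree and are kept. If they agree,
  both lines may also flip: with weight \<open>r\<close> from False to True, and with weight
  \<open>r * weight_g r x * weight_g r y\<close> back. Writing \<open>r = - (q + 1 / q)\<close> and
  \<open>w = (1 + q * x) / (1 + x / q)\<close>, and correspondingly for \<open>y\<close>, these are the usual
  trigonometric six-vertex weights at the product of the two values \<open>w\<close>, in a gauge that needs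
  no square roots: a line pays \<open>weight_g\<close> exactly when it goes down from True to False.
\<close>

definition weight_a :: "'a::comm_ring_1 \<Rightarrow> 'a \<Rightarrow> 'a \<Rightarrow> 'a" where
  "weight_a r x y = 1 - r * (x + y) + (r\<^sup>2 - 1) * x * y"

definition weight_g :: "'a::comm_ring_1 \<Rightarrow> 'a \<Rightarrow> 'a" where
  "weight_g r x = 1 - r * x + x\<^sup>2"

text \<open>
  The line with parameter \<open>x\<close> enters a row in state \<open>h\<close> and must leave it as True, because
  every row of the matrix sums to 1. The list \<open>vs\<close> gives the states of the columns above the
  row, and the states below it are passed to \<open>F\<close>. With this continuation, the next row is
  composed without an explicit sum over states.
\<close>

fun row_sum :: "'a::comm_ring_1 \<Rightarrow> 'a \<Rightarrow> bool \<Rightarrow> 'a list \<Rightarrow> bool list \<Rightarrow> (bool list \<Rightarrow> 'a) \<Rightarrow> 'a" where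
  "row_sum r x h [] [] F = (if h then F [] else 0)"
| "row_sum r x h (u # us) (v # vs) F =
     (if h = v
      then (1 - x * u) * row_sum r x h us vs (\<lambda>w. F (v # w))
         + (if h then r * weight_g r x * weight_g r u else r) * row_sum r x (\<not> h) us vs (\<lambda>w. F ((\<not> v) # w))
      else weight_a r x u * row_sum r x h us vs (\<lambda>w. F (v # w)))"
| "row_sum r x h _ _ F = 0"

text \<open>
  The first column ends at the diagonal vertex of the first row. There the line keeps its
  state with weight \<open>1 + x\<close> (diagonal entry 0), or flips it with weight \<open>s\<close>, times \<open>weight_g\<close>
  when it goes down.
\<close>

fun part_fn :: "'a::comm_ring_1 \<Rightarrow> 'a \<Rightarrow> 'a list \<Rightarrow> bool list \<Rightarrow> 'a" where
  "part_fn r s [] vs = (if vs = [] then 1 else 0)"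
| "part_fn r s (x # us) vs = (case vs of [] \<Rightarrow> 0 | c # vs' \<Rightarrow>
     (1 + x) * row_sum r x c us vs' (part_fn r s us)
     + (if c then s * weight_g r x else s) * row_sum r x (\<not> c) us vs' (part_fn r s us))"

text \<open>
  The weight of a crossing of two neighbouring lines in equal states.
\<close>

definition cross_eq :: "'a::comm_ring_1 \<Rightarrow> 'a \<Rightarrow> 'a \<Rightarrow> 'a" where
  "cross_eq r x y = r - (r\<^sup>2 - 1) * y - x + r * x * y"

text \<open>
  A crossing of the neighbouring lines with parameters \<open>x\<close> and \<open>y\<close> at positions \<open>k\<close> and
  \<open>k + 1\<close>. If the states differ, they either pass on to the other position with weight
  \<open>y - x\<close>, or stay in place, so that each line flips.
\<close>

fun crossing :: "'a::comm_ring_1 \<Rightarrow> 'a \<Rightarrow> 'a \<Rightarrow> nat \<Rightarrow> (bool list \<Rightarrow> 'a) \<Rightarrow> bool list \<Rightarrow> 'a" where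
  "crossing r x y 0 F (a # b # w) =
     (if a = b then cross_eq r x y * F (a # b # w)
      else r * weight_g r (if a then x else y) * F (a # b # w) + (y - x) * F (b # a # w))"
| "crossing r x y (Suc k) F (v # w) = crossing r x y k (\<lambda>w'. F (v # w')) w"
| "crossing r x y k F _ = 0"

lemma row_sum_lin:
  "row_sum r x h us vs (\<lambda>w. c * F w + d * G w) = c * row_sum r x h us vs F + d * row_sum r x h us vs G"
proof (induction us arbitrary: h vs F G)
  case Nil
  show ?case by (cases vs) auto
next
  case (Cons u us)
  have IH: "row_sum r x h us vs (\<lambda>w. c * F (p # w) + d * G (p # w))
      = c * row_sum r x h us vs (\<lambda>w. F (p # w)) + d * row_sum r x h us vs (\<lambda>w. G (p # w))" for h vs p
    by (rule Cons.IH)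
  show ?case by (cases vs) (simp_all add: IH algebra_simps)
qed

lemma row_sum_add: "row_sum r x h us vs (\<lambda>w. F w + G w) = row_sum r x h us vs F + row_sum r x h us vs G"
  using row_sum_lin[of r x h us vs 1 F 1 G] by simp

lemma row_sum_scale: "row_sum r x h us vs (\<lambda>w. c * F w) = c * row_sum r x h us vs F"
  using row_sum_lin[of r x h us vs c F 0 F] by simp

lemma row_sum_cong:
  assumes "\<And>w. length w = length us \<Longrightarrow> F w = G w"
  shows "row_sum r x h us vs F = row_sum r x h us vs G"
  using assms
proof (induction us arbitrary: h vs F G)
  case Nil
  thus ?case by (cases vs) auto
next
  case (Cons u us)
  have IH: "row_sum r x h us vs (\<lambda>w. F (p # w)) = row_sum r x h us vs (\<lambda>w. G (p # w))" for h vs p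
    by (rule Cons.IH) (simp add: Cons.prems)
  show ?case by (cases vs) (simp_all add: IH)
qed

lemma crossing_lin: "crossing r x y k (\<lambda>w. c * F w + d * G w) vs = c * crossing r x y k F vs + d * crossing r x y k G vs"
proof (induction k arbitrary: F G vs)
  case 0
  show ?case by (cases vs; cases "tl vs") (auto simp: algebra_simps)
next
  case (Suc k)
  show ?case by (cases vs) (simp_all add: Suc.IH)
qed

lemma crossing_add: "crossing r x y k (\<lambda>w. F w + G w) vs = crossing r x y k F vs + crossing r x y k G vs"
  using crossing_lin[of r x y k 1 F 1 G] by simp

lemma crossing_scale: "crossing r x y k (\<lambda>w. c * F w) vs = c * crossing r x y k F vs"
  using crossing_lin[of r x y k c F 0 F] by simp

text \<open>
  The Yang-Baxter equation: a polynomial identity for each choice of the three incoming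
  states.
\<close>

lemma row_sum_YBE_base:
  "crossing r x y 0 (\<lambda>v. row_sum r z h (y # x # us) v F) (a # b # vs)
   = row_sum r z h (x # y # us) (a # b # vs) (crossing r x y 0 F)"
proof -
  have l: "row_sum r z h us vs (\<lambda>w. c * F (p # q # w) + d * F (p' # q' # w)) = 
      c * row_sum r z h us vs (\<lambda>w. F (p # q # w)) + d * row_sum r z h us vs (\<lambda>w. F (p' # q' # w))"
    for h c d p q p' q' by (rule row_sum_lin)
  show ?thesis
    by (cases h; cases a; cases b)
       (simp_all add: l row_sum_scale, simp_all add: cross_eq_def weight_g_def weight_a_def power2_eq_square algebra_simps)
qed

lemma row_sum_YBE:
  assumes "length us1 = k" "length vs = length us1 + 2 + length us2"
  shows "crossing r x y k (\<lambda>v. row_sum r z h (us1 @ y # x # us2) v F) vs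
   = row_sum r z h (us1 @ x # y # us2) vs (crossing r x y k F)"
  using assms
proof (induction us1 arbitrary: k vs h F)
  case Nil
  then obtain a b vs' where "vs = a # b # vs'" "k = 0"
    by (cases vs; cases "tl vs") auto
  show ?case unfolding \<open>vs = _\<close> \<open>k = 0\<close> append_Nil by (rule row_sum_YBE_base)
next
  case (Cons u us1)
  then obtain v vs' k' where v: "vs = v # vs'" "k = Suc k'" by (cases vs) auto
  have IH: "crossing r x y k' (\<lambda>v. row_sum r z h (us1 @ y # x # us2) v F) vs'
   = row_sum r z h (us1 @ x # y # us2) vs' (crossing r x y k' F)" for h F
    using Cons v by (intro Cons.IH) auto
  show ?case using v by (simp add: IH crossing_add crossing_scale)
qed

text \<open>
  The same crossing exchanges two consecutive rows. At the right end both lines are True,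
  where the crossing only contributes the factor \<open>cross_eq\<close>; this is why it is absent on the
  right-hand side. Each induction step is again the Yang-Baxter equation, for one column.
\<close>

lemma row_sum_pair_YBE:
  assumes "length vs = length us"
  shows "(if h1 = h2 then cross_eq r x y * row_sum r y h1 us vs (\<lambda>w. row_sum r x h2 us w F)
     else r * weight_g r (if h1 then x else y) * row_sum r y h1 us vs (\<lambda>w. row_sum r x h2 us w F)
          + (y - x) * row_sum r y h2 us vs (\<lambda>w. row_sum r x h1 us w F))
   = cross_eq r x y * row_sum r x h1 us vs (\<lambda>w. row_sum r y h2 us w F)"
  using assms
proof (induction us arbitrary: vs h1 h2 F)
  case Nil
  thus ?case by auto
next
  case (Cons u us)
  obtain v vs' where v: "vs = v # vs'" "length vs' = length us" using Cons.prems by (cases vs) auto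
  define X where "X k1 k2 c = row_sum r y k1 us vs' (\<lambda>w. row_sum r x k2 us w (\<lambda>w. F (c # w)))" for k1 k2 c
  define Y where "Y k1 k2 c = row_sum r x k1 us vs' (\<lambda>w. row_sum r y k2 us w (\<lambda>w. F (c # w)))" for k1 k2 c
  have IH: "cross_eq r x y * Y k1 k2 c = (if k1 = k2 then cross_eq r x y * X k1 k2 c
     else r * weight_g r (if k1 then x else y) * X k1 k2 c + (y - x) * X k2 k1 c)" for k1 k2 c
    unfolding X_def Y_def using Cons.IH[OF v(2), of k1 k2 "\<lambda>w. F (c # w)"] by simp
  have IHs: "cross_eq r x y * Y True True c = cross_eq r x y * X True True c"
     "cross_eq r x y * Y False False c = cross_eq r x y * X False False c"
     "cross_eq r x y * Y True False c = r * weight_g r x * X True False c + (y - x) * X False True c"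
     "cross_eq r x y * Y False True c = r * weight_g r y * X False True c + (y - x) * X True False c" for c
    using IH[of True True c] IH[of False False c] IH[of True False c] IH[of False True c] by auto
  show ?case
    using IHs[of True] IHs[of False]
    unfolding v(1)
    by (cases h1; cases h2; cases v)
       (simp_all add: row_sum_add row_sum_scale X_def[symmetric] Y_def[symmetric] distrib_left
          mult.left_commute[of "cross_eq r x y"],
        simp_all add: cross_eq_def weight_g_def weight_a_def power2_eq_square algebra_simps)
qed

section \<open>Symmetry, special values and degree of the partition function\<close>

text \<open>
  The base case is the reflection equation: a crossing above two neighbouring diagonal
  vertices can be moved to the two rows that leave them, where \<open>row_sum_pair_YBE\<close> absorbs it.
  Rows above these two are passed by \<open>row_sum_YBE\<close>.
\<close>

lemma part_fn_YBE:
  assumes "length vs = length us1 + 2 + length us2"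
  shows "crossing r x y (length us1) (part_fn r s (us1 @ y # x # us2)) vs = cross_eq r x y * part_fn r s (us1 @ x # y # us2) vs"
  using assms
proof (induction us1 arbitrary: vs)
  case Nil
  then obtain a b vs' where v: "vs = a # b # vs'" "length vs' = length us2"
    by (cases vs; cases "tl vs") auto
  define X where "X k1 k2 = row_sum r y k1 us2 vs' (\<lambda>w. row_sum r x k2 us2 w (part_fn r s us2))" for k1 k2
  define Y where "Y k1 k2 = row_sum r x k1 us2 vs' (\<lambda>w. row_sum r y k2 us2 w (part_fn r s us2))" for k1 k2
  have IH: "cross_eq r x y * Y k1 k2 = (if k1 = k2 then cross_eq r x y * X k1 k2
     else r * weight_g r (if k1 then x else y) * X k1 k2 + (y - x) * X k2 k1)" for k1 k2
    unfolding X_def Y_def using row_sum_pair_YBE[OF v(2), where r = r and x = x and y = y and ?h1.0 = k1 and ?h2.0 = k2 and F = "part_fn r s us2"] by simp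
  have IHs: "cross_eq r x y * Y True True = cross_eq r x y * X True True"
     "cross_eq r x y * Y False False = cross_eq r x y * X False False"
     "cross_eq r x y * Y True False = r * weight_g r x * X True False + (y - x) * X False True"
     "cross_eq r x y * Y False True = r * weight_g r y * X False True + (y - x) * X True False"
    using IH[of True True] IH[of False False] IH[of True False] IH[of False True] by auto
  show ?case
    using IHs
    unfolding v(1)
    by (cases a; cases b)
       (simp_all add: row_sum_add row_sum_scale X_def[symmetric] Y_def[symmetric] distrib_left
          mult.left_commute[of "cross_eq r x y"],
        simp_all add: cross_eq_def weight_g_def weight_a_def power2_eq_square algebra_simps)
next
  case (Cons z us1)
  obtain c vs' where v: "vs = c # vs'" "length vs' = length us1 + 2 + length us2"
    using Cons.prems by (cases vs) auto
  have *: "crossing r x y (length us1) (\<lambda>w. row_sum r z h (us1 @ y # x # us2) w (part_fn r s (us1 @ y # x # us2))) vs'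
     = cross_eq r x y * row_sum r z h (us1 @ x # y # us2) vs' (part_fn r s (us1 @ x # y # us2))" for h
  proof -
    have "crossing r x y (length us1) (\<lambda>w. row_sum r z h (us1 @ y # x # us2) w (part_fn r s (us1 @ y # x # us2))) vs'
      = row_sum r z h (us1 @ x # y # us2) vs' (crossing r x y (length us1) (part_fn r s (us1 @ y # x # us2)))"
      by (rule row_sum_YBE) (use v in auto)
    also have "\<dots> = row_sum r z h (us1 @ x # y # us2) vs' (\<lambda>w. cross_eq r x y * part_fn r s (us1 @ x # y # us2) w)"
      by (rule row_sum_cong) (simp add: Cons.IH)
    finally show ?thesis by (simp add: row_sum_scale)
  qed
  show ?case unfolding v(1) by (simp add: crossing_add crossing_scale * algebra_simps)
qed

definition part_fn0 :: "'a::comm_ring_1 \<Rightarrow> 'a \<Rightarrow> 'a list \<Rightarrow> 'a" where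
  "part_fn0 r s us = part_fn r s us (replicate (length us) False)"

lemma crossing_replicate:
  "k + 2 \<le> n \<Longrightarrow> crossing r x y k F (replicate n False) = cross_eq r x y * F (replicate n False)"
proof (induction k arbitrary: n F)
  case 0
  then obtain m where "n = Suc (Suc m)" by (metis add_0 add_2_eq_Suc le_Suc_ex)
  thus ?case by simp
next
  case (Suc k)
  then obtain m where "n = Suc m" "k + 2 \<le> m" by (cases n) auto
  thus ?case using Suc.IH by simp
qed

text \<open>
  With all states False at the top, the crossing there only contributes the factor \<open>cross_eq\<close>
  as well.
\<close>

lemma part_fn0_swap:
  fixes r :: "'a::idom"
  assumes "cross_eq r x y \<noteq> 0"
  shows "part_fn0 r s (us1 @ y # x # us2) = part_fn0 r s (us1 @ x # y # us2)"
proof -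
  let ?v = "replicate (length us1 + 2 + length us2) False"
  have "crossing r x y (length us1) (part_fn r s (us1 @ y # x # us2)) ?v = cross_eq r x y * part_fn r s (us1 @ y # x # us2) ?v"
    by (rule crossing_replicate) simp
  moreover have "crossing r x y (length us1) (part_fn r s (us1 @ y # x # us2)) ?v = cross_eq r x y * part_fn r s (us1 @ x # y # us2) ?v"
    by (rule part_fn_YBE) simp
  ultimately have "part_fn r s (us1 @ y # x # us2) ?v = part_fn r s (us1 @ x # y # us2) ?v"
    using assms by (metis mult_left_cancel)
  thus ?thesis by (simp add: part_fn0_def)
qed

lemma row_sum_True_replicate:
  "row_sum r x True us (replicate (length us) False) F = (\<Prod>u\<leftarrow>us. weight_a r x u) * F (replicate (length us) False)"
  by (induction us arbitrary: F) (auto simp: mult.assoc)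

text \<open>
  For \<open>x = -1\<close> the weight \<open>1 + x\<close> vanishes, so the line turns True at its diagonal vertex.
  Then it differs from every column that it meets and stays True.
\<close>

lemma part_fn0_Cons_minus_one: "part_fn0 r s ((-1) # us) = s * (\<Prod>u\<leftarrow>us. weight_a r (-1) u) * part_fn0 r s us"
  by (simp add: part_fn0_def row_sum_True_replicate mult.assoc)

text \<open>
  If \<open>x * y = 1\<close>, then two equal states at the crossing of the first two lines must flip. The
  two ways to leave this corner with the first line True and the second False cancel, so both
  lines leave it as True and are frozen.
\<close>

lemma part_fn0_Cons_Cons_inverse:
  assumes "x * y = 1"
  shows "part_fn0 r s (x # y # us) = (s\<^sup>2 * weight_a r x y + r * (1 + x) * (1 + y)) *
           (\<Prod>u\<leftarrow>us. weight_a r x u * weight_a r y u) * part_fn0 r s us"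
proof -
  let ?v = "replicate (length us) False"
  define P where "P = (\<Prod>u\<leftarrow>us. weight_a r x u)"
  define P' where "P' = (\<Prod>u\<leftarrow>us. weight_a r y u)"
  define E where "E = row_sum r y False us ?v (part_fn r s us)"
  have PP: "(\<Prod>u\<leftarrow>us. weight_a r x u * weight_a r y u) = P * P'"
    unfolding P_def P'_def by (induction us) (auto simp: algebra_simps)
  \<comment> \<open>The two ways to leave the corner in states True, False cancel.\<close>
  have 0: "(1 + x) * r * weight_g r y + weight_a r x y * (1 + y) = 0"
  proof -
    have "(1 + x) * weight_g r y = (1 + y) * (x + y - r)"
    proof -
      have "(1 + x) * weight_g r y = (1 + y) * (x + y - r) + (x * y - 1) * (y - 1 - r)"
        by (simp add: weight_g_def power2_eq_square algebra_simps)
      thus ?thesis by (simp add: assms)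
    qed
    moreover have "weight_a r x y = r * (r - x - y)"
    proof -
      have "weight_a r x y = 1 - r * (x + y) + (r\<^sup>2 - 1) * (x * y)" by (simp add: weight_a_def algebra_simps)
      thus ?thesis by (simp add: assms power2_eq_square algebra_simps)
    qed
    moreover have "(1 + x) * r * weight_g r y + weight_a r x y * (1 + y) = r * ((1 + x) * weight_g r y) + (1 + y) * weight_a r x y"
      by (simp add: algebra_simps)
    ultimately show ?thesis by (simp only:) (simp add: algebra_simps)
  qed
  have "part_fn0 r s (x # y # us) = (1 + x) * (r * (P * ((1 + y) * (P' * part_fn r s us ?v) + s * weight_g r y * E)))
      + s * (weight_a r x y * (P * ((1 + y) * E + s * (P' * part_fn r s us ?v))))"
    unfolding part_fn0_def by (simp add: assms row_sum_True_replicate P_def P'_def E_def)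
  also have "\<dots> = (s\<^sup>2 * weight_a r x y + r * (1 + x) * (1 + y)) * (P * P') * part_fn r s us ?v
      + s * P * E * ((1 + x) * r * weight_g r y + weight_a r x y * (1 + y))"
    by (simp add: power2_eq_square algebra_simps)
  finally show ?thesis by (simp add: 0 PP part_fn0_def)
qed

lemma row_sum_last_True:
  assumes "length vs = length us"
  shows "row_sum r x h (us @ [l]) (vs @ [True]) F = (1 - x * l) * row_sum r x h us vs (\<lambda>w. F (w @ [True]))"
  using assms
proof (induction us arbitrary: vs h F)
  case Nil
  thus ?case by auto
next
  case (Cons u us)
  then obtain v vs' where "vs = v # vs'" "length vs' = length us" by (cases vs) auto
  thus ?case by (simp add: Cons.IH algebra_simps)
qed

text \<open>
  Once the last line is True it must meet every row as True, because a line that meets it as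
  False differs from it, keeps its state and leaves the row as False.
\<close>

lemma part_fn_last_True:
  assumes "length vs = length us"
  shows "part_fn r s (us @ [l]) (vs @ [True]) = (1 + l) * (\<Prod>u\<leftarrow>us. 1 - u * l) * part_fn r s us vs"
  using assms
proof (induction us arbitrary: vs)
  case Nil
  thus ?case by auto
next
  case (Cons u us)
  then obtain v vs' where v: "vs = v # vs'" "length vs' = length us" by (cases vs) auto
  have *: "row_sum r u h us vs' (\<lambda>w. part_fn r s (us @ [l]) (w @ [True]))
      = (1 + l) * (\<Prod>u\<leftarrow>us. 1 - u * l) * row_sum r u h us vs' (part_fn r s us)" for h
  proof -
    have "row_sum r u h us vs' (\<lambda>w. part_fn r s (us @ [l]) (w @ [True]))
      = row_sum r u h us vs' (\<lambda>w. (1 + l) * (\<Prod>u\<leftarrow>us. 1 - u * l) * part_fn r s us w)"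
      by (rule row_sum_cong) (simp add: Cons.IH)
    thus ?thesis by (simp add: row_sum_scale)
  qed
  show ?case using v by (simp add: row_sum_last_True * algebra_simps)
qed

lemma row_sum_last_weight_a_zero:
  assumes "weight_a r x l = 0"
  shows "row_sum r x True (us @ [l]) (replicate (length us) False @ [False]) F = 0"
    and "row_sum r x False (us @ [l]) (replicate (length us) False @ [False]) F
           = r * (\<Prod>u\<leftarrow>us. 1 - x * u) * F (replicate (length us) False @ [True])"
proof -
  have 1: "row_sum r x True (us @ [l]) (replicate (length us) False @ [False]) F = 0" for us F
    by (induction us arbitrary: F) (auto simp: assms)
  show "row_sum r x True (us @ [l]) (replicate (length us) False @ [False]) F = 0" by (rule 1)
  show "row_sum r x False (us @ [l]) (replicate (length us) False @ [False]) F
           = r * (\<Prod>u\<leftarrow>us. 1 - x * u) * F (replicate (length us) False @ [True])"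
    by (induction us arbitrary: F) (auto simp: 1 algebra_simps)
qed

text \<open>
  The first and the last line cross in the corner, where the first one has to leave as True.
  It cannot arrive there as True, because the two states would then differ, which has weight
  0; so it arrives as False and both lines flip. This freezes the first row and the last
  column.
\<close>

lemma part_fn0_weight_a_zero:
  assumes "weight_a r x l = 0"
  shows "part_fn0 r s (x # us @ [l]) = r * (1 + x) * (1 + l) * (\<Prod>u\<leftarrow>us. (1 - x * u) * (1 - l * u)) * part_fn0 r s us"
proof -
  have "(\<Prod>u\<leftarrow>us. (1 - x * u) * (1 - l * u)) = (\<Prod>u\<leftarrow>us. 1 - x * u) * (\<Prod>u\<leftarrow>us. 1 - u * l)"
    by (induction us) (auto simp: algebra_simps)
  moreover have "part_fn0 r s (x # us @ [l]) = part_fn r s (x # us @ [l]) (False # replicate (length us) False @ [False])"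
    by (simp add: part_fn0_def replicate_append_same)
  ultimately show ?thesis
    using row_sum_last_weight_a_zero[OF assms, of us] by (simp add: part_fn_last_True part_fn0_def algebra_simps)
qed

text \<open>
  A crossing at which the line is kept has degree at most 1 in \<open>x\<close>; going down costs degree 2,
  going up degree 0. A row that starts as False goes up once more than it goes down, so its
  degree is lower by one than that of a row that starts as True. No path leads from False to
  True without a crossing, hence the condition for the empty row.
\<close>

lemma row_sum_poly:
  fixes r :: "'a::idom"
  assumes "length vs = length us"
  shows "(\<exists>p. degree p \<le> length us \<and> (\<forall>x. poly p x = row_sum r x True us vs F)) \<and>
         (\<exists>p. degree p \<le> length us - 1 \<and> (us = [] \<longrightarrow> p = 0) \<and> (\<forall>x. poly p x = row_sum r x False us vs F))"
  using assms
proof (induction us arbitrary: vs F)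
  case Nil
  thus ?case by (auto intro!: exI[of _ "[: F [] :]"])
next
  case (Cons u us)
  then obtain v vs' where v: "vs = v # vs'" "length vs' = length us" by (cases vs) auto
  have "\<forall>c. \<exists>p. degree p \<le> length us \<and> (\<forall>x. poly p x = row_sum r x True us vs' (\<lambda>w. F (c # w)))"
    using Cons.IH[OF v(2)] by blast
  from choice[OF this] obtain pT where pT: "\<And>c. degree (pT c) \<le> length us"
      "\<And>c x. poly (pT c) x = row_sum r x True us vs' (\<lambda>w. F (c # w))"
    by blast
  have "\<forall>c. \<exists>p. degree p \<le> length us - 1 \<and> (us = [] \<longrightarrow> p = 0) \<and>
      (\<forall>x. poly p x = row_sum r x False us vs' (\<lambda>w. F (c # w)))"
    using Cons.IH[OF v(2)] by blast
  from choice[OF this] obtain pF where pF: "\<And>c. degree (pF c) \<le> length us - 1" "\<And>c. us = [] \<Longrightarrow> pF c = 0"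
      "\<And>c x. poly (pF c) x = row_sum r x False us vs' (\<lambda>w. F (c # w))"
    by blast
  have d1: "degree ([:a, b:] * p) \<le> Suc n" if "degree p \<le> n" for a b :: 'a and p n
    using that degree_mult_le[of "[:a, b:]" p] by (auto split: if_splits)
  have d2: "degree ([:a, b, c:] * p) \<le> Suc (Suc n)" if "degree p \<le> n" for a b c :: 'a and p n
    using that degree_mult_le[of "[:a, b, c:]" p] by (auto split: if_splits)
  have dF: "degree ([:a, b:] * pF d) \<le> length us" for a b d
    using d1[OF pF(1), of a b d] pF(2)[of d] by (cases us) auto
  have dF2: "degree ([:a, b, c:] * pF d) \<le> Suc (length us)" for a b c d
    using d2[OF pF(1), of a b c d] pF(2)[of d] by (cases us) auto
  have T: "\<exists>p. degree p \<le> Suc (length us) \<and> (\<forall>x. poly p x = row_sum r x True (u # us) vs F)"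
  proof (cases v)
    case True
    let ?p = "[:1, - u:] * pT True + [:r * weight_g r u, - r * r * weight_g r u, r * weight_g r u:] * pF False"
    have "degree ?p \<le> Suc (length us)" by (intro degree_add_le d1 dF2 pT)
    moreover have "poly ?p x = row_sum r x True (u # us) vs F" for x
      by (simp add: v True pT pF weight_g_def[of r x] power2_eq_square algebra_simps)
    ultimately show ?thesis by blast
  next
    case False
    let ?p = "[:1 - r * u, - r + (r\<^sup>2 - 1) * u:] * pT False"
    have "degree ?p \<le> Suc (length us)" by (intro d1 pT)
    moreover have "poly ?p x = row_sum r x True (u # us) vs F" for x
      by (simp add: v False pT weight_a_def algebra_simps)
    ultimately show ?thesis by blast
  qed
  have F: "\<exists>p. degree p \<le> length us \<and> (\<forall>x. poly p x = row_sum r x False (u # us) vs F)"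
  proof (cases v)
    case False
    let ?p = "[:1, - u:] * pF False + [:r:] * pT True"
    have "degree ?p \<le> length us" using pT(1)[of True] degree_mult_le[of "[:r:]" "pT True"]
      by (intro degree_add_le dF) auto
    moreover have "poly ?p x = row_sum r x False (u # us) vs F" for x
      by (simp add: v False pT pF algebra_simps)
    ultimately show ?thesis by blast
  next
    case True
    let ?p = "[:1 - r * u, - r + (r\<^sup>2 - 1) * u:] * pF True"
    have "degree ?p \<le> length us" by (intro dF)
    moreover have "poly ?p x = row_sum r x False (u # us) vs F" for x
      by (simp add: v True pF weight_a_def algebra_simps)
    ultimately show ?thesis by blast
  qed
  show ?case using T F by auto
qed

lemma part_fn0_Cons_poly:
  fixes r :: "'a::idom"
  shows "\<exists>p. degree p \<le> length us \<and> (\<forall>x. poly p x = part_fn0 r s (x # us))"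
proof -
  let ?v = "replicate (length us) False"
  obtain p where p: "degree p \<le> length us" "\<And>x. poly p x = row_sum r x True us ?v (part_fn r s us)"
    using row_sum_poly[of ?v us] by fastforce
  obtain q where q: "degree q \<le> length us - 1" "us = [] \<Longrightarrow> q = 0" "\<And>x. poly q x = row_sum r x False us ?v (part_fn r s us)"
    using row_sum_poly[of ?v us] by fastforce
  have "degree ([:1, 1:] * q) \<le> length us"
    using q(1,2) degree_mult_le[of "[:1, 1:]" q] by (cases us) auto
  hence "degree ([:1, 1:] * q + [:s:] * p) \<le> length us"
    using p(1) degree_mult_le[of "[:s:]" p] by (intro degree_add_le) auto
  moreover have "poly ([:1, 1:] * q + [:s:] * p) x = part_fn0 r s (x # us)" for x
    by (simp add: part_fn0_def p q algebra_simps)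
  ultimately show ?thesis by blast
qed

lemma (in comm_ring_hom) hom_row_sum:
  "hom (row_sum r x h us vs F) = row_sum (hom r) (hom x) h (map hom us) vs (\<lambda>w. hom (F w))"
proof (induction us arbitrary: h vs F)
  case Nil
  show ?case by (cases vs) auto
next
  case (Cons u us)
  show ?case by (cases vs) (simp_all add: Cons.IH hom_distribs weight_a_def weight_g_def)
qed

lemma (in comm_ring_hom) hom_part_fn: "hom (part_fn r s us vs) = part_fn (hom r) (hom s) (map hom us) vs"
proof (induction us arbitrary: vs)
  case Nil
  show ?case by auto
next
  case (Cons u us)
  show ?case by (cases vs) (simp_all add: hom_row_sum Cons.IH hom_distribs weight_a_def weight_g_def)
qed

lemma (in comm_ring_hom) hom_part_fn0: "hom (part_fn0 r s us) = part_fn0 (hom r) (hom s) (map hom us)"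
  by (simp add: part_fn0_def hom_part_fn)

section \<open>Symmetric alternating sign matrices as configurations\<close>

definition nonzeros :: "int list \<Rightarrow> nat" where "nonzeros a = length (filter (\<lambda>x. x \<noteq> 0) a)"

fun admissible_rows :: "bool \<Rightarrow> bool list \<Rightarrow> int list set" where
  "admissible_rows h [] = (if h then {[]} else {})"
| "admissible_rows h (v # vs) = (#) 0 ` admissible_rows h vs \<union>
     (if h = v then (#) (if h then - 1 else 1) ` admissible_rows (\<not> h) vs else {})"

definition next_states :: "bool list \<Rightarrow> int list \<Rightarrow> bool list" where
  "next_states vs a = map2 (\<lambda>v x. if x = 0 then v else \<not> v) vs a"

lemma admissible_rows_length: "a \<in> admissible_rows h vs \<Longrightarrow> length a = length vs"
  by (induction vs arbitrary: h a) (auto split: if_splits)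

lemma finite_admissible_rows: "finite (admissible_rows h vs)"
  by (induction vs arbitrary: h) auto

text \<open>
  At parameter 0 the path of a line is recorded by the matrix entries of the row: an entry is
  the change of the state at that crossing.
\<close>

lemma row_sum_zero:
  "row_sum r 0 h (replicate (length vs) 0) vs F = (\<Sum>a\<in>admissible_rows h vs. r ^ nonzeros a * F (next_states vs a))"
proof (induction vs arbitrary: h F)
  case Nil
  show ?case by (simp add: nonzeros_def next_states_def)
next
  case (Cons v vs)
  have s: "(\<Sum>a\<in>(#) x ` admissible_rows h' vs. r ^ nonzeros a * F (next_states (v # vs) a)) =
     (\<Sum>a\<in>admissible_rows h' vs. r ^ (nonzeros [x] + nonzeros a) * F ((if x = 0 then v else \<not> v) # next_states vs a))" for x h'
    by (subst sum.reindex) (auto simp: nonzeros_def next_states_def)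
  show ?case
  proof (cases "h = v")
    case True
    have "(\<Sum>a\<in>admissible_rows h (v # vs). r ^ nonzeros a * F (next_states (v # vs) a)) =
       (\<Sum>a\<in>(#) 0 ` admissible_rows h vs. r ^ nonzeros a * F (next_states (v # vs) a)) +
       (\<Sum>a\<in>(#) (if h then - 1 else 1) ` admissible_rows (\<not> h) vs. r ^ nonzeros a * F (next_states (v # vs) a))"
      unfolding admissible_rows.simps(2) if_P[OF True]
      by (rule sum.union_disjoint) (auto simp: finite_admissible_rows)
    thus ?thesis unfolding s using True
      by (simp add: Cons.IH nonzeros_def weight_g_def sum_distrib_left mult.assoc)
  next
    case False
    thus ?thesis using s[of 0 h] by (simp add: Cons.IH nonzeros_def weight_a_def)
  qed
qed

text \<open>
  Upper triangular halves of symmetric matrices, as lists of rows that start at the diagonal.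
  The matrix may continue a larger one: \<open>vs\<close> records the partial column sums above it.
\<close>

fun arrays :: "nat \<Rightarrow> bool list \<Rightarrow> int list list set" where
  "arrays 0 vs = {[]}"
| "arrays (Suc n) vs =
     (\<lambda>(a, T). (0 # a) # T) ` (SIGMA a:admissible_rows (hd vs) (tl vs). arrays n (next_states (tl vs) a)) \<union>
     (\<lambda>(a, T). ((if hd vs then - 1 else 1) # a) # T) `
        (SIGMA a:admissible_rows (\<not> hd vs) (tl vs). arrays n (next_states (tl vs) a))"

definition off_nz :: "int list list \<Rightarrow> nat" where "off_nz T = (\<Sum>a\<leftarrow>T. nonzeros (tl a))"
definition diag_nz :: "int list list \<Rightarrow> nat" where "diag_nz T = (\<Sum>a\<leftarrow>T. nonzeros [hd a])"

lemma finite_arrays: "finite (arrays n vs)"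
  by (induction n arbitrary: vs) (auto simp: finite_admissible_rows)

lemma length_next_states: "length a = length vs \<Longrightarrow> length (next_states vs a) = length vs"
  by (simp add: next_states_def)

lemma part_fn_zero:
  assumes "length vs = n"
  shows "part_fn r s (replicate n 0) vs = (\<Sum>T\<in>arrays n vs. r ^ off_nz T * s ^ diag_nz T)"
  using assms
proof (induction n arbitrary: vs)
  case 0
  thus ?case by (simp add: off_nz_def diag_nz_def)
next
  case (Suc n)
  then obtain c vs' where v: "vs = c # vs'" "length vs' = n" by (cases vs) auto
  have R: "row_sum r 0 h (replicate n 0) vs' (part_fn r s (replicate n 0)) =
     (\<Sum>a\<in>admissible_rows h vs'. \<Sum>T\<in>arrays n (next_states vs' a). r ^ nonzeros a * (r ^ off_nz T * s ^ diag_nz T))" for h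
  proof -
    have "row_sum r 0 h (replicate n 0) vs' (part_fn r s (replicate n 0)) =
      (\<Sum>a\<in>admissible_rows h vs'. r ^ nonzeros a * part_fn r s (replicate n 0) (next_states vs' a))"
      using row_sum_zero[of r h vs' "part_fn r s (replicate n 0)"] v(2) by simp
    also have "\<dots> = (\<Sum>a\<in>admissible_rows h vs'. r ^ nonzeros a * (\<Sum>T\<in>arrays n (next_states vs' a). r ^ off_nz T * s ^ diag_nz T))"
    proof (intro sum.cong refl arg_cong2[where f = "(*)"] Suc.IH)
      fix a assume "a \<in> admissible_rows h vs'"
      thus "length (next_states vs' a) = n" using v(2) admissible_rows_length length_next_states by metis
    qed
    finally show ?thesis by (simp add: sum_distrib_left)
  qed
  have S: "(\<Sum>T\<in>(\<lambda>(a, T). (x # a) # T) ` (SIGMA a:admissible_rows h vs'. arrays n (next_states vs' a)). r ^ off_nz T * s ^ diag_nz T)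
     = s ^ nonzeros [x] * row_sum r 0 h (replicate n 0) vs' (part_fn r s (replicate n 0))" for x h
  proof -
    have "(\<Sum>T\<in>(\<lambda>(a, T). (x # a) # T) ` (SIGMA a:admissible_rows h vs'. arrays n (next_states vs' a)). r ^ off_nz T * s ^ diag_nz T)
      = (\<Sum>(a, T)\<in>(SIGMA a:admissible_rows h vs'. arrays n (next_states vs' a)). s ^ nonzeros [x] * (r ^ nonzeros a * (r ^ off_nz T * s ^ diag_nz T)))"
      by (subst sum.reindex)
         (auto simp: inj_on_def off_nz_def diag_nz_def power_add mult_ac intro!: sum.cong)
    thus ?thesis unfolding R
      by (simp add: sum.Sigma finite_admissible_rows finite_arrays sum_distrib_left case_prod_unfold)
  qed
  have "(\<Sum>T\<in>arrays (Suc n) vs. r ^ off_nz T * s ^ diag_nz T) =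
     s ^ nonzeros [0] * row_sum r 0 c (replicate n 0) vs' (part_fn r s (replicate n 0)) +
     s ^ nonzeros [if c then - 1 else 1] * row_sum r 0 (\<not> c) (replicate n 0) vs' (part_fn r s (replicate n 0))"
    unfolding S[symmetric] v(1) arrays.simps list.sel
    by (rule sum.union_disjoint) (auto simp: finite_admissible_rows finite_arrays)
  thus ?case by (simp add: v nonzeros_def weight_g_def)
qed

definition bit_int :: "bool \<Rightarrow> int" where "bit_int b = (if b then 1 else 0)"

lemma bit_int_simps [simp]: "bit_int True = 1" "bit_int False = 0" by (auto simp: bit_int_def)

lemma bit_int_range: "bit_int b \<in> {0, 1}" by (auto simp: bit_int_def)

lemma next_states_nth:
  assumes "i < length vs" "length a = length vs" "bit_int (vs ! i) + a ! i \<in> {0, 1}"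
  shows "bit_int (next_states vs a ! i) = bit_int (vs ! i) + a ! i"
  using assms by (cases "vs ! i") (auto simp: next_states_def)

lemma all_le_Suc: "(\<forall>k\<le>Suc n. P k) \<longleftrightarrow> P 0 \<and> (\<forall>k\<le>n. P (Suc k))"
  by (simp only: less_Suc_eq_le[symmetric] All_less_Suc2)

text \<open>
  Rows are generated entry by entry, but the definition of alternating sign matrices concerns
  partial sums; this translates one into the other.
\<close>

lemma admissible_rows_iff:
  assumes "length a = length vs"
  shows "a \<in> admissible_rows h vs \<longleftrightarrow>
     (\<forall>k\<le>length vs. bit_int h + (\<Sum>i<k. a ! i) \<in> {0, 1}) \<and> bit_int h + (\<Sum>i<length vs. a ! i) = 1 \<and>
     (\<forall>i<length vs. bit_int (vs ! i) + a ! i \<in> {0, 1})"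
  using assms
proof (induction vs arbitrary: h a)
  case Nil
  thus ?case by (auto simp: bit_int_def)
next
  case (Cons v vs)
  then obtain x a' where a: "a = x # a'" "length a' = length vs" by (cases a) auto
  note IH = Cons.IH[OF a(2)]
  have *: "(\<forall>k\<le>length (v # vs). bit_int h + (\<Sum>i<k. a ! i) \<in> {0, 1}) \<and> bit_int h + (\<Sum>i<length (v # vs). a ! i) = 1 \<and>
     (\<forall>i<length (v # vs). bit_int ((v # vs) ! i) + a ! i \<in> {0, 1}) \<longleftrightarrow>
     bit_int h + x \<in> {0, 1} \<and> bit_int v + x \<in> {0, 1} \<and>
     (\<forall>k\<le>length vs. (bit_int h + x) + (\<Sum>i<k. a' ! i) \<in> {0, 1}) \<and> (bit_int h + x) + (\<Sum>i<length vs. a' ! i) = 1 \<and>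
     (\<forall>i<length vs. bit_int (vs ! i) + a' ! i \<in> {0, 1})"
    unfolding a list.size add_0_right add_Suc_right all_le_Suc All_less_Suc2 sum.lessThan_Suc_shift
    using bit_int_range[of h] by (auto simp: add.assoc)
  show ?case
  proof (cases "bit_int h + x \<in> {0, 1} \<and> bit_int v + x \<in> {0, 1}")
    case False
    thus ?thesis unfolding * unfolding a by (auto simp: bit_int_def split: if_splits)
  next
    case True
    consider "x = 0" | "h = v" "x = (if h then -1 else 1)" using True by (auto simp: bit_int_def split: if_splits)
    thus ?thesis
    proof cases
      case 1
      thus ?thesis unfolding * using True IH[of h] a by auto
    next
      case 2
      hence "bit_int h + x = bit_int (\<not> h)" "x \<noteq> 0" by (auto simp: bit_int_def)
      thus ?thesis unfolding * using True IH[of "\<not> h"] a 2 by auto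
    qed
  qed
qed

definition half :: "nat \<Rightarrow> (nat \<Rightarrow> nat \<Rightarrow> int) \<Rightarrow> int list list" where
  "half n A = map (\<lambda>i. map (A i) [i..<n]) [0..<n]"

lemma half_Suc: "half (Suc n) A = map (A 0) [0..<Suc n] # half n (\<lambda>i j. A (Suc i) (Suc j))"
proof -
  have m: "map f [Suc i..<Suc k] = map (f \<circ> Suc) [i..<k]" for f :: "nat \<Rightarrow> 'b" and i k
    by (simp add: map_Suc_upt[symmetric] del: upt_Suc)
  have "half (Suc n) A = map (A 0) [0..<Suc n] # map (\<lambda>i. map (A i) [i..<Suc n]) [Suc 0..<Suc n]"
    unfolding half_def by (subst upt_conv_Cons) (simp_all del: upt_Suc)
  thus ?thesis unfolding m by (simp add: half_def m comp_def del: upt_Suc)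
qed

text \<open>
  Symmetry makes the conditions on columns sufficient: the row condition for index \<open>j\<close> is its
  column condition.
\<close>

definition column_ok :: "nat \<Rightarrow> bool list \<Rightarrow> (nat \<Rightarrow> nat \<Rightarrow> int) \<Rightarrow> bool" where
  "column_ok n vs A \<longleftrightarrow> (\<forall>j<n. (\<forall>k\<le>n. bit_int (vs ! j) + (\<Sum>i<k. A i j) \<in> {0, 1}) \<and> bit_int (vs ! j) + (\<Sum>i<n. A i j) = 1)"

text \<open>
  Induction on the size: the first row of a symmetric matrix is also its first column. The
  remaining columns form a smaller matrix whose partial sums start from the updated states.
\<close>

lemma half_in_arrays_iff:
  assumes "length vs = n" "\<And>i j. i < n \<Longrightarrow> j < n \<Longrightarrow> A i j = A j i"
  shows "half n A \<in> arrays n vs \<longleftrightarrow> column_ok n vs A"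
  using assms
proof (induction n arbitrary: vs A)
  case 0
  thus ?case by (simp add: half_def column_ok_def)
next
  case (Suc n)
  then obtain c vs' where v: "vs = c # vs'" "length vs' = n" by (cases vs) auto
  define a where "a = map (A 0 \<circ> Suc) [0..<n]"
  have a: "length a = n" "\<And>i. i < n \<Longrightarrow> a ! i = A 0 (Suc i)" by (auto simp: a_def)
  have row0: "map (A 0) [0..<Suc n] = A 0 0 # a"
    by (simp add: a_def upt_conv_Cons map_Suc_upt[symmetric] del: upt_Suc)
  let ?A = "\<lambda>i j. A (Suc i) (Suc j)"
  have sym: "A i 0 = A 0 i" if "i < Suc n" for i using Suc.prems(2) that by blast
  have IH: "half n ?A \<in> arrays n (next_states vs' a) \<longleftrightarrow> column_ok n (next_states vs' a) ?A"
    by (rule Suc.IH) (use v a length_next_states Suc.prems(2) in auto)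
  have asum: "(\<Sum>i<k. A (Suc i) 0) = (\<Sum>i<k. a ! i)" if "k \<le> n" for k
    by (intro sum.cong refl) (use that a sym in auto)
  have col0: "(\<forall>k\<le>Suc n. bit_int c + (\<Sum>i<k. A i 0) \<in> {0, 1}) \<and> bit_int c + (\<Sum>i<Suc n. A i 0) = 1 \<longleftrightarrow>
     bit_int c + A 0 0 \<in> {0, 1} \<and> (\<forall>k\<le>n. (bit_int c + A 0 0) + (\<Sum>i<k. a ! i) \<in> {0, 1}) \<and> (bit_int c + A 0 0) + (\<Sum>i<n. a ! i) = 1"
    unfolding all_le_Suc sum.lessThan_Suc_shift using bit_int_range[of c] asum by (auto simp: add.assoc)
  have colj: "(\<forall>k\<le>Suc n. bit_int (vs' ! j) + (\<Sum>i<k. A i (Suc j)) \<in> {0, 1}) \<and> bit_int (vs' ! j) + (\<Sum>i<Suc n. A i (Suc j)) = 1 \<longleftrightarrow>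
     bit_int (vs' ! j) + a ! j \<in> {0, 1} \<and> (\<forall>k\<le>n. bit_int (next_states vs' a ! j) + (\<Sum>i<k. ?A i j) \<in> {0, 1})
       \<and> bit_int (next_states vs' a ! j) + (\<Sum>i<n. ?A i j) = 1" if j: "j < n" for j
  proof (cases "bit_int (vs' ! j) + a ! j \<in> {0, 1}")
    case True
    have "bit_int (next_states vs' a ! j) = bit_int (vs' ! j) + a ! j" by (rule next_states_nth) (use True v a j in auto)
    thus ?thesis unfolding all_le_Suc sum.lessThan_Suc_shift
      using bit_int_range[of "vs' ! j"] a(2)[OF j] True by (auto simp: add.assoc)
  next
    case False
    have "bit_int (vs' ! j) + (\<Sum>i<1. A i (Suc j)) \<notin> {0, 1}" using False a(2)[OF j] by simp
    thus ?thesis using False by (metis One_nat_def Suc_le_mono le0)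
  qed
  have "column_ok (Suc n) vs A \<longleftrightarrow>
     (bit_int c + A 0 0 \<in> {0, 1} \<and> (\<forall>k\<le>n. (bit_int c + A 0 0) + (\<Sum>i<k. a ! i) \<in> {0, 1}) \<and> (bit_int c + A 0 0) + (\<Sum>i<n. a ! i) = 1) \<and>
     (\<forall>j<n. bit_int (vs' ! j) + a ! j \<in> {0, 1}) \<and> column_ok n (next_states vs' a) ?A"
    unfolding column_ok_def All_less_Suc2 v(1) nth_Cons_0 nth_Cons_Suc col0 using colj by blast
  also have "\<dots> \<longleftrightarrow> half (Suc n) A \<in> arrays (Suc n) vs"
  proof (cases "bit_int c + A 0 0 \<in> {0, 1}")
    case False
    thus ?thesis unfolding half_Suc row0 by (auto simp: v bit_int_def split: if_splits)
  next
    case True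
    then consider "A 0 0 = 0" | "A 0 0 = (if c then -1 else 1)" by (auto simp: bit_int_def split: if_splits)
    thus ?thesis
    proof cases
      case 1
      have "half (Suc n) A \<in> arrays (Suc n) vs \<longleftrightarrow> a \<in> admissible_rows c vs' \<and> half n ?A \<in> arrays n (next_states vs' a)"
        unfolding half_Suc row0 1 by (auto simp: v)
      thus ?thesis using admissible_rows_iff[of a vs' c] a v IH 1 bit_int_range[of c] by auto
    next
      case 2
      hence i: "bit_int c + A 0 0 = bit_int (\<not> c)" by (auto simp: bit_int_def)
      have "half (Suc n) A \<in> arrays (Suc n) vs \<longleftrightarrow> a \<in> admissible_rows (\<not> c) vs' \<and> half n ?A \<in> arrays n (next_states vs' a)"
        unfolding half_Suc row0 2 by (auto simp: v)
      thus ?thesis unfolding i using admissible_rows_iff[of a vs' "\<not> c"] a v IH bit_int_range[of "\<not> c"] by auto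
    qed
  qed
  finally show ?case by simp
qed

text \<open>
  As nonzero entries alternate, the sum over an interval is 0 or the last nonzero entry in it.
\<close>

lemma alternating_partial_sums:
  fixes f :: "nat \<Rightarrow> int"
  assumes f: "\<And>i. i < n \<Longrightarrow> f i \<in> {-1, 0, 1}"
    and alt: "\<And>i j. i < j \<Longrightarrow> j < n \<Longrightarrow> f i \<noteq> 0 \<Longrightarrow> f j \<noteq> 0 \<Longrightarrow> (\<And>k. i < k \<Longrightarrow> k < j \<Longrightarrow> f k = 0) \<Longrightarrow> f j = - f i"
    and ab: "a \<le> b" "b \<le> n"
  shows "(\<Sum>i=a..<b. f i) \<in> {-1, 0, 1}"
proof -
  have "((\<Sum>i=a..<b. f i) = 0 \<and> (\<forall>i. a \<le> i \<longrightarrow> i < b \<longrightarrow> f i = 0)) \<or>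
    (\<exists>l. a \<le> l \<and> l < b \<and> f l \<noteq> 0 \<and> (\<forall>i. l < i \<longrightarrow> i < b \<longrightarrow> f i = 0) \<and> (\<Sum>i=a..<b. f i) \<in> {0, f l})"
    using ab
  proof (induction b rule: dec_induct)
    case base
    thus ?case by simp
  next
    case (step b)
    have sum: "(\<Sum>i=a..<Suc b. f i) = (\<Sum>i=a..<b. f i) + f b" using step.hyps by simp
    show ?case
    proof (cases "f b = 0")
      case True
      thus ?thesis unfolding sum using step.IH step.prems by (auto simp: less_Suc_eq)
    next
      case False
      from step.IH step.prems consider "(\<Sum>i=a..<b. f i) = 0" |
        l where "a \<le> l" "l < b" "f l \<noteq> 0" "\<forall>i. l < i \<longrightarrow> i < b \<longrightarrow> f i = 0" "(\<Sum>i=a..<b. f i) \<in> {0, f l}"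
        by fastforce
      thus ?thesis
      proof cases
        case 1
        thus ?thesis unfolding sum using False step.hyps by (intro disjI2 exI[of _ b]) auto
      next
        case 2
        hence "f b = - f l" using alt[of l b] False step.prems by auto
        thus ?thesis unfolding sum using 2 False step.hyps by (intro disjI2 exI[of _ b]) auto
      qed
    qed
  qed
  thus ?thesis
  proof (elim disjE exE conjE)
    fix l assume "l < b" "(\<Sum>i=a..<b. f i) \<in> {0, f l}"
    thus ?thesis using f[of l] ab by auto
  qed simp
qed

text \<open>
  Initial and final segments both have sums in \<open>{-1, 0, 1}\<close> and together sum to 1, so an
  initial segment cannot sum to -1. Conversely, partial sums in \<open>{0, 1}\<close> can only go up and
  down in turn.
\<close>

lemma asm_line_iff:
  fixes v :: "int vec"
  assumes v: "\<And>i. i < dim_vec v \<Longrightarrow> v $ i \<in> {-1, 0, 1}"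
  shows "asm_line v \<longleftrightarrow> (\<forall>k\<le>dim_vec v. (\<Sum>i<k. v $ i) \<in> {0, 1}) \<and> (\<Sum>i<dim_vec v. v $ i) = 1"
proof
  assume a: "asm_line v"
  have tot: "(\<Sum>i<dim_vec v. v $ i) = 1" using a by (simp add: asm_line_def)
  have alt: "v $ j = - (v $ i)" if "i < j" "j < dim_vec v" "v $ i \<noteq> 0" "v $ j \<noteq> 0"
      "\<And>k. i < k \<Longrightarrow> k < j \<Longrightarrow> v $ k = 0" for i j
  proof -
    have "sgn (v $ j) = - sgn (v $ i)" using a that unfolding asm_line_def by blast
    moreover have "v $ i \<in> {-1, 0, 1}" "v $ j \<in> {-1, 0, 1}"
      by (rule v, use that in simp)+
    ultimately show ?thesis using that by auto
  qed
  have "(\<Sum>i<k. v $ i) \<in> {0, 1}" if k: "k \<le> dim_vec v" for k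
  proof -
    have "(\<Sum>i=0..<k. v $ i) \<in> {-1, 0, 1}" "(\<Sum>i=k..<dim_vec v. v $ i) \<in> {-1, 0, 1}"
      by (rule alternating_partial_sums[of "dim_vec v"]; use v alt k in auto)+
    moreover have "(\<Sum>i=0..<k. v $ i) + (\<Sum>i=k..<dim_vec v. v $ i) = 1"
      unfolding sum.atLeastLessThan_concat[OF le0 k] using tot by (simp add: atLeast0LessThan)
    ultimately show ?thesis by (auto simp: atLeast0LessThan)
  qed
  thus "(\<forall>k\<le>dim_vec v. (\<Sum>i<k. v $ i) \<in> {0, 1}) \<and> (\<Sum>i<dim_vec v. v $ i) = 1" using tot by blast
next
  assume p: "(\<forall>k\<le>dim_vec v. (\<Sum>i<k. v $ i) \<in> {0, 1}) \<and> (\<Sum>i<dim_vec v. v $ i) = 1"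
  have "sgn (v $ j) = - sgn (v $ i)" if ij: "i < j" "j < dim_vec v" "v $ i \<noteq> 0" "v $ j \<noteq> 0"
      "\<And>k. i < k \<Longrightarrow> k < j \<Longrightarrow> v $ k = 0" for i j
  proof -
    have "(\<Sum>k<j. v $ k) = (\<Sum>k<Suc i. v $ k)"
      by (rule sum.mono_neutral_right) (use ij in auto)
    moreover have "(\<Sum>k<i. v $ k) \<in> {0, 1}" "(\<Sum>k<Suc i. v $ k) \<in> {0, 1}" "(\<Sum>k<Suc j. v $ k) \<in> {0, 1}"
      using p ij by (auto simp del: sum.lessThan_Suc)
    moreover have "v $ i \<in> {-1, 0, 1}" "v $ j \<in> {-1, 0, 1}"
      by (rule v, use ij in simp)+
    ultimately show ?thesis using ij(3,4) by (auto simp: sgn_if)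
  qed
  thus "asm_line v" using p unfolding asm_line_def by blast
qed

lemma DSASM_iff:
  assumes A: "A \<in> carrier_mat n n" and sym: "\<And>i j. i < n \<Longrightarrow> j < n \<Longrightarrow> A $$ (i, j) = A $$ (j, i)"
  shows "A \<in> DSASM n \<longleftrightarrow> column_ok n (replicate n False) (\<lambda>i j. A $$ (i, j))"
proof -
  have T: "transpose_mat A = A" using A sym by (intro eq_matI) auto
  have el: "elements_mat A \<subseteq> {0, 1, -1} \<longleftrightarrow> (\<forall>i<n. \<forall>j<n. A $$ (i, j) \<in> {-1, 0, 1})"
    using A by (fastforce simp: elements_mat_def)
  have rc: "Matrix.row A i = col A i" if "i < n" for i
    using A that sym by (intro eq_vecI) auto
  have D: "A \<in> DSASM n \<longleftrightarrow> (\<forall>i<n. \<forall>j<n. A $$ (i, j) \<in> {-1, 0, 1}) \<and> (\<forall>j<n. asm_line (col A j))"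
    using A T rc unfolding DSASM_def ASM_def el[symmetric] by auto
  have line: "asm_line (col A j) \<longleftrightarrow> (\<forall>k\<le>n. (\<Sum>i<k. A $$ (i, j)) \<in> {0, 1}) \<and> (\<Sum>i<n. A $$ (i, j)) = 1"
    if "j < n" "\<forall>i<n. \<forall>j<n. A $$ (i, j) \<in> {-1, 0, 1}" for j
  proof -
    have s: "(\<Sum>i<k. col A j $ i) = (\<Sum>i<k. A $$ (i, j))" if "k \<le> n" for k
      by (intro sum.cong refl) (use A \<open>j < n\<close> that in auto)
    have d: "dim_vec (col A j) = n" using A by simp
    have "asm_line (col A j) \<longleftrightarrow> (\<forall>k\<le>n. (\<Sum>i<k. col A j $ i) \<in> {0, 1}) \<and> (\<Sum>i<n. col A j $ i) = 1"
      by (subst asm_line_iff) (use A that in \<open>auto simp: d\<close>)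
    thus ?thesis using s by auto
  qed
  have ent: "A $$ (i, j) \<in> {-1, 0, 1}" if c: "column_ok n (replicate n False) (\<lambda>i j. A $$ (i, j))" and ij: "i < n" "j < n" for i j
  proof -
    have "(\<Sum>k<i. A $$ (k, j)) \<in> {0, 1}" "(\<Sum>k<Suc i. A $$ (k, j)) \<in> {0, 1}"
      using c ij unfolding column_ok_def by (auto simp del: sum.lessThan_Suc)
    thus ?thesis by auto
  qed
  show ?thesis
  proof
    assume "A \<in> DSASM n"
    thus "column_ok n (replicate n False) (\<lambda>i j. A $$ (i, j))"
      using line unfolding D column_ok_def by auto
  next
    assume c: "column_ok n (replicate n False) (\<lambda>i j. A $$ (i, j))"
    hence e: "\<forall>i<n. \<forall>j<n. A $$ (i, j) \<in> {-1, 0, 1}" using ent by blast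
    thus "A \<in> DSASM n" using line[OF _ e] c unfolding D column_ok_def by auto
  qed
qed

lemma arrays_shape:
  assumes "T \<in> arrays n vs" "length vs = n"
  shows "length T = n \<and> (\<forall>i<n. length (T ! i) = n - i)"
  using assms
proof (induction n arbitrary: T vs)
  case (Suc n)
  from Suc.prems(1) obtain x a T' where T: "T = (x # a) # T'" "T' \<in> arrays n (next_states (tl vs) a)" "length a = length (tl vs)"
    by (auto dest: admissible_rows_length)
  have "length T' = n \<and> (\<forall>i<n. length (T' ! i) = n - i)"
    by (rule Suc.IH[OF T(2)]) (use T(3) Suc.prems(2) in \<open>auto simp: length_next_states\<close>)
  thus ?case using T Suc.prems(2) by (auto simp: nth_Cons split: nat.splits)
qed simp

definition unhalf :: "nat \<Rightarrow> int list list \<Rightarrow> int mat" where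
  "unhalf n T = mat n n (\<lambda>(i, j). T ! min i j ! (max i j - min i j))"

lemma half_nz:
  fixes A :: "int mat"
  assumes A: "A \<in> carrier_mat n n" and e: "\<And>i j. i < n \<Longrightarrow> j < n \<Longrightarrow> A $$ (i, j) \<in> {-1, 0, 1}"
  shows "off_nz (half n (\<lambda>i j. A $$ (i, j))) = R_stat A" "diag_nz (half n (\<lambda>i j. A $$ (i, j))) = S_stat A"
proof -
  have nonzeros_map: "nonzeros (map f [a..<b]) = (\<Sum>j\<in>{a..<b}. nat \<bar>f j\<bar>)" if "\<And>j. j < b \<Longrightarrow> f j \<in> {-1, 0, 1}" for f a b
    using that
  proof (induction b)
    case (Suc b)
    have "f b \<in> {-1, 0, 1}" by (rule Suc.prems) simp
    moreover have "nonzeros (map f [a..<b]) = (\<Sum>j\<in>{a..<b}. nat \<bar>f j\<bar>)"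
      by (rule Suc.IH, rule Suc.prems) simp
    ultimately show ?case by (auto simp: nonzeros_def)
  qed (simp add: nonzeros_def)
  have tl: "tl (map f [i..<n]) = map f [Suc i..<n]" for f :: "nat \<Rightarrow> int" and i by (simp add: map_tl[symmetric] tl_upt)
  have "off_nz (half n (\<lambda>i j. A $$ (i, j))) = (\<Sum>i<n. nonzeros (map (\<lambda>j. A $$ (i, j)) [Suc i..<n]))"
    by (simp add: off_nz_def half_def tl comp_def sum_list_sum_nth atLeast0LessThan)
  also have "\<dots> = (\<Sum>i<n. \<Sum>j\<in>{Suc i..<n}. nat \<bar>A $$ (i, j)\<bar>)"
    by (intro sum.cong refl nonzeros_map e) auto
  also have "\<dots> = (\<Sum>(i, j)\<in>(SIGMA i:{..<n}. {Suc i..<n}). nat \<bar>A $$ (i, j)\<bar>)"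
    by (rule sum.Sigma) auto
  also have "(SIGMA i:{..<n}. {Suc i..<n}) = {(i, j). i < j \<and> j < dim_row A}" using A by auto
  finally show "off_nz (half n (\<lambda>i j. A $$ (i, j))) = R_stat A" by (simp add: R_stat_def)
  have "diag_nz (half n (\<lambda>i j. A $$ (i, j))) = (\<Sum>i<n. nonzeros [hd (map (\<lambda>j. A $$ (i, j)) [i..<n])])"
    by (simp add: diag_nz_def half_def comp_def sum_list_sum_nth atLeast0LessThan)
  also have "\<dots> = (\<Sum>i<n. nat \<bar>A $$ (i, i)\<bar>)"
  proof (intro sum.cong refl)
    fix i assume "i \<in> {..<n}"
    thus "nonzeros [hd (map (\<lambda>j. A $$ (i, j)) [i..<n])] = nat \<bar>A $$ (i, i)\<bar>"
      using e[of i i] by (auto simp: nonzeros_def hd_map)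
  qed
  finally show "diag_nz (half n (\<lambda>i j. A $$ (i, j))) = S_stat A" using A by (simp add: S_stat_def)
qed

text \<open>
  Symmetric matrices correspond bijectively to their upper triangular halves.
\<close>

theorem X_gf_partition: "X_gf n r s 1 = part_fn0 r s (replicate n 0)"
proof -
  let ?h = "\<lambda>A. half n (\<lambda>i j. A $$ (i, j))" and ?v = "replicate n False"
  have sym: "A $$ (i, j) = A $$ (j, i)" if "A \<in> DSASM n" "i < n" "j < n" for A i j
  proof -
    have "A \<in> carrier_mat n n" "transpose_mat A = A" using that by (auto simp: DSASM_def ASM_def)
    thus ?thesis using that by (metis carrier_matD index_transpose_mat(1))
  qed
  have U: "?h (unhalf n T) = T" if "T \<in> arrays n ?v" for T
  proof -
    have s: "length T = n" "\<And>i. i < n \<Longrightarrow> length (T ! i) = n - i" using arrays_shape[OF that] by auto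
    show ?thesis
      by (rule nth_equalityI) (auto simp: half_def s unhalf_def intro!: nth_equalityI)
  qed
  have usym: "unhalf n T $$ (i, j) = unhalf n T $$ (j, i)" if "i < n" "j < n" for T i j
    using that by (simp add: unhalf_def min.commute max.commute)
  have "(\<Sum>T\<in>arrays n ?v. r ^ off_nz T * s ^ diag_nz T) = (\<Sum>A\<in>DSASM n. r ^ R_stat A * s ^ S_stat A)"
  proof (rule sum.reindex_bij_witness[of _ ?h "unhalf n"])
    fix T assume T: "T \<in> arrays n ?v"
    show "?h (unhalf n T) = T" by (rule U[OF T])
    have c: "unhalf n T \<in> carrier_mat n n" by (simp add: unhalf_def)
    have "?h (unhalf n T) \<in> arrays n ?v" using U[OF T] T by simp
    hence ok: "column_ok n ?v (\<lambda>i j. unhalf n T $$ (i, j))"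
      by (subst (asm) half_in_arrays_iff) (use usym in auto)
    thus D: "unhalf n T \<in> DSASM n" using DSASM_iff[OF c usym] by blast
    have "unhalf n T $$ (i, j) \<in> {-1, 0, 1}" if "i < n" "j < n" for i j
    proof -
      have "unhalf n T $$ (i, j) \<in> elements_mat (unhalf n T)"
        using that c by (intro elements_matI[of _ n n]) auto
      thus ?thesis using D by (auto simp: DSASM_def ASM_def)
    qed
    from half_nz[OF c this] show "r ^ R_stat (unhalf n T) * s ^ S_stat (unhalf n T) = r ^ off_nz T * s ^ diag_nz T"
      by (simp add: U[OF T])
  next
    fix A assume A: "A \<in> DSASM n"
    hence c: "A \<in> carrier_mat n n" by (simp add: DSASM_def ASM_def)
    show "unhalf n (?h A) = A"
    proof (rule eq_matI)
      fix i j assume "i < dim_row A" "j < dim_col A"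
      hence ij: "i < n" "j < n" using c by auto
      show "unhalf n (?h A) $$ (i, j) = A $$ (i, j)"
        using ij sym[OF A ij] by (cases "i \<le> j") (auto simp: unhalf_def half_def min_def max_def)
    qed (use c in \<open>auto simp: unhalf_def\<close>)
    show "?h A \<in> arrays n ?v"
      using A DSASM_iff[OF c sym[OF A]] by (subst half_in_arrays_iff) (use sym[OF A] in auto)
  qed
  moreover have "part_fn0 r s (replicate n 0) = (\<Sum>T\<in>arrays n ?v. r ^ off_nz T * s ^ diag_nz T)"
    unfolding part_fn0_def length_replicate by (rule part_fn_zero) simp
  ultimately show ?thesis by (simp add: X_gf_def)
qed

section \<open>Sums over permutations of products over pairs\<close>

text \<open>
  A version of the Pfaffian in which each perfect matching is counted once for each order of
  its blocks and of the two elements in each block. It is easier to handle than the Pfaffian,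
  because relabelling the index set only permutes the summands.
\<close>

definition pfsum :: "nat \<Rightarrow> (nat \<Rightarrow> nat \<Rightarrow> 'a::comm_ring_1) \<Rightarrow> 'a" where
  "pfsum m B = (\<Sum>p | p permutes {..<2*m}. of_int (sign p) * (\<Prod>k<m. B (p (2*k)) (p (2*k+1))))"

lemma pfsum_cong:
  assumes "\<And>i j. i < 2*m \<Longrightarrow> j < 2*m \<Longrightarrow> B i j = B' i j"
  shows "pfsum m B = pfsum m B'"
  unfolding pfsum_def
proof (intro sum.cong refl arg_cong2[where f = "(*)"] prod.cong)
  fix p k assume "p \<in> {p. p permutes {..<2*m}}" "k \<in> {..<m}"
  hence "p (2*k) \<in> {..<2*m}" "p (2*k+1) \<in> {..<2*m}"
    by (subst permutes_in_image; simp)+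
  thus "B (p (2*k)) (p (2*k+1)) = B' (p (2*k)) (p (2*k+1))" by (intro assms) auto
qed

lemma pfsum_permute:
  assumes t: "t permutes {..<2*m}"
  shows "pfsum m (\<lambda>i j. B (t i) (t j)) = of_int (sign t) * pfsum m B"
proof -
  have *: "permutation p" if "p permutes {..<2*m}" for p
    using that permutation_permutes by blast
  have "pfsum m B = (\<Sum>p | p permutes {..<2*m}. of_int (sign (t \<circ> p)) * (\<Prod>k<m. B ((t \<circ> p) (2*k)) ((t \<circ> p) (2*k+1))))"
    unfolding pfsum_def by (rule setum_permutations_compose_left[OF t])
  also have "\<dots> = of_int (sign t) * pfsum m (\<lambda>i j. B (t i) (t j))"
    unfolding pfsum_def sum_distrib_left
    by (intro sum.cong refl) (simp add: sign_compose[OF *[OF t] *] mult.assoc)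
  finally have "of_int (sign t) * pfsum m B = of_int (sign t * sign t) * pfsum m (\<lambda>i j. B (t i) (t j))"
    by (simp only: of_int_mult mult.assoc)
  thus ?thesis by (simp only: sign_idempotent of_int_1 mult_1)
qed

lemma pfsum_repeated:
  fixes B :: "nat \<Rightarrow> nat \<Rightarrow> 'a::{comm_ring_1, ring_char_0, idom}"
  assumes "a < 2*m" "b < 2*m" "a \<noteq> b"
    and "\<And>i j. i < 2*m \<Longrightarrow> j < 2*m \<Longrightarrow> B (transpose a b i) (transpose a b j) = B i j"
  shows "pfsum m B = 0"
proof -
  have "pfsum m B = pfsum m (\<lambda>i j. B (transpose a b i) (transpose a b j))"
    by (rule pfsum_cong) (simp add: assms)
  also have "\<dots> = - pfsum m B"
    by (subst pfsum_permute) (use assms in \<open>auto simp: permutes_swap_id sign_swap_id\<close>)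
  finally have "2 * pfsum m B = 0" by simp
  thus ?thesis by simp
qed

definition border :: "(nat \<Rightarrow> 'a::comm_ring_1) \<Rightarrow> (nat \<Rightarrow> nat \<Rightarrow> 'a) \<Rightarrow> nat \<Rightarrow> nat \<Rightarrow> 'a" where
  "border b M i j = (if i = 0 then b j else if j = 0 then - b i else M i j)"

text \<open>
  Every product contains exactly one factor with index 0; so \<open>pfsum\<close> is linear in row 0, with
  coefficients that depend only on the other rows.
\<close>

lemma pfsum_border:
  assumes "m \<ge> 1"
  shows "\<exists>c. \<forall>b. pfsum m (border b M) = (\<Sum>j\<in>{1..<2*m}. c j * b j)"
proof -
  have *: "\<exists>j c. j \<in> {1..<2*m} \<and> (\<forall>b. of_int (sign p) * (\<Prod>k<m. border b M (p (2*k)) (p (2*k+1))) = c * b j)"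
    if p: "p permutes {..<2*m}" for p
  proof -
    have inj: "p i = p j \<longleftrightarrow> i = j" for i j using permutes_inj[OF p] by (auto simp: inj_def)
    have im: "p i < 2*m" if "i < 2*m" for i using permutes_in_image[OF p] that by auto
    obtain q where q: "p q = 0" "q < 2*m"
    proof -
      have "p (inv_into UNIV p 0) = 0" using permutes_inverses[OF p] by simp
      moreover have "inv_into UNIV p 0 < 2*m" using permutes_in_image[OF permutes_inv[OF p], of 0] assms by auto
      ultimately show ?thesis using that by blast
    qed
    define k0 where "k0 = q div 2"
    have k0: "k0 < m" using q(2) by (auto simp: k0_def)
    have p0: "p i = 0 \<longleftrightarrow> i = q" for i using q(1) inj by metis
    define C where "C = (\<Prod>k\<in>{..<m}-{k0}. M (p (2*k)) (p (2*k+1)))"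
    have split: "(\<Prod>k<m. border b M (p (2*k)) (p (2*k+1))) = border b M (p (2*k0)) (p (2*k0+1)) * C" for b
    proof -
      have "(\<Prod>k\<in>{..<m}-{k0}. border b M (p (2*k)) (p (2*k+1))) = C"
        unfolding C_def by (intro prod.cong refl) (auto simp: border_def p0 k0_def)
      thus ?thesis using k0 by (subst prod.remove[of _ k0]) auto
    qed
    show ?thesis
    proof (cases "even q")
      case True
      hence q2: "q = 2 * k0" by (simp add: k0_def)
      have "p (2*k0+1) \<noteq> 0" "p (2*k0+1) < 2*m" using p0 q2 im k0 by auto
      thus ?thesis unfolding split using q2 q
        by (intro exI[of _ "p (2*k0+1)"] exI[of _ "of_int (sign p) * C"]) (auto simp: border_def mult_ac)
    next
      case False
      hence q2: "q = 2 * k0 + 1" by (simp add: k0_def)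
      have "p (2*k0) \<noteq> 0" "p (2*k0) < 2*m" using p0 q2 im k0 by auto
      thus ?thesis unfolding split using q2 q
        by (intro exI[of _ "p (2*k0)"] exI[of _ "- of_int (sign p) * C"]) (auto simp: border_def mult_ac)
    qed
  qed
  hence "\<forall>p. \<exists>jc. p permutes {..<2*m} \<longrightarrow> fst jc \<in> {1..<2*m} \<and>
      (\<forall>b. of_int (sign p) * (\<Prod>k<m. border b M (p (2*k)) (p (2*k+1))) = snd jc * b (fst jc))"
  proof (intro allI)
    fix p
    show "\<exists>jc. p permutes {..<2*m} \<longrightarrow> fst jc \<in> {1..<2*m} \<and>
      (\<forall>b. of_int (sign p) * (\<Prod>k<m. border b M (p (2*k)) (p (2*k+1))) = snd jc * b (fst jc))"
    proof (cases "p permutes {..<2*m}")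
      case True
      from *[OF True] obtain j c where jc: "j \<in> {1..<2*m}"
        "\<forall>b. of_int (sign p) * (\<Prod>k<m. border b M (p (2*k)) (p (2*k+1))) = c * b j" by blast
      show ?thesis unfolding split_paired_Ex fst_conv snd_conv using jc by blast
    qed blast
  qed
  from choice[OF this] obtain X where X: "\<And>p. p permutes {..<2*m} \<longrightarrow> fst (X p) \<in> {1..<2*m} \<and>
      (\<forall>b. of_int (sign p) * (\<Prod>k<m. border b M (p (2*k)) (p (2*k+1))) = snd (X p) * b (fst (X p)))"
    by blast
  define J where "J = (\<lambda>p. fst (X p))"
  define c where "c = (\<lambda>p. snd (X p))"
  have Jc: "\<And>p. p permutes {..<2*m} \<Longrightarrow> J p \<in> {1..<2*m}"
    "\<And>p b. p permutes {..<2*m} \<Longrightarrow>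
      of_int (sign p) * (\<Prod>k<m. border b M (p (2*k)) (p (2*k+1))) = c p * b (J p)"
    unfolding J_def c_def using X by blast+
  have fin: "finite {p. p permutes {..<2*m}}" by (simp add: finite_permutations)
  have "pfsum m (border b M) = (\<Sum>j\<in>{1..<2*m}. (\<Sum>p | p permutes {..<2*m} \<and> J p = j. c p) * b j)" for b
  proof -
    have "pfsum m (border b M) = (\<Sum>p | p permutes {..<2*m}. c p * b (J p))"
      unfolding pfsum_def by (intro sum.cong refl) (simp only: mem_Collect_eq Jc(2))
    also have "\<dots> = (\<Sum>j\<in>{1..<2*m}. \<Sum>p\<in>{p. p \<in> {p. p permutes {..<2*m}} \<and> J p = j}. c p * b (J p))"
      using Jc(1) by (intro sum.group[symmetric] fin) auto
    finally show ?thesis by (simp add: sum_distrib_right)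
  qed
  thus ?thesis
    by (intro exI[of _ "\<lambda>j. \<Sum>p | p permutes {..<2*m} \<and> J p = j. c p"]) blast
qed

section \<open>The Pfaffian as a sum over all permutations\<close>

definition match_perms :: "nat \<Rightarrow> (nat \<Rightarrow> nat) set" where
  "match_perms m = {p. p permutes {..<2*m} \<and> (\<forall>k<m. p (2*k) < p (2*k+1)) \<and>
      (\<forall>k. Suc k < m \<longrightarrow> p (2*k) < p (2 * Suc k))}"

lemma pfaffian_shift:
  assumes ab: "{a..b} = {a..<a+2*m}"
  shows "pfaffian a b B = (\<Sum>p\<in>match_perms m. of_int (sign p) * (\<Prod>k<m. B (a + p (2*k)) (a + p (2*k+1))))"
proof -
  have card: "card {a..b} = 2 * m" using ab by simp
  have bb: "bij_betw ((+) a) {..<2*m} {a..b}" unfolding ab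
    by (intro bij_betwI[where g = "\<lambda>i. i - a"]) auto
  have bb': "bij_betw (\<lambda>i. i - a) {a..b} {..<2*m}" unfolding ab
    by (intro bij_betwI[where g = "(+) a"]) auto
  let ?f = "map_permutation {..<2*m} ((+) a)" and ?g = "map_permutation {a..b} (\<lambda>i. i - a)"
  have f: "?f p (a + i) = a + p i" if "i < 2*m" for p i
    using map_permutation_apply[of "(+) a" "{..<2*m}" i p] that by simp
  have g: "a + ?g p i = p (a + i)" if "i < 2*m" "p permutes {a..b}" for p i
  proof -
    have "inj_on (\<lambda>i. i - a) {a..b}" using bb' by (rule bij_betw_imp_inj_on)
    moreover have "a + i \<in> {a..b}" using that ab by auto
    ultimately have "?g p (a + i - a) = p (a + i) - a" by (rule map_permutation_apply)
    moreover have "p (a + i) \<in> {a..b}" using that(2) \<open>a + i \<in> {a..b}\<close> by (simp only: permutes_in_image)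
    ultimately show ?thesis by simp
  qed
  have 1: "?f p \<in> pfaffian_perms a b" if "p \<in> match_perms m" for p
  proof -
    have "?f p (a + 2*k) = a + p (2*k)" "?f p (a + 2*k+1) = a + p (2*k+1)" if "k < m" for k
      using f[of "2*k" p] f[of "2*k+1" p] that by auto
    moreover have "?f p (a + 2*Suc k) = a + p (2*Suc k)" if "Suc k < m" for k
      using f[of "2*Suc k" p] that by auto
    ultimately show ?thesis
      using that map_permutation_permutes[OF bb] unfolding pfaffian_perms_def card by (simp add: match_perms_def)
  qed
  have 2: "?g p \<in> match_perms m" if p: "p \<in> pfaffian_perms a b" for p
  proof -
    have pp: "p permutes {a..b}" using p by (simp add: pfaffian_perms_def)
    have "?g p i < ?g p j" if "p (a + i) < p (a + j)" "i < 2*m" "j < 2*m" for i j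
      using that g[OF that(2) pp] g[OF that(3) pp] by linarith
    moreover have "p (a + 2*k) < p (a + (2*k+1))" if "k < m" for k
      using p that unfolding pfaffian_perms_def card by simp
    moreover have "p (a + 2*k) < p (a + 2*Suc k)" if "Suc k < m" for k
      using p that unfolding pfaffian_perms_def card by simp
    ultimately show ?thesis using map_permutation_permutes[OF bb' pp]
      by (auto simp: match_perms_def)
  qed
  have "pfaffian a b B = (\<Sum>p\<in>pfaffian_perms a b. of_int (sign p) * (\<Prod>k<m. B (p (a + 2*k)) (p (a + 2*k+1))))"
    unfolding pfaffian_def card by simp
  also have "\<dots> = (\<Sum>p\<in>match_perms m. of_int (sign p) * (\<Prod>k<m. B (a + p (2*k)) (a + p (2*k+1))))"
  proof (rule sum.reindex_bij_witness[of _ ?f ?g])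
    fix p assume p: "p \<in> pfaffian_perms a b"
    hence pp: "p permutes {a..b}" by (simp add: pfaffian_perms_def)
    show "?f (?g p) = p" by (rule map_permutation_compose_inv[OF bb' pp]) auto
    show "?g p \<in> match_perms m" using 2[OF p] .
    have "sign (?g p) = sign p" by (rule sign_map_permutation) (use bb' pp in \<open>auto simp: bij_betw_def\<close>)
    moreover have "a + ?g p (2*k) = p (a + 2*k)" "a + ?g p (2*k+1) = p (a + 2*k+1)" if "k < m" for k
      using g[of "2*k" p] g[of "2*k+1" p] pp that by auto
    ultimately show "of_int (sign (?g p)) * (\<Prod>k<m. B (a + ?g p (2*k)) (a + ?g p (2*k+1)))
       = of_int (sign p) * (\<Prod>k<m. B (p (a + 2*k)) (p (a + 2*k+1)))" by simp
  next
    fix p assume p: "p \<in> match_perms m"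
    hence pp: "p permutes {..<2*m}" by (simp add: match_perms_def)
    show "?g (?f p) = p" by (rule map_permutation_compose_inv[OF bb pp]) auto
    show "?f p \<in> pfaffian_perms a b" using 1[OF p] .
  qed
  finally show ?thesis .
qed

text \<open>
  The permutations that preserve the partition into the blocks \<open>{2 * k, 2 * k + 1}\<close> are
  composed of permutations of the blocks (\<open>block_lift\<close>) and exchanges within the blocks of a
  set (\<open>block_flip\<close>).
\<close>

definition block_lift :: "(nat \<Rightarrow> nat) \<Rightarrow> nat \<Rightarrow> nat" where
  "block_lift t i = 2 * t (i div 2) + i mod 2"

definition block_flip :: "nat set \<Rightarrow> nat \<Rightarrow> nat" where
  "block_flip E i = (if i div 2 \<in> E then (if even i then i + 1 else i - 1) else i)"

lemma block_lift_comp: "block_lift s (block_lift t i) = block_lift (s \<circ> t) i"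
  by (simp add: block_lift_def)

lemma block_lift_permutes:
  assumes "t permutes {..<m}"
  shows "block_lift t permutes {..<2*m}"
proof (rule bij_imp_permutes)
  have lt: "block_lift s i < 2 * m" if "s permutes {..<m}" "i < 2 * m" for s i
  proof -
    have "s (i div 2) \<in> {..<m}" using that by (subst permutes_in_image) auto
    thus ?thesis by (auto simp: block_lift_def)
  qed
  have inv: "block_lift (inv_into UNIV t) (block_lift t i) = i" "block_lift t (block_lift (inv_into UNIV t) i) = i" for i
    using permutes_inv_o[OF assms] unfolding block_lift_comp by (simp_all add: block_lift_def)
  show "bij_betw (block_lift t) {..<2*m} {..<2*m}"
    by (rule bij_betwI[where g = "block_lift (inv_into UNIV t)"])
       (use lt[OF assms] lt[OF permutes_inv[OF assms]] inv in auto)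
  fix i assume "i \<notin> {..<2*m}"
  hence "t (i div 2) = i div 2" by (intro permutes_not_in[OF assms]) auto
  thus "block_lift t i = i" by (simp add: block_lift_def)
qed

text \<open>
  Exchanging two blocks amounts to two transpositions, hence is even.
\<close>

lemma sign_block_lift:
  assumes "t permutes {..<m}"
  shows "sign (block_lift t) = 1"
  using assms finite_lessThan
proof (induction rule: permutes_induct)
  case id
  have "block_lift id = id" by (auto simp: block_lift_def)
  thus ?case by (simp only: sign_id)
next
  case (swap a b p)
  have "block_lift (transpose a b) = transpose (2*a) (2*b) \<circ> transpose (2*a+1) (2*b+1)"
  proof
    fix i :: nat
    consider k where "i = 2 * k" | k where "i = 2 * k + 1" by (metis evenE oddE)
    thus "block_lift (transpose a b) i = (transpose (2*a) (2*b) \<circ> transpose (2*a+1) (2*b+1)) i"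
      by cases (auto simp: block_lift_def Transposition.transpose_def; presburger)+
  qed
  hence "block_lift (transpose a b \<circ> p) = transpose (2*a) (2*b) \<circ> transpose (2*a+1) (2*b+1) \<circ> block_lift p"
    by (metis block_lift_comp comp_def ext)
  moreover have "permutation (block_lift p)"
    using block_lift_permutes[OF swap.hyps(4)] permutation_permutes by blast
  ultimately have "sign (block_lift (transpose a b \<circ> p)) =
      sign (transpose (2*a) (2*b)) * sign (transpose (2*a+1) (2*b+1)) * sign (block_lift p)"
    by (simp only: sign_compose permutation_compose permutation_swap_id)
  also have "\<dots> = 1" using swap by (simp add: sign_swap_id)
  finally show ?case .
qed

lemma block_flip_div2: "block_flip E i div 2 = i div 2"
  unfolding block_flip_def by (cases "even i"; simp) presburger+

lemma block_flip_permutes: "E \<subseteq> {..<m} \<Longrightarrow> block_flip E permutes {..<2*m}"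
  and block_flip_flip: "block_flip E (block_flip E i) = i"
proof -
  show ff: "block_flip E (block_flip E i) = i" for i by (auto simp: block_flip_def elim!: oddE)
  assume E: "E \<subseteq> {..<m}"
  show "block_flip E permutes {..<2*m}"
  proof (rule bij_imp_permutes)
    show "bij_betw (block_flip E) {..<2*m} {..<2*m}"
    proof (rule bij_betwI[where g = "block_flip E"])
      show "block_flip E \<in> {..<2*m} \<rightarrow> {..<2*m}"
      proof
        fix i assume "i \<in> {..<2*m}"
        hence "i div 2 < m" by auto
        hence "block_flip E i div 2 < m" by (simp only: block_flip_div2)
        thus "block_flip E i \<in> {..<2*m}" by simp
      qed
      thus "block_flip E \<in> {..<2*m} \<rightarrow> {..<2*m}" .
    qed (auto simp: ff)
  next
    fix i assume "i \<notin> {..<2*m}"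
    thus "block_flip E i = i" using E by (auto simp: block_flip_def)
  qed
qed

lemma sign_block_flip:
  assumes "finite E"
  shows "sign (block_flip E) = (-1) ^ card E"
  using assms
proof (induction E)
  case empty
  have "block_flip {} = id" by (auto simp: block_flip_def)
  thus ?case by simp
next
  case (insert k E)
  have "block_flip (insert k E) = transpose (2*k) (2*k+1) \<circ> block_flip E"
  proof
    fix i :: nat
    consider l where "i = 2 * l" | l where "i = 2 * l + 1" by (metis evenE oddE)
    thus "block_flip (insert k E) i = (transpose (2*k) (2*k+1) \<circ> block_flip E) i"
    proof cases
      case 1
      thus ?thesis using insert.hyps(2)
        by (cases "l = k"; cases "l \<in> E") (auto simp: block_flip_def Transposition.transpose_def)
    next
      case 2
      thus ?thesis using insert.hyps(2)
        by (cases "l = k"; cases "l \<in> E") (auto simp: block_flip_def Transposition.transpose_def)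
    qed
  qed
  moreover obtain m where "E \<subseteq> {..<m}" using insert.hyps(1) finite_nat_bounded by blast
  hence "permutation (block_flip E)" using block_flip_permutes permutation_permutes by blast
  ultimately have "sign (block_flip (insert k E)) = sign (transpose (2*k) (2*k+1)) * sign (block_flip E)"
    by (simp only: sign_compose permutation_swap_id)
  thus ?case using insert by (simp add: sign_swap_id)
qed

text \<open>
  Each exchange within a block changes both the sign of the permutation and, by skew symmetry,
  the sign of the product.
\<close>

lemma block_perm_term:
  assumes p: "p permutes {..<2*m}" and t: "t permutes {..<m}" and E: "E \<subseteq> {..<m}"
    and skew: "\<And>i j. i < 2*m \<Longrightarrow> j < 2*m \<Longrightarrow> B j i = - B i j"
  defines "q \<equiv> p \<circ> block_lift t \<circ> block_flip E"
  shows "of_int (sign q) * (\<Prod>k<m. B (q (2*k)) (q (2*k+1))) = of_int (sign p) * (\<Prod>k<m. B (p (2*k)) (p (2*k+1)) :: 'a::comm_ring_1)"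
proof -
  have fE: "finite E" using E finite_subset by blast
  have perm: "permutation p" "permutation (block_lift t)" "permutation (block_flip E)"
    using p block_lift_permutes[OF t] block_flip_permutes[OF E] permutation_permutes by blast+
  have sg: "sign q = sign p * (-1) ^ card E"
    unfolding q_def by (simp add: sign_compose permutation_compose perm sign_block_lift[OF t] sign_block_flip[OF fE])
  have p_lt: "p i < 2*m" if "i < 2*m" for i using permutes_in_image[OF p] that by auto
  have t_lt: "t i < m" if "i < m" for i using permutes_in_image[OF t] that by auto
  have "(\<Prod>k<m. B (q (2*k)) (q (2*k+1))) = (\<Prod>k<m. (if k \<in> E then -1 else 1) * B (p (2 * t k)) (p (2 * t k + 1)))"
  proof (intro prod.cong refl)
    fix k assume "k \<in> {..<m}"
    hence k: "k < m" by simp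
    have "B (p (2 * t k + 1)) (p (2 * t k)) = - B (p (2 * t k)) (p (2 * t k + 1))"
      using t_lt[OF k] by (intro skew p_lt) auto
    thus "B (q (2*k)) (q (2*k+1)) = (if k \<in> E then -1 else 1) * B (p (2 * t k)) (p (2 * t k + 1))"
      by (auto simp: q_def block_lift_def block_flip_def)
  qed
  also have "\<dots> = (\<Prod>k<m. if k \<in> E then -1 else 1) * (\<Prod>k<m. B (p (2 * t k)) (p (2 * t k + 1)))"
    by (rule prod.distrib)
  also have "(\<Prod>k<m. if k \<in> E then -1 else (1::'a)) = (-1) ^ card E"
  proof -
    have "(\<Prod>k<m. if k \<in> E then -1 else (1::'a)) = (\<Prod>k\<in>E. -1)"
      using E by (intro prod.mono_neutral_cong_right) auto
    thus ?thesis by simp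
  qed
  also have "(\<Prod>k<m. B (p (2 * t k)) (p (2 * t k + 1))) = (\<Prod>k<m. B (p (2 * k)) (p (2 * k + 1)))"
    using prod.permute[OF t, of "\<lambda>k. B (p (2 * k)) (p (2 * k + 1))"] by (simp add: comp_def)
  finally show ?thesis unfolding sg
    by (simp add: mult.assoc[symmetric] flip: power_mult_distrib) (simp add: mult.assoc flip: power_mult_distrib)
qed

lemma match_perms_strict:
  assumes "p \<in> match_perms m" "i < j" "j < m"
  shows "p (2*i) < p (2*j)"
  using assms(2,3)
proof (induction j)
  case (Suc j)
  have "p (2*j) < p (2 * Suc j)" using assms(1) Suc.prems by (auto simp: match_perms_def)
  thus ?case using Suc by (cases "i = j") auto
qed simp

text \<open>
  The set \<open>E\<close> consists of the blocks on which the composite is decreasing. After undoing these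
  exchanges, the block minima in increasing order determine \<open>p\<close>, and then their positions
  determine \<open>t\<close>.
\<close>

lemma block_perm_inj:
  assumes p: "p \<in> match_perms m" "p' \<in> match_perms m" and t: "t permutes {..<m}" "t' permutes {..<m}"
    and E: "E \<subseteq> {..<m}" "E' \<subseteq> {..<m}"
    and eq: "p \<circ> block_lift t \<circ> block_flip E = p' \<circ> block_lift t' \<circ> block_flip E'"
  shows "p = p' \<and> t = t' \<and> E = E'"
proof -
  have t_lt: "t i < m" "t' i < m" if "i < m" for i using permutes_in_image[OF t(1)] permutes_in_image[OF t(2)] that by auto
  have E_iff: "k \<in> E \<longleftrightarrow> q (2*k) > q (2*k+1)"
    if "q = p \<circ> block_lift t \<circ> block_flip E" "p \<in> match_perms m" "t permutes {..<m}" "E \<subseteq> {..<m}" "k < m" for q p t E k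
  proof -
    have "t k < m" using permutes_in_image[OF that(3)] that(5) by auto
    hence "p (2 * t k) < p (2 * t k + 1)" using that(2) by (auto simp: match_perms_def)
    thus ?thesis by (auto simp: that(1) block_lift_def block_flip_def)
  qed
  have EE: "E = E'" using E_iff[OF refl p(1) t(1) E(1)] E_iff[OF eq p(2) t(2) E(2)] E by blast
  have "p \<circ> block_lift t = p' \<circ> block_lift t'"
  proof
    fix i
    show "(p \<circ> block_lift t) i = (p' \<circ> block_lift t') i"
      using fun_cong[OF eq, of "block_flip E i"] by (simp add: EE block_flip_flip)
  qed
  note eq2 = this
  have eq3: "p (2 * t k) = p' (2 * t' k)" for k using fun_cong[OF eq2, of "2 * k"] by (simp add: block_lift_def)
  let ?L = "\<lambda>p. map (\<lambda>k. p (2 * k)) [0..<m]"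
  have srt: "sorted_wrt (<) (?L p)" if "p \<in> match_perms m" for p :: "nat \<Rightarrow> nat"
    using match_perms_strict[OF that] by (auto simp: sorted_wrt_iff_nth_less)
  have "set (?L p) = (\<lambda>k. p (2 * k)) ` t ` {..<m}" using permutes_image[OF t(1)] by (auto simp: atLeast0LessThan)
  also have "\<dots> = (\<lambda>k. p' (2 * k)) ` t' ` {..<m}" by (simp add: image_image eq3)
  also have "\<dots> = set (?L p')" using permutes_image[OF t(2)] by (auto simp: atLeast0LessThan)
  finally have "?L p = ?L p'" using srt[OF p(1)] srt[OF p(2)] by (metis strict_sorted_equal)
  hence pp': "p (2 * k) = p' (2 * k)" if "k < m" for k using that by (auto simp: list_eq_iff_nth_eq)
  have inj: "inj p'" using p(2) permutes_inj by (auto simp: match_perms_def)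
  have tt: "t = t'"
  proof
    fix k
    show "t k = t' k"
    proof (cases "k < m")
      case True
      hence "p' (2 * t k) = p' (2 * t' k)" using eq3[of k] pp'[of "t k"] t_lt by simp
      thus ?thesis using inj_eq[OF inj] by simp
    next
      case False
      thus ?thesis using permutes_not_in[OF t(1)] permutes_not_in[OF t(2)] by simp
    qed
  qed
  have "p = p'"
  proof
    fix i
    have "block_lift t (block_lift (inv_into UNIV t) i) = i"
      using permutes_inv_o[OF t(1)] unfolding block_lift_comp by (simp add: block_lift_def)
    thus "p i = p' i" using fun_cong[OF eq2, of "block_lift (inv_into UNIV t) i"] by (simp add: tt)
  qed
  thus ?thesis using tt EE by blast
qed

text \<open>
  Sort each block, then sort the blocks by their minima.
\<close>

lemma block_perm_surj:
  assumes q: "q permutes {..<2*m}"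
  shows "\<exists>p t E. p \<in> match_perms m \<and> t permutes {..<m} \<and> E \<subseteq> {..<m} \<and> q = p \<circ> block_lift t \<circ> block_flip E"
proof -
  have inj: "inj q" using permutes_inj[OF q] .
  define E where "E = {k. k < m \<and> q (2*k) > q (2*k+1)}"
  have E: "E \<subseteq> {..<m}" by (auto simp: E_def)
  define q' where "q' = q \<circ> block_flip E"
  have q': "q' permutes {..<2*m}" unfolding q'_def by (intro permutes_compose block_flip_permutes E q)
  have q'_inj: "q' i = q' j \<longleftrightarrow> i = j" for i j using permutes_inj[OF q'] by (auto simp: inj_def)
  have less: "q' (2*k) < q' (2*k+1)" if "k < m" for k
  proof -
    have "q (2*k) \<noteq> q (2*k+1)" using inj_eq[OF inj] by simp
    thus ?thesis using that by (auto simp: q'_def E_def block_flip_def)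
  qed
  let ?ys = "map (\<lambda>k. q' (2*k)) [0..<m]"
  have "mset (sort ?ys) = mset ?ys" by simp
  then obtain s where s: "s permutes {..<length ?ys}" "permute_list s ?ys = sort ?ys" by (rule mset_eq_permutation)
  hence s': "s permutes {..<m}" by simp
  have sm: "s k < m" if "k < m" for k using permutes_in_image[OF s'] that by auto
  have nth: "sort ?ys ! k = q' (2 * s k)" if "k < m" for k
    unfolding s(2)[symmetric] using that sm by (simp add: permute_list_nth[OF s(1)])
  define p where "p = q' \<circ> block_lift s"
  have "p permutes {..<2*m}" unfolding p_def by (intro permutes_compose block_lift_permutes s' q')
  moreover have "p (2*k) < p (2*k+1)" if "k < m" for k
    using less[OF sm[OF that]] by (simp add: p_def block_lift_def)
  moreover have "p (2*k) < p (2 * Suc k)" if "Suc k < m" for k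
  proof -
    have "sort ?ys ! k \<le> sort ?ys ! Suc k" using that by (intro sorted_nth_mono) auto
    moreover have "s k \<noteq> s (Suc k)" using permutes_inj[OF s'] by (metis inj_eq n_not_Suc_n)
    hence "q' (2 * s k) \<noteq> q' (2 * s (Suc k))" by (simp add: q'_inj)
    ultimately show ?thesis using nth[of k] nth[of "Suc k"] that by (simp add: p_def block_lift_def)
  qed
  ultimately have "p \<in> match_perms m" by (auto simp: match_perms_def)
  moreover have "inv_into UNIV s permutes {..<m}" by (rule permutes_inv[OF s'])
  moreover have "q = p \<circ> block_lift (inv_into UNIV s) \<circ> block_flip E"
  proof
    fix i
    have "block_lift s (block_lift (inv_into UNIV s) j) = j" for j
      using permutes_inv_o[OF s'] unfolding block_lift_comp by (simp add: block_lift_def)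
    thus "q i = (p \<circ> block_lift (inv_into UNIV s) \<circ> block_flip E) i"
      by (simp add: p_def q'_def block_flip_flip)
  qed
  ultimately show ?thesis using E by blast
qed

theorem pfsum_pfaffian:
  assumes ab: "{a..b} = {a..<a+2*m}"
    and skew: "\<And>i j. i < 2*m \<Longrightarrow> j < 2*m \<Longrightarrow> B (a + j) (a + i) = - B (a + i) (a + j)"
  shows "pfsum m (\<lambda>i j. B (a + i) (a + j)) = of_nat (2 ^ m * fact m) * pfaffian a b B"
proof -
  let ?S = "match_perms m \<times> {t. t permutes {..<m}} \<times> Pow {..<m}"
  let ?w = "\<lambda>p. of_int (sign p) * (\<Prod>k<m. B (a + p (2*k)) (a + p (2*k+1)))"
  have bij: "bij_betw (\<lambda>(p, t, E). p \<circ> block_lift t \<circ> block_flip E) ?S {p. p permutes {..<2*m}}"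
  proof (rule bij_betwI')
    fix x y assume "x \<in> ?S" "y \<in> ?S"
    thus "((\<lambda>(p, t, E). p \<circ> block_lift t \<circ> block_flip E) x = (\<lambda>(p, t, E). p \<circ> block_lift t \<circ> block_flip E) y) = (x = y)"
      using block_perm_inj by (auto split: prod.splits) metis+
  next
    fix x assume "x \<in> ?S"
    thus "(\<lambda>(p, t, E). p \<circ> block_lift t \<circ> block_flip E) x \<in> {p. p permutes {..<2*m}}"
      by (auto simp: match_perms_def intro!: permutes_compose block_lift_permutes block_flip_permutes)
  next
    fix q assume "q \<in> {p. p permutes {..<2*m}}"
    then obtain p t E where "p \<in> match_perms m \<and> t permutes {..<m} \<and> E \<subseteq> {..<m} \<and> q = p \<circ> block_lift t \<circ> block_flip E"
      using block_perm_surj by blast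
    thus "\<exists>x\<in>?S. q = (\<lambda>(p, t, E). p \<circ> block_lift t \<circ> block_flip E) x" by (intro bexI[of _ "(p, t, E)"]) auto
  qed
  have "pfsum m (\<lambda>i j. B (a + i) (a + j)) = (\<Sum>(p, t, E)\<in>?S. ?w (p \<circ> block_lift t \<circ> block_flip E))"
    unfolding pfsum_def by (subst sum.reindex_bij_betw[OF bij, symmetric]) (simp add: case_prod_unfold)
  also have "\<dots> = (\<Sum>(p, t, E)\<in>?S. ?w p)"
  proof (intro sum.cong refl)
    fix x assume x: "x \<in> ?S"
    obtain p t E where x': "x = (p, t, E)" by (cases x)
    have "?w (p \<circ> block_lift t \<circ> block_flip E) = ?w p"
      by (rule block_perm_term[where B = "\<lambda>i j. B (a + i) (a + j)" and m = m, OF _ _ _ skew])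
         (use x x' in \<open>auto simp: match_perms_def\<close>)
    thus "(case x of (p, t, E) \<Rightarrow> ?w (p \<circ> block_lift t \<circ> block_flip E)) = (case x of (p, t, E) \<Rightarrow> ?w p)"
      by (simp add: x')
  qed
  also have "\<dots> = (\<Sum>p\<in>match_perms m. of_nat (2 ^ m * fact m) * ?w p)"
    by (simp add: sum.cartesian_product[symmetric] card_cartesian_product card_permutations card_Pow mult_ac)
  also have "\<dots> = of_nat (2 ^ m * fact m) * pfaffian a b B"
    by (simp only: pfaffian_shift[OF ab] sum_distrib_left)
  finally show ?thesis .
qed

text \<open>
  In the encoding of matchings by permutations, 0 always comes first. As the only nonzero
  entry of row 0 is at 1, its partner is 1, and what remains is a matching of the other
  indices.
\<close>

lemma pfsum_first_pair:
  fixes B :: "nat \<Rightarrow> nat \<Rightarrow> 'a::comm_ring_1"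
  assumes skew: "\<And>i j. B j i = - B i j" and z: "\<And>j. 2 \<le> j \<Longrightarrow> j < 2 * Suc m \<Longrightarrow> B 0 j = 0"
  shows "pfsum (Suc m) B = of_nat (2 * Suc m) * B 0 1 * pfsum m (\<lambda>i j. B (i + 2) (j + 2))"
proof -
  let ?t = "\<lambda>p. of_int (sign p) * (\<Prod>k<Suc m. B (p (2*k)) (p (2*k+1)))"
  have card: "card {0..2*m+1} div 2 = Suc m" "card {2..2*m+1} div 2 = m" "even (card {0..2*m+1})" "even (card {2..2*m+1})"
    by auto
  have "pfaffian 0 (2 * m + 1) B = (\<Sum>p\<in>pfaffian_perms 0 (2*m+1). ?t p)"
    unfolding pfaffian_def using card by simp
  also have "\<dots> = (\<Sum>p\<in>pfaffian_perms 2 (2*m+1). ?t p)"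
  proof (rule sum.mono_neutral_right)
    show "finite (pfaffian_perms 0 (2*m+1))"
      by (rule finite_subset[OF _ finite_permutations[of "{0..2*m+1}"]]) (auto simp: pfaffian_perms_def)
    show "pfaffian_perms 2 (2*m+1) \<subseteq> pfaffian_perms 0 (2*m+1)"
    proof
      fix p assume p: "p \<in> pfaffian_perms 2 (2*m+1)"
      hence pp: "p permutes {2..2*m+1}" by (simp add: pfaffian_perms_def)
      have 01: "p 0 = 0" "p 1 = 1" using pp by (auto intro: permutes_not_in)
      have "p permutes {0..2*m+1}" by (rule permutes_subset[OF pp]) auto
      moreover have "p (2*k) < p (2*k+1)" if "k < Suc m" for k
        using p that 01 card by (cases k) (auto simp: pfaffian_perms_def)
      moreover have "p (2*k) < p (2*Suc k)" if "Suc k < Suc m" for k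
      proof (cases k)
        case 0
        have "p 2 \<in> {2..2*m+1}" using that by (subst permutes_in_image[OF pp]) auto
        thus ?thesis using 0 01 by simp
      next
        case (Suc l)
        thus ?thesis using p that card by (auto simp: pfaffian_perms_def)
      qed
      ultimately show "p \<in> pfaffian_perms 0 (2*m+1)" using card by (simp add: pfaffian_perms_def)
    qed
    show "\<forall>p\<in>pfaffian_perms 0 (2*m+1) - pfaffian_perms 2 (2*m+1). ?t p = 0"
    proof
      fix p assume p: "p \<in> pfaffian_perms 0 (2*m+1) - pfaffian_perms 2 (2*m+1)"
      hence pp: "p permutes {0..2*m+1}" by (simp add: pfaffian_perms_def)
      have inc: "\<And>k. k < Suc m \<Longrightarrow> p (2*k) < p (2*k+1)" "\<And>k. Suc k < Suc m \<Longrightarrow> p (2*k) < p (2*Suc k)"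
        using p card by (auto simp: pfaffian_perms_def)
      have le: "p 0 \<le> p (2*k)" if "k < Suc m" for k
        using that by (induction k) (use inc(2) in \<open>auto intro: order.trans less_imp_le\<close>)
      have le2: "p 0 \<le> p i" if "i < 2 * Suc m" for i
      proof -
        consider k where "i = 2 * k" | k where "i = 2 * k + 1" by (metis evenE oddE)
        thus ?thesis
        proof cases
          case 1
          thus ?thesis using le[of k] that by simp
        next
          case 2
          thus ?thesis using le[of k] inc(1)[of k] that by simp
        qed
      qed
      obtain i where i: "i \<in> {0..2*m+1}" "p i = 0"
        using permutes_image[OF pp] by (metis atLeastAtMost_iff imageE le0)
      have p0: "p 0 = 0" using le2[of i] i by auto
      have p1: "p 1 < 2 * Suc m" using permutes_in_image[OF pp, of 1] by auto
      show "?t p = 0"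
      proof (cases "p 1 = 1")
        case False
        hence "2 \<le> p 1" using inc(1)[of 0] p0 by simp
        hence "B (p 0) (p 1) = 0" using z p1 p0 by simp
        thus ?thesis unfolding prod.lessThan_Suc_shift by simp
      next
        case True
        have "p permutes {2..2*m+1}"
        proof (rule permutes_superset[OF pp])
          fix x assume "x \<in> {0..2*m+1} - {2..2*m+1}"
          hence "x = 0 \<or> x = 1" by auto
          thus "p x = x" using True p0 by auto
        qed
        moreover have "p (2+2*k) < p (2+2*k+1)" if "k < m" for k
          using inc(1)[of "Suc k"] that by simp
        moreover have "p (2+2*k) < p (2+2*Suc k)" if "Suc k < m" for k
          using inc(2)[of "Suc k"] that by simp
        ultimately have "p \<in> pfaffian_perms 2 (2*m+1)" using card by (simp add: pfaffian_perms_def)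
        thus ?thesis using p by simp
      qed
    qed
  qed
  also have "\<dots> = (\<Sum>p\<in>pfaffian_perms 2 (2*m+1). B 0 1 * (of_int (sign p) * (\<Prod>k<m. B (p (2+2*k)) (p (2+2*k+1)))))"
  proof (intro sum.cong refl)
    fix p assume "p \<in> pfaffian_perms 2 (2*m+1)"
    hence pp: "p permutes {2..2*m+1}" by (simp add: pfaffian_perms_def)
    have "p 0 = 0" "p 1 = 1" using pp by (auto intro: permutes_not_in)
    thus "?t p = B 0 1 * (of_int (sign p) * (\<Prod>k<m. B (p (2+2*k)) (p (2+2*k+1))))"
      unfolding prod.lessThan_Suc_shift by (simp add: mult_ac)
  qed
  also have "\<dots> = B 0 1 * pfaffian 2 (2*m+1) B"
    unfolding pfaffian_def using card by (simp add: sum_distrib_left)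
  finally have P: "pfaffian 0 (2 * m + 1) B = B 0 1 * pfaffian 2 (2 * m + 1) B" .
  have "pfsum (Suc m) (\<lambda>i j. B (0 + i) (0 + j)) = of_nat (2 ^ Suc m * fact (Suc m)) * pfaffian 0 (2 * m + 1) B"
    by (rule pfsum_pfaffian[OF _ skew]) auto
  moreover have "pfsum m (\<lambda>i j. B (2 + i) (2 + j)) = of_nat (2 ^ m * fact m) * pfaffian 2 (2 * m + 1) B"
    by (rule pfsum_pfaffian[OF _ skew]) auto
  moreover have "of_nat (2 ^ Suc m * fact (Suc m)) = of_nat (2 * Suc m) * (of_nat (2 ^ m * fact m) :: 'a)"
    by (simp only: flip: of_nat_mult) (simp add: algebra_simps)
  ultimately show ?thesis by (simp only: P add_0 add.commute[of 2], simp only: mult_ac)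
qed

section \<open>The partition function as a Pfaffian\<close>

definition pair_den :: "'a::comm_ring_1 \<Rightarrow> 'a \<Rightarrow> 'a \<Rightarrow> 'a" where
  "pair_den r x y = (1 - x * y) * weight_a r x y"

text \<open>
  The entries \<open>pair_num / pair_den\<close> of the Pfaffian agree with the generating series of the
  theorem, with the parameters in place of the indeterminates. The denominator vanishes
  exactly where the partition function factors.
\<close>

definition pair_num :: "'a::comm_ring_1 \<Rightarrow> 'a \<Rightarrow> 'a \<Rightarrow> 'a \<Rightarrow> 'a" where
  "pair_num r s x y = (y - x) * (s\<^sup>2 * weight_a r x y + r * (1 + x) * (1 + y))"

definition pair_entry :: "'a::field \<Rightarrow> 'a \<Rightarrow> 'a \<Rightarrow> 'a \<Rightarrow> 'a" where
  "pair_entry r s x y = pair_num r s x y / pair_den r x y"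

fun vandermonde :: "'a::comm_ring_1 list \<Rightarrow> 'a" where
  "vandermonde [] = 1"
| "vandermonde (x # us) = (\<Prod>u\<leftarrow>us. u - x) * vandermonde us"

fun den_prod :: "'a::comm_ring_1 \<Rightarrow> 'a list \<Rightarrow> 'a" where
  "den_prod r [] = 1"
| "den_prod r (x # us) = (\<Prod>u\<leftarrow>us. pair_den r x u) * den_prod r us"

text \<open>
  Together with distinctness, this ensures that the interpolation points \<open>u\<close>, \<open>1 / u\<close> and the
  zero \<open>(1 - r * u) / (r - (r\<^sup>2 - 1) * u)\<close> of \<open>weight_a r x u\<close> as a function of \<open>x\<close>, for
  \<open>u\<close> in \<open>U\<close>, exist and are distinct, and that lines can be exchanged.
\<close>

definition generic :: "'a::field \<Rightarrow> 'a set \<Rightarrow> bool" where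
  "generic r U \<longleftrightarrow> (\<forall>x\<in>U. x \<noteq> 0 \<and> r - (r\<^sup>2 - 1) * x \<noteq> 0) \<and>
     (\<forall>x\<in>U. \<forall>y\<in>U. pair_den r x y \<noteq> 0 \<and> cross_eq r x y \<noteq> 0 \<and> x - r * (1 + x * y) + (r\<^sup>2 - 1) * y \<noteq> 0)"

lemma weight_a_sym: "weight_a r x y = weight_a r y x" by (simp add: weight_a_def algebra_simps)
lemma pair_den_sym: "pair_den r x y = pair_den r y x" by (simp add: pair_den_def weight_a_sym[of r x y] mult.commute)
lemma pair_num_skew: "pair_num r s y x = - pair_num r s x y" by (simp add: pair_num_def weight_a_sym[of r y x] algebra_simps)
lemma pair_entry_skew: "pair_entry r s y x = - pair_entry r s x y" by (simp add: pair_entry_def pair_num_skew[of r s y x] pair_den_sym[of r y x])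

lemma vandermonde_swap: "vandermonde (ws @ a # b # zs) = - vandermonde (ws @ b # a # zs)"
  by (induction ws) (auto simp: algebra_simps)

lemma den_prod_swap: "den_prod r (ws @ a # b # zs) = den_prod r (ws @ b # a # zs)"
  by (induction ws) (auto simp: pair_den_sym[of r a b] mult_ac)

text \<open>
  Row 0 of the Pfaffian belongs to the parameter \<open>x\<close> and is multiplied by the product of all
  its denominators, so that it is polynomial in \<open>x\<close> and makes sense at the poles.
\<close>

definition first_row :: "'a::comm_ring_1 \<Rightarrow> 'a \<Rightarrow> 'a list \<Rightarrow> 'a \<Rightarrow> nat \<Rightarrow> 'a" where
  "first_row r s us x j = (if j = 0 then 0 else
     pair_num r s x (us ! (j - 1)) * (\<Prod>i\<in>{..<length us} - {j - 1}. pair_den r x (us ! i)))"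

definition pair_entries :: "'a::field \<Rightarrow> 'a \<Rightarrow> 'a list \<Rightarrow> nat \<Rightarrow> nat \<Rightarrow> 'a" where
  "pair_entries r s us i j = pair_entry r s (us ! (i - 1)) (us ! (j - 1))"

text \<open>
  The identity to be proved for the parameters \<open>x # us\<close>, with the denominators of row 0
  cleared.
\<close>

definition cleared :: "'a::field \<Rightarrow> 'a \<Rightarrow> nat \<Rightarrow> 'a list \<Rightarrow> 'a \<Rightarrow> bool" where
  "cleared r s m us x \<longleftrightarrow> of_nat (2 ^ m * fact m) * vandermonde (x # us) * part_fn0 r s (x # us) =
     den_prod r us * pfsum m (border (first_row r s us x) (pair_entries r s us))"

lemma swap_nth:
  assumes "i < length (ws @ a # b # zs)"
  shows "(ws @ b # a # zs) ! i = (ws @ a # b # zs) ! (transpose (length ws) (Suc (length ws)) i)"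
proof -
  consider "i < length ws" | "i = length ws" | "i = Suc (length ws)" | "i > Suc (length ws)" by linarith
  thus ?thesis
    by cases (auto simp: Transposition.transpose_def nth_append nth_Cons split: nat.splits)
qed

text \<open>
  Both sides change their sign when two neighbouring parameters are exchanged.
\<close>

lemma cleared_swap:
  fixes r :: "'a::field_char_0"
  assumes c: "cleared r s m (ws @ a # b # zs) x" and len: "Suc (length (ws @ a # b # zs)) = 2 * m"
    and cross_eq: "cross_eq r a b \<noteq> 0"
  shows "cleared r s m (ws @ b # a # zs) x"
proof -
  let ?us = "ws @ a # b # zs" and ?us' = "ws @ b # a # zs" and ?k = "length ws"
  let ?t = "transpose ?k (Suc ?k)" and ?T = "transpose (Suc ?k) (Suc (Suc ?k))"
  have T: "?T permutes {..<2*m}" by (rule permutes_swap_id) (use len in auto)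
  have t_lt: "?t i < length ?us \<longleftrightarrow> i < length ?us" for i
    unfolding Transposition.transpose_def by simp
  have Tt: "?T (Suc i) = Suc (?t i)" for i by (auto simp: Transposition.transpose_def)
  have T0: "?T 0 = 0" by (auto simp: Transposition.transpose_def)
  have nth: "?us' ! i = ?us ! (?t i)" if "i < length ?us" for i by (rule swap_nth[OF that])
  have fr: "first_row r s ?us' x (Suc j) = first_row r s ?us x (?T (Suc j))" if "j < length ?us" for j
  proof -
    have "(\<Prod>i\<in>{..<length ?us'} - {j}. pair_den r x (?us' ! i)) = (\<Prod>i\<in>{..<length ?us} - {j}. pair_den r x (?us ! (?t i)))"
    proof (rule prod.cong)
      show "{..<length ?us'} - {j} = {..<length ?us} - {j}" by simp
      show "pair_den r x (?us' ! i) = pair_den r x (?us ! (?t i))" if "i \<in> {..<length ?us} - {j}" for i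
        by (rule arg_cong[of _ _ "pair_den r x"], rule nth) (use that in simp)
    qed
    also have "\<dots> = (\<Prod>i\<in>{..<length ?us} - {?t j}. pair_den r x (?us ! i))"
    proof (rule prod.reindex_bij_betw)
      show "bij_betw ?t ({..<length ?us} - {j}) ({..<length ?us} - {?t j})"
        by (rule bij_betwI[where g = ?t]) (auto simp del: length_append simp: t_lt, (metis transpose_involutory)+)
    qed
    finally show ?thesis by (simp add: first_row_def Tt nth[OF that])
  qed
  have "pfsum m (border (first_row r s ?us' x) (pair_entries r s ?us')) =
        pfsum m (\<lambda>i j. border (first_row r s ?us x) (pair_entries r s ?us) (?T i) (?T j))"
  proof (rule pfsum_cong)
    fix i j assume "i < 2 * m" "j < 2 * m"
    hence ij: "i - 1 < length ?us" "j - 1 < length ?us" using len by auto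
    show "border (first_row r s ?us' x) (pair_entries r s ?us') i j =
          border (first_row r s ?us x) (pair_entries r s ?us) (?T i) (?T j)"
    proof (cases i)
      case 0
      show ?thesis
      proof (cases j)
        case 0
        show ?thesis unfolding 0 \<open>i = 0\<close> T0 by (simp add: border_def first_row_def)
      next
        case (Suc j')
        show ?thesis unfolding Suc \<open>i = 0\<close> T0 using fr[of j'] ij Suc by (simp add: border_def)
      qed
    next
      case (Suc i')
      show ?thesis
      proof (cases j)
        case 0
        show ?thesis unfolding 0 Suc T0 using fr[of i'] ij Suc by (simp add: border_def Tt)
      next
        case (Suc j')
        show ?thesis unfolding Suc \<open>i = Suc i'\<close> using ij Suc \<open>i = Suc i'\<close> nth[of i'] nth[of j']
          by (simp add: border_def Tt pair_entries_def)
      qed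
    qed
  qed
  also have "\<dots> = - pfsum m (border (first_row r s ?us x) (pair_entries r s ?us))"
    by (subst pfsum_permute[OF T]) (simp add: sign_swap_id)
  finally have pf: "pfsum m (border (first_row r s ?us' x) (pair_entries r s ?us')) = - pfsum m (border (first_row r s ?us x) (pair_entries r s ?us))" .
  have "vandermonde (x # ?us') = - vandermonde (x # ?us)" using vandermonde_swap[of "x # ws" b a zs] by simp
  moreover have "part_fn0 r s (x # ?us') = part_fn0 r s (x # ?us)" using part_fn0_swap[OF cross_eq, of s "x # ws" zs] by simp
  moreover have "den_prod r ?us' = den_prod r ?us" by (rule den_prod_swap)
  ultimately show ?thesis using c unfolding cleared_def pf by simp
qed

lemma cleared_move:
  fixes r :: "'a::field_char_0"
  assumes "cleared r s m (u # ws @ zs) x" "Suc (length (u # ws @ zs)) = 2 * m"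
    "\<And>w. w \<in> set ws \<Longrightarrow> cross_eq r u w \<noteq> 0"
  shows "cleared r s m (ws @ u # zs) x"
  using assms
proof (induction ws arbitrary: zs rule: rev_induct)
  case (snoc w ws)
  have "cleared r s m (ws @ u # w # zs) x" by (rule snoc.IH) (use snoc.prems in auto)
  hence "cleared r s m (ws @ w # u # zs) x" by (rule cleared_swap) (use snoc.prems in auto)
  thus ?case by simp
qed simp

lemma part_fn0_move_last:
  fixes r :: "'a::idom"
  assumes "\<And>w. w \<in> set ws \<Longrightarrow> cross_eq r u w \<noteq> 0"
  shows "part_fn0 r s (pre @ u # ws) = part_fn0 r s (pre @ ws @ [u])"
  using assms
proof (induction ws arbitrary: pre)
  case (Cons w ws)
  have "part_fn0 r s (pre @ u # w # ws) = part_fn0 r s (pre @ w # u # ws)"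
    by (rule part_fn0_swap[symmetric]) (use Cons.prems in auto)
  also have "\<dots> = part_fn0 r s (pre @ (w # ws) @ [u])" using Cons.IH[of "pre @ [w]"] Cons.prems by simp
  finally show ?case .
qed simp

text \<open>
  The frozen lines contribute the factors of the smaller Pfaffian identity, because at a pole
  \<open>(w - x) * (w - u)\<close> equals \<open>(1 - x * w) * (1 - u * w)\<close> or \<open>weight_a r x w * weight_a r u w\<close>,
  depending on which factor of the denominator vanishes.
\<close>

lemma pole_value:
  fixes r :: "'a::field_char_0"
  assumes q: "pair_den r x u = 0" and cross_eq: "\<And>w. w \<in> set ws \<Longrightarrow> cross_eq r u w \<noteq> 0"
  shows "(u - x) * (\<Prod>w\<leftarrow>ws. (w - x) * (w - u)) * part_fn0 r s (x # u # ws) =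
     pair_num r s x u * (\<Prod>w\<leftarrow>ws. pair_den r x w * pair_den r u w) * part_fn0 r s ws"
proof -
  have pm: "(\<Prod>w\<leftarrow>ws. f w) * (\<Prod>w\<leftarrow>ws. g w) = (\<Prod>w\<leftarrow>ws. h w)" if "\<And>w. f w * g w = h w" for f g h :: "'a \<Rightarrow> 'a"
    by (induction ws) (auto simp: that[symmetric] algebra_simps)
  from q consider "x * u = 1" | "weight_a r x u = 0" by (auto simp: pair_den_def)
  thus ?thesis
  proof cases
    case 1
    have "(\<Prod>w\<leftarrow>ws. (w - x) * (w - u)) * (\<Prod>w\<leftarrow>ws. weight_a r x w * weight_a r u w) = (\<Prod>w\<leftarrow>ws. pair_den r x w * pair_den r u w)"
    proof (rule pm)
      fix w
      have "(w - x) * (w - u) = (1 - x * w) * (1 - u * w) + (x * u - 1) * (1 - w * w)"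
        by (simp add: left_diff_distrib right_diff_distrib mult_ac)
      hence "(w - x) * (w - u) = (1 - x * w) * (1 - u * w)" by (simp only: 1 diff_self mult_zero_left add_0_right)
      thus "(w - x) * (w - u) * (weight_a r x w * weight_a r u w) = pair_den r x w * pair_den r u w"
        by (simp only: pair_den_def mult_ac)
    qed
    note e = this
    show ?thesis unfolding part_fn0_Cons_Cons_inverse[OF 1] pair_num_def by (simp only: e[symmetric]) (simp only: mult_ac)
  next
    case 2
    have e: "(\<Prod>w\<leftarrow>ws. (w - x) * (w - u)) * (\<Prod>w\<leftarrow>ws. (1 - x * w) * (1 - u * w)) = (\<Prod>w\<leftarrow>ws. pair_den r x w * pair_den r u w)"
    proof (rule pm)
      fix w
      have "weight_a r x w * weight_a r u w = (w - x) * (w - u) + weight_a r x u * (1 - 2 * r * w + (r\<^sup>2 - 1) * w * w)"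
        by (simp add: weight_a_def algebra_simps power2_eq_square)
      thus "(w - x) * (w - u) * ((1 - x * w) * (1 - u * w)) = pair_den r x w * pair_den r u w"
        by (simp add: 2 pair_den_def mult_ac)
    qed
    have m: "part_fn0 r s (x # u # ws) = part_fn0 r s (x # ws @ [u])"
      using part_fn0_move_last[of ws r u s "[x]"] cross_eq by simp
    show ?thesis unfolding pair_num_def 2 m part_fn0_weight_a_zero[OF 2] mult_zero_right add_0_left
      by (simp only: e[symmetric]) (simp only: mult_ac)
  qed
qed

text \<open>
  At a zero of \<open>pair_den r x u\<close>, all entries of the cleared first row but the one at \<open>u\<close>
  vanish. This leaves a smaller Pfaffian, as \<open>pole_value\<close> does for the partition function.
\<close>

lemma cleared_pole:
  fixes r :: "'a::field_char_0"
  assumes q: "pair_den r x u = 0" and cross_eq: "\<And>w. w \<in> set ws \<Longrightarrow> cross_eq r u w \<noteq> 0"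
    and len: "length ws = 2 * m"
    and IH: "of_nat (2 ^ m * fact m) * vandermonde ws * part_fn0 r s ws = den_prod r ws * pfsum m (\<lambda>i j. pair_entry r s (ws ! i) (ws ! j))"
  shows "cleared r s (Suc m) (u # ws) x"
proof -
  let ?B = "border (first_row r s (u # ws) x) (pair_entries r s (u # ws))"
  have skew: "?B j i = - ?B i j" for i j
    by (auto simp: border_def first_row_def pair_entries_def pair_entry_skew[of r s "(u # ws) ! (j - Suc 0)"])
  have z: "?B 0 j = 0" if "2 \<le> j" for j
  proof -
    have "(\<Prod>i\<in>{..<length (u # ws)} - {j - 1}. pair_den r x ((u # ws) ! i)) = 0"
      by (rule prod_zero) (use that q in \<open>auto intro!: bexI[of _ 0]\<close>)
    thus ?thesis by (simp add: border_def first_row_def)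
  qed
  have "{..<Suc (length ws)} - {0} = Suc ` {..<length ws}" by (auto simp: lessThan_Suc_eq_insert_0)
  hence "(\<Prod>i\<in>{..<Suc (length ws)} - {0}. pair_den r x ((u # ws) ! i)) = (\<Prod>i<length ws. pair_den r x (ws ! i))"
    by (simp add: prod.reindex)
  also have "\<dots> = (\<Prod>w\<leftarrow>ws. pair_den r x w)" by (simp add: prod.list_conv_set_nth atLeast0LessThan)
  finally have B01: "?B 0 1 = pair_num r s x u * (\<Prod>w\<leftarrow>ws. pair_den r x w)"
    by (simp add: border_def first_row_def)
  have Bs: "(\<lambda>i j. ?B (i + 2) (j + 2)) = (\<lambda>i j. pair_entry r s (ws ! i) (ws ! j))"
    by (auto simp: fun_eq_iff border_def pair_entries_def)
  have pf: "pfsum (Suc m) ?B = of_nat (2 * Suc m) * (pair_num r s x u * (\<Prod>w\<leftarrow>ws. pair_den r x w)) * pfsum m (\<lambda>i j. pair_entry r s (ws ! i) (ws ! j))"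
    using pfsum_first_pair[of ?B m, OF skew] z unfolding B01 Bs by blast
  have c: "of_nat (2 ^ Suc m * fact (Suc m)) = of_nat (2 * Suc m) * (of_nat (2 ^ m * fact m) :: 'a)"
    by (simp only: flip: of_nat_mult) (simp add: algebra_simps)
  have pm: "(\<Prod>w\<leftarrow>ws. f w * g w) = (\<Prod>w\<leftarrow>ws. f w) * (\<Prod>w\<leftarrow>ws. g w)" for f g :: "'a \<Rightarrow> 'a"
    by (induction ws) (auto simp: algebra_simps)
  have "of_nat (2 ^ Suc m * fact (Suc m)) * vandermonde (x # u # ws) * part_fn0 r s (x # u # ws)
    = of_nat (2 * Suc m) * (of_nat (2 ^ m * fact m) * vandermonde ws) * ((u - x) * (\<Prod>w\<leftarrow>ws. (w - x) * (w - u)) * part_fn0 r s (x # u # ws))"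
    unfolding c pm by (simp only: vandermonde.simps list.map prod_list.Cons mult_ac)
  also have "\<dots> = of_nat (2 * Suc m) * (of_nat (2 ^ m * fact m) * vandermonde ws * part_fn0 r s ws) * (pair_num r s x u * (\<Prod>w\<leftarrow>ws. pair_den r x w * pair_den r u w))"
    by (simp only: pole_value[OF q cross_eq, of ws s]) (simp only: mult_ac)
  also have "\<dots> = den_prod r (u # ws) * pfsum (Suc m) ?B"
    unfolding IH pf pm by (simp only: den_prod.simps mult_ac)
  finally show ?thesis unfolding cleared_def .
qed

lemma border_clear:
  fixes r :: "'a::field"
  assumes m: "m \<ge> 1" "Suc (length us) = 2 * m" and nz: "\<And>u. u \<in> set us \<Longrightarrow> pair_den r x u \<noteq> 0"
  shows "pfsum m (border (first_row r s us x) (pair_entries r s us)) =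
    (\<Prod>u\<leftarrow>us. pair_den r x u) * pfsum m (\<lambda>i j. pair_entry r s ((x # us) ! i) ((x # us) ! j))"
proof -
  obtain c where c: "\<And>b. pfsum m (border b (pair_entries r s us)) = (\<Sum>j\<in>{1..<2*m}. c j * b j)"
    using pfsum_border[OF m(1)] by blast
  have fr: "first_row r s us x j = (\<Prod>u\<leftarrow>us. pair_den r x u) * pair_entry r s x (us ! (j - 1))" if "j \<in> {1..<2*m}" for j
  proof -
    have "(\<Prod>u\<leftarrow>us. pair_den r x u) = (\<Prod>i<length us. pair_den r x (us ! i))"
      by (simp add: prod.list_conv_set_nth atLeast0LessThan)
    also have "\<dots> = pair_den r x (us ! (j - 1)) * (\<Prod>i\<in>{..<length us} - {j - 1}. pair_den r x (us ! i))"
      by (rule prod.remove) (use that m in auto)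
    finally have "(\<Prod>u\<leftarrow>us. pair_den r x u) = pair_den r x (us ! (j - 1)) * (\<Prod>i\<in>{..<length us} - {j - 1}. pair_den r x (us ! i))" .
    moreover have "us ! (j - 1) \<in> set us" using that m by (intro nth_mem) auto
    hence "pair_den r x (us ! (j - 1)) \<noteq> 0" by (rule nz)
    ultimately show ?thesis using that by (simp add: first_row_def pair_entry_def)
  qed
  have "pfsum m (border (first_row r s us x) (pair_entries r s us)) =
     (\<Prod>u\<leftarrow>us. pair_den r x u) * pfsum m (border (\<lambda>j. if j = 0 then 0 else pair_entry r s x (us ! (j - 1))) (pair_entries r s us))"
    unfolding c sum_distrib_left by (intro sum.cong refl) (auto simp: fr)
  also have "border (\<lambda>j. if j = 0 then 0 else pair_entry r s x (us ! (j - 1))) (pair_entries r s us) = (\<lambda>i j. pair_entry r s ((x # us) ! i) ((x # us) ! j))"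
    by (auto simp: fun_eq_iff border_def pair_entries_def nth_Cons' pair_entry_def[of r s x x] pair_num_def intro: pair_entry_skew[symmetric])
  finally show ?thesis .
qed

text \<open>
  If the first parameter is repeated, then both sides vanish.
\<close>

lemma cleared_repeated:
  fixes r :: "'a::field_char_0"
  assumes m: "m \<ge> 1" "Suc (length us) = 2 * m" and nz: "\<And>v. v \<in> set us \<Longrightarrow> pair_den r u v \<noteq> 0" and u: "u \<in> set us"
  shows "cleared r s m us u"
proof -
  obtain k where k: "k < length us" "us ! k = u" using u by (metis in_set_conv_nth)
  have "pfsum m (\<lambda>i j. pair_entry r s ((u # us) ! i) ((u # us) ! j)) = 0"
  proof (rule pfsum_repeated[of 0 _ "Suc k"])
    have "(u # us) ! (transpose 0 (Suc k) i) = (u # us) ! i" for i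
      using k by (auto simp: Transposition.transpose_def)
    thus "pair_entry r s ((u # us) ! (transpose 0 (Suc k) i)) ((u # us) ! (transpose 0 (Suc k) j))
       = pair_entry r s ((u # us) ! i) ((u # us) ! j)" for i j by simp
  qed (use m k in auto)
  moreover have "(\<Prod>v\<leftarrow>us. v - u) = 0" using u by (induction us) auto
  ultimately show ?thesis using border_clear[OF m nz, of s] by (simp add: cleared_def)
qed

text \<open>
  Lagrange interpolation in \<open>x\<close>: both sides have degree at most \<open>2 * length us\<close> and agree at
  \<open>3 * length us\<close> points.
\<close>

lemma cleared_all:
  fixes r :: "'a::field_char_0"
  assumes gen: "generic r (set us)" and dist: "distinct us" and len: "length us = Suc (2 * m)"
    and IH: "\<And>ws. length ws = 2 * m \<Longrightarrow> distinct ws \<Longrightarrow> generic r (set ws) \<Longrightarrow>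
      of_nat (2 ^ m * fact m) * vandermonde ws * part_fn0 r s ws = den_prod r ws * pfsum m (\<lambda>i j. pair_entry r s (ws ! i) (ws ! j))"
  shows "cleared r s (Suc m) us x"
proof -
  have pole: "cleared r s (Suc m) us x" if u: "u \<in> set us" "pair_den r x u = 0" for u x
  proof -
    obtain ws zs where us: "us = ws @ u # zs" using u(1) by (metis split_list)
    have g: "generic r (set (ws @ zs))" using gen unfolding us generic_def by auto
    have cross_eq: "cross_eq r u w \<noteq> 0" if "w \<in> set (ws @ zs)" for w using gen that unfolding us generic_def by auto
    have "cleared r s (Suc m) (u # ws @ zs) x"
      by (rule cleared_pole[OF u(2) cross_eq _ IH]) (use len dist g us in auto)
    thus ?thesis unfolding us by (rule cleared_move) (use cross_eq len us in auto)
  qed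
  \<comment> \<open>The zero of \<open>weight_a r x u\<close> as a function of \<open>x\<close>.\<close>
  define mu where "mu = (\<lambda>u. (1 - r * u) / (r - (r\<^sup>2 - 1) * u))"
  have den: "u \<noteq> 0" "r - (r\<^sup>2 - 1) * u \<noteq> 0" if "u \<in> set us" for u using gen that by (auto simp: generic_def)
  have mu0: "weight_a r x u = (r - (r\<^sup>2 - 1) * u) * (mu u - x)" if "u \<in> set us" for x u
    using den[OF that] by (simp add: mu_def weight_a_def field_simps)
  have pair_den0: "pair_den r u v \<noteq> 0" "u - r * (1 + u * v) + (r\<^sup>2 - 1) * v \<noteq> 0" if "u \<in> set us" "v \<in> set us" for u v
    using gen that by (auto simp: generic_def)
  define S where "S = set us \<union> inverse ` set us \<union> mu ` set us"
  have Sc: "cleared r s (Suc m) us x" if xS: "x \<in> S" for x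
  proof -
    consider "x \<in> set us" | u where "u \<in> set us" "x = inverse u" | u where "u \<in> set us" "x = mu u"
      using xS unfolding S_def by blast
    thus ?thesis
    proof cases
      case 1
      thus ?thesis by (intro cleared_repeated) (use len pair_den0 in auto)
    next
      case 2
      thus ?thesis using den[OF 2(1)] by (intro pole[of u]) (auto simp: pair_den_def)
    next
      case 3
      thus ?thesis by (intro pole[of u]) (auto simp: pair_den_def mu0)
    qed
  qed
  have d1: "set us \<inter> inverse ` set us = {}"
  proof -
    have False if "u \<in> set us" "v \<in> set us" "u = inverse v" for u v
      using pair_den0(1)[OF that(1,2)] den[OF that(2)] that(3) by (auto simp: pair_den_def)
    thus ?thesis by blast
  qed
  have d2: "set us \<inter> mu ` set us = {}"
  proof -
    have False if "u \<in> set us" "v \<in> set us" "u = mu v" for u v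
      using pair_den0(1)[OF that(1,2)] mu0[OF that(2), of u] that(3) by (auto simp: pair_den_def)
    thus ?thesis by blast
  qed
  have d3: "inverse ` set us \<inter> mu ` set us = {}"
  proof -
    have False if "u \<in> set us" "v \<in> set us" "inverse u = mu v" for u v
    proof -
      have "weight_a r (inverse u) v = 0" using mu0[OF that(2), of "inverse u"] that(3) by simp
      hence "u * weight_a r (inverse u) v = 0" by simp
      moreover have "u * weight_a r (inverse u) v = u - r * (u * inverse u + u * v) + (r\<^sup>2 - 1) * (u * inverse u) * v"
        unfolding weight_a_def by (simp add: left_diff_distrib right_diff_distrib distrib_left mult_ac)
      ultimately have "u - r * (1 + u * v) + (r\<^sup>2 - 1) * v = 0"
        by (simp only: right_inverse[OF den(1)[OF that(1)]] mult_1_right)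
      thus False using pair_den0(2)[OF that(1,2)] by simp
    qed
    thus ?thesis by blast
  qed
  have inj_mu: "inj_on mu (set us)"
  proof (rule inj_onI)
    fix u v assume uv: "u \<in> set us" "v \<in> set us" "mu u = mu v"
    have "(1 - r * u) * (r - (r\<^sup>2 - 1) * v) = (1 - r * v) * (r - (r\<^sup>2 - 1) * u)"
      using uv(3) den[OF uv(1)] den[OF uv(2)] by (simp add: mu_def frac_eq_eq)
    thus "u = v" by (simp add: algebra_simps power2_eq_square)
  qed
  have cardS: "card S = 3 * length us"
  proof -
    have "card S = card (set us \<union> inverse ` set us) + card (mu ` set us)"
      unfolding S_def by (rule card_Un_disjoint) (use d2 d3 in auto)
    also have "card (set us \<union> inverse ` set us) = card (set us) + card (inverse ` set us)"
      by (rule card_Un_disjoint) (use d1 in auto)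
    finally show ?thesis using dist card_image[OF inj_mu] by (simp add: card_image distinct_card inj_on_def)
  qed
  obtain p where p: "degree p \<le> 2 * length us"
    "\<And>x. poly p x = of_nat (2 ^ Suc m * fact (Suc m)) * vandermonde (x # us) * part_fn0 r s (x # us)"
  proof -
    obtain z where z: "degree z \<le> length us" "\<And>x. poly z x = part_fn0 r s (x # us)" using part_fn0_Cons_poly by metis
    define v where "v = (\<Prod>u\<leftarrow>us. [:u, -1:])"
    have v: "degree v \<le> length us" unfolding v_def
    proof (induction us)
      case (Cons a us)
      have "degree ([:a, -1:] * (\<Prod>u\<leftarrow>us. [:u, -1:])) \<le> degree [:a, -1:] + degree (\<Prod>u\<leftarrow>us. [:u, -1:])"
        by (rule degree_mult_le)
      thus ?case using Cons.IH by (simp del: mult_pCons_left)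
    qed simp
    have pv: "poly v x = (\<Prod>u\<leftarrow>us. u - x)" for x
      unfolding v_def by (induction us) (auto simp: algebra_simps)
    show ?thesis
    proof (rule that)
      show "degree (smult (of_nat (2 ^ Suc m * fact (Suc m)) * vandermonde us) (v * z)) \<le> 2 * length us"
        using degree_mult_le[of v z] v z(1) by (intro order.trans[OF degree_smult_le]) auto
      show "poly (smult (of_nat (2 ^ Suc m * fact (Suc m)) * vandermonde us) (v * z)) x =
        of_nat (2 ^ Suc m * fact (Suc m)) * vandermonde (x # us) * part_fn0 r s (x # us)" for x
        by (simp only: poly_smult poly_mult pv z vandermonde.simps mult_ac)
    qed
  qed
  obtain q where q: "degree q \<le> 2 * length us"
    "\<And>x. poly q x = den_prod r us * pfsum (Suc m) (border (first_row r s us x) (pair_entries r s us))"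
  proof -
    obtain c where c: "\<And>b. pfsum (Suc m) (border b (pair_entries r s us)) = (\<Sum>j\<in>{1..<2*Suc m}. c j * b j)"
      using pfsum_border[of "Suc m" "pair_entries r s us"] by auto
    define Q where "Q u = [:1, - u:] * [:1 - r * u, (r\<^sup>2 - 1) * u - r:]" for u
    define N where "N u = [:u, -1:] * [:s\<^sup>2 * (1 - r * u) + r * (1 + u), s\<^sup>2 * ((r\<^sup>2 - 1) * u - r) + r * (1 + u):]" for u
    have Q: "poly (Q u) x = pair_den r x u" "degree (Q u) \<le> 2" for u x
      by (simp add: Q_def pair_den_def weight_a_def algebra_simps)
         (use degree_mult_le[of "[:1, - u:]" "[:1 - r * u, (r\<^sup>2 - 1) * u - r:]"] in
           \<open>auto simp: Q_def simp del: mult_pCons_left split: if_splits\<close>)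
    have N: "poly (N u) x = pair_num r s x u" "degree (N u) \<le> 2" for u x
      by (simp add: N_def pair_num_def weight_a_def algebra_simps)
         (use degree_mult_le[of "[:u, -1:]"
             "[:s\<^sup>2 * (1 - r * u) + r * (1 + u), s\<^sup>2 * ((r\<^sup>2 - 1) * u - r) + r * (1 + u):]"] in
           \<open>auto simp: N_def simp del: mult_pCons_left split: if_splits\<close>)
    define F where "F j = N (us ! (j - 1)) * (\<Prod>i\<in>{..<length us} - {j - 1}. Q (us ! i))" for j
    have F: "poly (F j) x = first_row r s us x j" if "j \<in> {1..<2*Suc m}" for j x
      using that by (simp add: F_def first_row_def poly_prod N Q)
    have dF: "degree (F j) \<le> 2 * length us" if "j \<in> {1..<2*Suc m}" for j
    proof -
      have "degree (\<Prod>i\<in>{..<length us} - {j - 1}. Q (us ! i)) \<le> (\<Sum>i\<in>{..<length us} - {j - 1}. 2)"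
        by (rule order.trans[OF degree_prod_sum_le[OF finite_Diff[OF finite_lessThan]]]; unfold comp_def)
           (intro sum_mono Q)
      also have "\<dots> = 2 * (length us - 1)"
      proof -
        have "j - 1 \<in> {..<length us}" using that len by auto
        thus ?thesis by (simp add: card_Diff_singleton)
      qed
      finally have "degree (F j) \<le> 2 + 2 * (length us - 1)"
        unfolding F_def using N(2)[of "us ! (j - 1)"] by (intro order.trans[OF degree_mult_le]) linarith
      thus ?thesis using len by simp
    qed
    show ?thesis
    proof (rule that)
      show "degree (smult (den_prod r us) (\<Sum>j\<in>{1..<2*Suc m}. smult (c j) (F j))) \<le> 2 * length us"
        by (intro order.trans[OF degree_smult_le] degree_sum_le) (auto intro: order.trans[OF degree_smult_le] dF)
      show "poly (smult (den_prod r us) (\<Sum>j\<in>{1..<2*Suc m}. smult (c j) (F j))) x =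
         den_prod r us * pfsum (Suc m) (border (first_row r s us x) (pair_entries r s us))" for x
        unfolding c poly_smult poly_sum by (intro arg_cong2[where f = "(*)"] sum.cong refl) (simp only: F)
    qed
  qed
  have "p = q"
  proof (rule poly_eqI_degree)
    show "poly p x = poly q x" if "x \<in> S" for x using Sc[OF that] by (simp only: p(2) q(2) cleared_def)
  qed (use p(1) q(1) cardS len in auto)
  thus ?thesis unfolding cleared_def using p(2) q(2) by metis
qed

theorem partition_pfaffian_even:
  fixes r :: "'a::field_char_0"
  assumes "generic r (set us)" "distinct us" "length us = 2 * m"
  shows "of_nat (2 ^ m * fact m) * vandermonde us * part_fn0 r s us = den_prod r us * pfsum m (\<lambda>i j. pair_entry r s (us ! i) (us ! j))"
  using assms
proof (induction m arbitrary: us)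
  case 0
  thus ?case by (simp add: part_fn0_def pfsum_def)
next
  case (Suc m)
  then obtain x us' where us: "us = x # us'" by (cases us) auto
  have "cleared r s (Suc m) us' x"
    by (rule cleared_all[OF _ _ _ Suc.IH]) (use Suc.prems us in \<open>auto simp: generic_def\<close>)
  moreover have "pfsum (Suc m) (border (first_row r s us' x) (pair_entries r s us')) =
    (\<Prod>u\<leftarrow>us'. pair_den r x u) * pfsum (Suc m) (\<lambda>i j. pair_entry r s (us ! i) (us ! j))"
    unfolding us by (rule border_clear) (use Suc.prems us in \<open>auto simp: generic_def\<close>)
  ultimately show ?case by (simp add: cleared_def us mult_ac)
qed

text \<open>
  Apply \<open>cleared_all\<close> with first parameter -1. Then all entries of the first row are equal,
  since \<open>pair_num r s (-1) u = s\<^sup>2 * pair_den r (-1) u\<close>.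
\<close>

theorem partition_pfaffian_odd:
  fixes r :: "'a::field_char_0"
  assumes gen: "generic r (set us)" and dist: "distinct us" and len: "length us = Suc (2 * m)"
    and nz: "s \<noteq> 0" "\<And>u. u \<in> set us \<Longrightarrow> pair_den r (-1) u \<noteq> 0"
  shows "of_nat (2 ^ Suc m * fact (Suc m)) * vandermonde us * part_fn0 r s us =
      s * den_prod r us * pfsum (Suc m) (border (\<lambda>_. 1) (pair_entries r s us))"
proof -
  define q where "q = (\<Prod>u\<leftarrow>us. pair_den r (-1) u)"
  have q0: "q \<noteq> 0" unfolding q_def using nz(2) by (induction us) auto
  have q: "(\<Prod>u\<leftarrow>us. u - (-1)) * (\<Prod>u\<leftarrow>us. weight_a r (-1) u) = q"
    unfolding q_def pair_den_def by (induction us) (auto simp: algebra_simps)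
  obtain c where c: "\<And>b. pfsum (Suc m) (border b (pair_entries r s us)) = (\<Sum>j\<in>{1..<2*Suc m}. c j * b j)"
    using pfsum_border[of "Suc m" "pair_entries r s us"] by auto
  have fr: "first_row r s us (-1) j = s\<^sup>2 * q" if "j \<in> {1..<2*Suc m}" for j
  proof -
    have "q = (\<Prod>i<length us. pair_den r (-1) (us ! i))"
      by (simp add: q_def prod.list_conv_set_nth atLeast0LessThan)
    also have "\<dots> = pair_den r (-1) (us ! (j - 1)) * (\<Prod>i\<in>{..<length us} - {j - 1}. pair_den r (-1) (us ! i))"
      by (rule prod.remove) (use that len in auto)
    moreover have "pair_num r s (-1) u = s\<^sup>2 * pair_den r (-1) u" for u
      by (simp add: pair_num_def pair_den_def algebra_simps)
    ultimately show ?thesis using that by (simp add: first_row_def mult_ac)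
  qed
  have "pfsum (Suc m) (border (first_row r s us (-1)) (pair_entries r s us)) = s\<^sup>2 * q * pfsum (Suc m) (border (\<lambda>_. 1) (pair_entries r s us))"
    unfolding c sum_distrib_left by (intro sum.cong refl) (simp add: fr)
  moreover have "cleared r s (Suc m) us (-1)"
    by (rule cleared_all[OF gen dist len]) (rule partition_pfaffian_even)
  ultimately have "of_nat (2 ^ Suc m * fact (Suc m)) * ((\<Prod>u\<leftarrow>us. u - (-1)) * vandermonde us) * (s * (\<Prod>u\<leftarrow>us. weight_a r (-1) u) * part_fn0 r s us)
      = den_prod r us * (s\<^sup>2 * q * pfsum (Suc m) (border (\<lambda>_. 1) (pair_entries r s us)))"
    by (simp only: cleared_def vandermonde.simps part_fn0_Cons_minus_one)
  hence "(s * q) * (of_nat (2 ^ Suc m * fact (Suc m)) * vandermonde us * part_fn0 r s us) =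
     (s * q) * (s * den_prod r us * pfsum (Suc m) (border (\<lambda>_. 1) (pair_entries r s us)))"
    by (simp only: q[symmetric] power2_eq_square mult_ac)
  thus ?thesis using nz(1) q0 by (metis mult_left_cancel mult_eq_0_iff)
qed

section \<open>The lowest coefficient of a Pfaffian of power series\<close>

definition fps_agree :: "nat \<Rightarrow> 'a::comm_ring_1 fps \<Rightarrow> 'a fps \<Rightarrow> bool" where
  "fps_agree W f g \<longleftrightarrow> (\<forall>d\<le>W. fps_nth f d = fps_nth g d)"

lemma fps_agree_refl: "fps_agree W f f" by (simp add: fps_agree_def)

lemma fps_agree_mult: "fps_agree W f g \<Longrightarrow> fps_agree W f' g' \<Longrightarrow> fps_agree W (f * f') (g * g')"
  by (auto simp: fps_agree_def fps_mult_nth intro!: sum.cong)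

lemma fps_agree_prod: "(\<And>k. k \<in> A \<Longrightarrow> fps_agree W (f k) (g k)) \<Longrightarrow> fps_agree W (prod f A) (prod g A)"
  by (induction A rule: infinite_finite_induct) (auto intro: fps_agree_mult fps_agree_refl)

lemma fps_agree_sum: "(\<And>k. k \<in> A \<Longrightarrow> fps_agree W (f k) (g k)) \<Longrightarrow> fps_agree W (sum f A) (sum g A)"
  by (auto simp: fps_agree_def fps_sum_nth intro!: sum.cong)

lemma pfsum_agree:
  assumes "\<And>i j. i < 2*m \<Longrightarrow> j < 2*m \<Longrightarrow> fps_agree W (B i j) (B' i j)"
  shows "fps_agree W (pfsum m B) (pfsum m B')"
  unfolding pfsum_def
proof (intro fps_agree_sum fps_agree_mult fps_agree_prod fps_agree_refl)
  fix p k assume "p \<in> {p. p permutes {..<2*m}}" "k \<in> {..<m}"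
  hence "p (2*k) \<in> {..<2*m}" "p (2*k+1) \<in> {..<2*m}"
    by (subst permutes_in_image; simp)+
  thus "fps_agree W (B (p (2*k)) (p (2*k+1))) (B' (p (2*k)) (p (2*k+1)))" by (intro assms) auto
qed

text \<open>
  The determinant of the columns \<open>e 0, ..., e (n - 1)\<close> of \<open>C\<close>.
\<close>

definition alt_sum :: "nat \<Rightarrow> (nat \<Rightarrow> nat \<Rightarrow> 'a::comm_ring_1) \<Rightarrow> (nat \<Rightarrow> nat) \<Rightarrow> 'a" where
  "alt_sum n C e = (\<Sum>p | p permutes {..<n}. of_int (sign p) * (\<Prod>i<n. C (p i) (e i)))"

lemma alt_sum_det: "alt_sum n C e = det (mat n n (\<lambda>(i, j). C j (e i)))"
proof -
  have "det (mat n n (\<lambda>(i, j). C j (e i))) =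
     (\<Sum>p | p permutes {0..<n}. signof p * (\<Prod>i = 0..<n. mat n n (\<lambda>(i, j). C j (e i)) $$ (i, p i)))"
    by (rule det_def') auto
  also have "\<dots> = alt_sum n C e" unfolding alt_sum_def atLeast0LessThan
  proof (intro sum.cong refl arg_cong2[where f = "(*)"] prod.cong)
    fix p i assume "p \<in> {p. p permutes {..<n}}" "i \<in> {..<n}"
    hence "p i < n" "i < n" using permutes_in_image[of p "{..<n}" i] by auto
    thus "mat n n (\<lambda>(i, j). C j (e i)) $$ (i, p i) = C (p i) (e i)" by simp
  qed
  finally show ?thesis by simp
qed

lemma alt_sum_not_inj:
  assumes "\<not> inj_on e {..<n}"
  shows "alt_sum n C e = 0"
proof -
  obtain i j where ij: "i < n" "j < n" "i \<noteq> j" "e i = e j" using assms by (auto simp: inj_on_def)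
  show ?thesis unfolding alt_sum_det
    by (rule det_identical_rows[of _ n i j]) (use ij in \<open>auto intro!: eq_vecI\<close>)
qed

lemma alt_sum_perm:
  assumes q: "q permutes {..<n}"
  shows "alt_sum n C q = of_int (sign q) * alt_sum n C id"
proof -
  have *: "permutation p" if "p permutes {..<n}" for p using that permutation_permutes by blast
  have pr: "(\<Prod>i<n. C (p i) i) = (\<Prod>i<n. C (p (q i)) (q i))" for p
    using prod.permute[OF q, of "\<lambda>i. C (p i) i"] by (simp add: comp_def)
  have "alt_sum n C id = (\<Sum>p | p permutes {..<n}. of_int (sign p) * (\<Prod>i<n. C ((p \<circ> q) i) (q i)))"
    unfolding alt_sum_def by (intro sum.cong refl) (simp add: pr)
  also have "\<dots> = (\<Sum>p | p permutes {..<n}. of_int (sign q) * (of_int (sign (p \<circ> q)) * (\<Prod>i<n. C ((p \<circ> q) i) (q i))))"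
  proof (intro sum.cong refl)
    fix p assume "p \<in> {p. p permutes {..<n}}"
    hence "sign (p \<circ> q) = sign p * sign q" using * q by (simp only: sign_compose mem_Collect_eq)
    hence "sign q * sign (p \<circ> q) = sign p" by (simp add: sign_idempotent mult.left_commute)
    hence "of_int (sign q) * of_int (sign (p \<circ> q)) = (of_int (sign p) :: 'a)" by (metis of_int_mult)
    thus "of_int (sign p) * (\<Prod>i<n. C ((p \<circ> q) i) (q i)) =
       of_int (sign q) * (of_int (sign (p \<circ> q)) * (\<Prod>i<n. C ((p \<circ> q) i) (q i)))"
      by (simp only: mult.assoc[symmetric])
  qed
  also have "\<dots> = of_int (sign q) *
      (\<Sum>p | p permutes {..<n}. of_int (sign (p \<circ> q)) * (\<Prod>i<n. C ((p \<circ> q) i) (q i)))"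
    by (rule sum_distrib_left[symmetric])
  also have "(\<Sum>p | p permutes {..<n}. of_int (sign (p \<circ> q)) * (\<Prod>i<n. C ((p \<circ> q) i) (q i))) = alt_sum n C q"
    unfolding alt_sum_def by (rule sum_permutations_compose_right[OF q, symmetric])
  finally have "of_int (sign q) * alt_sum n C id = of_int (sign q * sign q) * alt_sum n C q"
    by (simp only: of_int_mult mult.assoc)
  thus ?thesis by (simp only: sign_idempotent of_int_1 mult_1)
qed

lemma prod_pairs: "(\<Prod>i<2*m. f i) = (\<Prod>k<m. f (2*k) * f (2*k+1))" for f :: "nat \<Rightarrow> 'b::comm_monoid_mult"
  by (induction m) (auto simp: mult_ac)

lemma sum_pairs: "(\<Sum>i<2*m. f i) = (\<Sum>k<m. f (2*k) + f (2*k+1))" for f :: "nat \<Rightarrow> 'b::comm_monoid_add"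
  by (induction m) (auto simp: add_ac)

text \<open>
  An index outside the first \<open>n\<close> weighs at least \<open>w n\<close>, which is more than any of the first
  \<open>n\<close> that it can replace.
\<close>

lemma weight_sum_min:
  fixes w :: "nat \<Rightarrow> nat"
  assumes w: "mono w" "\<And>i. i < n \<Longrightarrow> w i < w n" and e: "inj_on e {..<n}"
  shows "(\<Sum>i<n. w i) \<le> (\<Sum>i<n. w (e i))"
    and "(\<Sum>i<n. w i) = (\<Sum>i<n. w (e i)) \<Longrightarrow> e ` {..<n} = {..<n}"
proof -
  let ?S = "e ` {..<n}"
  have cS: "card ?S = n" "finite ?S" using e by (auto simp: card_image)
  have c: "card (?S - {..<n}) = card ({..<n} - ?S)"
  proof -
    have "card ?S = card (?S \<inter> {..<n}) + card (?S - {..<n})" using cS(2) by (rule card_Int_Diff)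
    moreover have "card {..<n} = card ({..<n} \<inter> ?S) + card ({..<n} - ?S)" by (rule card_Int_Diff) simp
    ultimately show ?thesis using cS(1) by (simp add: Int_commute)
  qed
  have eq: "(\<Sum>i<n. w (e i)) = sum w ?S" using e by (simp add: sum.reindex)
  have S: "sum w ?S = sum w (?S \<inter> {..<n}) + sum w (?S - {..<n})" using cS(2) by (rule sum.Int_Diff)
  have N: "(\<Sum>i<n. w i) = sum w (?S \<inter> {..<n}) + sum w ({..<n} - ?S)"
    using sum.Int_Diff[of "{..<n}" w ?S] by (simp add: Int_commute)
  have hi: "card (?S - {..<n}) * w n \<le> sum w (?S - {..<n})"
    using sum_bounded_below[of "?S - {..<n}" "w n" w] monoD[OF w(1)] by (auto simp: not_less)
  have lo: "sum w ({..<n} - ?S) \<le> card ({..<n} - ?S) * w n"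
    using sum_bounded_above[of "{..<n} - ?S" w "w n"] w(2) by (auto intro: less_imp_le)
  show "(\<Sum>i<n. w i) \<le> (\<Sum>i<n. w (e i))" using hi lo c unfolding eq S N by simp
  assume same: "(\<Sum>i<n. w i) = (\<Sum>i<n. w (e i))"
  have "{..<n} - ?S = {}"
  proof (rule ccontr)
    assume ne: "{..<n} - ?S \<noteq> {}"
    have "sum w ({..<n} - ?S) < (\<Sum>i\<in>{..<n} - ?S. w n)"
      by (rule sum_strict_mono) (use ne w(2) in auto)
    hence "sum w ({..<n} - ?S) < card ({..<n} - ?S) * w n" by simp
    thus False using same hi c unfolding eq S N by simp
  qed
  hence "{..<n} \<subseteq> ?S" by blast
  thus "?S = {..<n}" using card_subset_eq[OF cS(2), of "{..<n}"] cS(1) by auto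
qed

text \<open>
  A choice of an index pair for each block, read as a choice of one index for each position.
\<close>

definition unpair :: "(nat \<Rightarrow> nat \<times> nat) \<Rightarrow> nat \<Rightarrow> nat" where
  "unpair g i = (if even i then fst (g (i div 2)) else snd (g (i div 2)))"

lemma unpair_simps: "unpair g (2*k) = fst (g k)" "unpair g (2*k+1) = snd (g k)" "unpair g (Suc (2*k)) = snd (g k)"
  by (simp_all add: unpair_def)

lemma sum_over_unpair:
  fixes f :: "(nat \<Rightarrow> nat) \<Rightarrow> 'b::comm_monoid_add"
  assumes N: "2*m \<le> N" and cong: "\<And>e e'. (\<And>i. i < 2*m \<Longrightarrow> e i = e' i) \<Longrightarrow> f e = f e'"
  shows "(\<Sum>g\<in>{g \<in> PiE {..<m} (\<lambda>_. {..<N} \<times> {..<N}). bij_betw (unpair g) {..<2*m} {..<2*m}}. f (unpair g))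
     = (\<Sum>p | p permutes {..<2*m}. f p)"
proof (rule sum.reindex_bij_witness
    [of _ "\<lambda>p. \<lambda>k\<in>{..<m}. (p (2*k), p (2*k+1))" "\<lambda>g i. if i < 2*m then unpair g i else i"])
  fix g assume g: "g \<in> {g \<in> PiE {..<m} (\<lambda>_. {..<N} \<times> {..<N}). bij_betw (unpair g) {..<2*m} {..<2*m}}"
  show "(\<lambda>k\<in>{..<m}. (if 2*k < 2*m then unpair g (2*k) else 2*k,
      if 2*k+1 < 2*m then unpair g (2*k+1) else 2*k+1)) = g"
    using g by (auto simp: fun_eq_iff unpair_simps PiE_def extensional_def)
  have "bij_betw (\<lambda>i. if i < 2*m then unpair g i else i) {..<2*m} {..<2*m}"
    using g by (subst bij_betw_cong[of _ _ "unpair g"]) auto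
  thus "(\<lambda>i. if i < 2*m then unpair g i else i) \<in> {p. p permutes {..<2*m}}"
    by (intro CollectI bij_imp_permutes) auto
  show "f (\<lambda>i. if i < 2*m then unpair g i else i) = f (unpair g)" by (rule cong) simp
next
  fix p assume "p \<in> {p. p permutes {..<2*m}}"
  hence p: "p permutes {..<2*m}" by simp
  let ?g = "\<lambda>k\<in>{..<m}. (p (2*k), p (2*k+1))"
  have pl: "p i < 2*m" if "i < 2*m" for i using permutes_in_image[OF p] that by auto
  have u: "unpair ?g i = p i" if "i < 2*m" for i
  proof (cases "even i")
    case True
    then obtain k where "i = 2*k" by (elim evenE)
    thus ?thesis using that by (simp add: unpair_simps)
  next
    case False
    then obtain k where "i = 2*k+1" by (elim oddE)
    thus ?thesis using that by (simp add: unpair_simps)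
  qed
  show "(\<lambda>i. if i < 2*m then unpair ?g i else i) = p"
    using u permutes_not_in[OF p] by (auto simp: fun_eq_iff)
  have "bij_betw (unpair ?g) {..<2*m} {..<2*m}"
    using permutes_imp_bij[OF p] u by (subst bij_betw_cong[of _ _ p]) auto
  moreover have "?g \<in> PiE {..<m} (\<lambda>_. {..<N} \<times> {..<N})"
  proof (rule restrict_PiE_iff[THEN iffD2], rule ballI)
    fix k assume "k \<in> {..<m}"
    thus "(p (2*k), p (2*k+1)) \<in> {..<N} \<times> {..<N}" using pl[of "2*k"] pl[of "2*k+1"] N by auto
  qed
  ultimately show "?g \<in> {g \<in> PiE {..<m} (\<lambda>_. {..<N} \<times> {..<N}). bij_betw (unpair g) {..<2*m} {..<2*m}}"
    by simp
qed

lemma fps_const_prod: "fps_const (prod f A) = (\<Prod>x\<in>A. fps_const (f x :: 'a::comm_ring_1))"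
  by (induction A rule: infinite_finite_induct) (simp_all flip: fps_const_mult)

lemma fps_const_sum: "fps_const (sum f A) = (\<Sum>x\<in>A. fps_const (f x :: 'a::comm_ring_1))"
  by (induction A rule: infinite_finite_induct) (simp_all flip: fps_const_add)

lemma fps_monom_nth: "fps_nth (fps_const a * fps_X ^ n) d = (if n = d then a else 0 :: 'a::comm_ring_1)"
  by (simp add: fps_X_power_nth)

lemma signed_sum:
  "(\<Sum>p\<in>P. of_int (s p) * (fps_const (a p * b) * x)) =
    fps_const ((\<Sum>p\<in>P. of_int (s p) * a p) * b) * (x :: 'a::comm_ring_1 fps)"
proof -
  have "of_int (s p) * (fps_const (a p * b) * x) = fps_const (of_int (s p) * a p) * (fps_const b * x)" for p
    by (simp only: fps_of_int[symmetric] fps_const_mult[symmetric] mult.assoc)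
  hence "(\<Sum>p\<in>P. of_int (s p) * (fps_const (a p * b) * x)) =
      (\<Sum>p\<in>P. fps_const (of_int (s p) * a p)) * (fps_const b * x)"
    by (simp only: sum_distrib_right)
  also have "\<dots> = fps_const (\<Sum>p\<in>P. of_int (s p) * a p) * (fps_const b * x)"
    by (simp only: fps_const_sum)
  also have "\<dots> = fps_const ((\<Sum>p\<in>P. of_int (s p) * a p) * b) * x"
    by (simp only: fps_const_mult[symmetric] mult.assoc)
  finally show ?thesis .
qed

text \<open>
  This is \<open>B = C F C\<^sup>T\<close> for a rectangular \<open>C\<close> whose column \<open>k\<close> carries the factor
  \<open>X ^ w k\<close>. Expanding all products and summing over permutations first gives a determinant of
  chosen columns of \<open>C\<close> for each term. It vanishes if a column is repeated; so the least
  exponent of \<open>X\<close> belongs to the first \<open>2 * m\<close> columns, and their orderings make up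
  \<open>pfsum m F\<close>. The entries have this form only up to that exponent; so they may be power
  series, truncated to finitely many columns.
\<close>

theorem pfsum_lowest_coeff:
  fixes B :: "nat \<Rightarrow> nat \<Rightarrow> 'a::comm_ring_1 fps" and w :: "nat \<Rightarrow> nat"
  assumes w: "mono w" "\<And>i. i < 2*m \<Longrightarrow> w i < w (2*m)" and N: "2*m \<le> N"
  defines "W \<equiv> \<Sum>i<2*m. w i"
  assumes B: "\<And>i j d. i < 2*m \<Longrightarrow> j < 2*m \<Longrightarrow> d \<le> W \<Longrightarrow>
     fps_nth (B i j) d = (\<Sum>(k, l)\<in>{..<N} \<times> {..<N}. if w k + w l = d then C i k * C j l * F k l else 0)"
    and d: "d \<le> W"
  shows "fps_nth (pfsum m B) d = (if d = W then alt_sum (2*m) C id * pfsum m F else 0)"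
proof -
  let ?K = "{..<N} \<times> {..<N}"
  let ?P = "{p. p permutes {..<2*m}}" and ?G = "PiE {..<m} (\<lambda>_. ?K)"
  let ?T = "\<lambda>e. alt_sum (2*m) C e * (\<Prod>k<m. F (e (2*k)) (e (2*k+1)))"
  have finG: "finite ?G" by (intro finite_PiE) auto
  define t where "t p k x = fps_const (C (p (2*k)) (fst x) * C (p (2*k+1)) (snd x) * F (fst x) (snd x)) * fps_X ^ (w (fst x) + w (snd x))"
    for p :: "nat \<Rightarrow> nat" and k and x :: "nat \<times> nat"
  define B' where "B' i j = (\<Sum>x\<in>?K. fps_const (C i (fst x) * C j (snd x) * F (fst x) (snd x)) * fps_X ^ (w (fst x) + w (snd x)))" for i j
  have "fps_agree W (pfsum m B) (pfsum m B')"
  proof (rule pfsum_agree)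
    fix i j assume "i < 2*m" "j < 2*m"
    thus "fps_agree W (B i j) (B' i j)"
      unfolding fps_agree_def B'_def by (simp only: fps_sum_nth fps_monom_nth) (simp add: B case_prod_unfold)
  qed
  hence "fps_nth (pfsum m B) d = fps_nth (pfsum m B') d" using d by (simp add: fps_agree_def)
  also have "pfsum m B' = (\<Sum>p\<in>?P. of_int (sign p) * (\<Sum>g\<in>?G. \<Prod>k<m. t p k (g k)))"
  proof -
    have "(\<Prod>k<m. B' (p (2*k)) (p (2*k+1))) = (\<Sum>g\<in>?G. \<Prod>k<m. t p k (g k))" for p
      unfolding B'_def t_def by (rule prod_sum_PiE) auto
    thus ?thesis unfolding pfsum_def by simp
  qed
  also have "\<dots> = (\<Sum>g\<in>?G. \<Sum>p\<in>?P. of_int (sign p) * (\<Prod>k<m. t p k (g k)))"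
    unfolding sum_distrib_left by (rule sum.swap)
  also have "\<dots> = (\<Sum>g\<in>?G. fps_const (?T (unpair g))
       * fps_X ^ (\<Sum>i<2*m. w (unpair g i)))"
  proof (intro sum.cong refl)
    fix g
    have "(\<Prod>k<m. t p k (g k)) = fps_const ((\<Prod>i<2*m. C (p i) (unpair g i)) * (\<Prod>k<m. F (unpair g (2*k)) (unpair g (2*k+1))))
       * fps_X ^ (\<Sum>i<2*m. w (unpair g i))" for p
    proof -
      have gen: "(\<Prod>k<m. fps_const (a k) * fps_X ^ b k) = fps_const (\<Prod>k<m. a k) * fps_X ^ (\<Sum>k<m. b k)"
        for a :: "nat \<Rightarrow> 'a" and b
        by (simp add: prod.distrib fps_const_prod power_sum)
      have "(\<Prod>k<m. t p k (g k)) = fps_const (\<Prod>k<m. C (p (2*k)) (fst (g k)) * C (p (2*k+1)) (snd (g k)) * F (fst (g k)) (snd (g k)))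
         * fps_X ^ (\<Sum>k<m. w (fst (g k)) + w (snd (g k)))"
        unfolding t_def gen ..
      thus ?thesis by (simp only: prod_pairs sum_pairs unpair_simps prod.distrib)
    qed
    thus "(\<Sum>p\<in>?P. of_int (sign p) * (\<Prod>k<m. t p k (g k))) =
       fps_const (?T (unpair g))
       * fps_X ^ (\<Sum>i<2*m. w (unpair g i))"
      unfolding alt_sum_def by (simp only: signed_sum)
  qed
  also have "fps_nth \<dots> d = (\<Sum>g\<in>?G. if (\<Sum>i<2*m. w (unpair g i)) = d
       then ?T (unpair g) else 0)"
    unfolding fps_sum_nth by (intro sum.cong refl) (rule fps_monom_nth)
  also have "\<dots> = (\<Sum>g\<in>{g\<in>?G. bij_betw (unpair g) {..<2*m} {..<2*m}}. if W = d
       then ?T (unpair g) else 0)"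
  proof (rule sum.mono_neutral_cong_right[OF finG])
    show "{g\<in>?G. bij_betw (unpair g) {..<2*m} {..<2*m}} \<subseteq> ?G" by blast
    show "\<forall>g\<in>?G - {g\<in>?G. bij_betw (unpair g) {..<2*m} {..<2*m}}. (if (\<Sum>i<2*m. w (unpair g i)) = d
       then ?T (unpair g) else 0) = 0"
    proof
      fix g assume "g \<in> ?G - {g\<in>?G. bij_betw (unpair g) {..<2*m} {..<2*m}}"
      hence nb: "\<not> bij_betw (unpair g) {..<2*m} {..<2*m}" by blast
      have "alt_sum (2*m) C (unpair g) = 0" if "(\<Sum>i<2*m. w (unpair g i)) = d"
      proof (rule alt_sum_not_inj, rule notI)
        assume i: "inj_on (unpair g) {..<2*m}"
        have "unpair g ` {..<2*m} = {..<2*m}"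
          using weight_sum_min[OF w i] that d unfolding W_def by linarith
        thus False using nb i by (simp add: bij_betw_def)
      qed
      thus "(if (\<Sum>i<2*m. w (unpair g i)) = d
       then ?T (unpair g) else 0) = 0" by simp
    qed
  next
    fix g assume "g \<in> {g\<in>?G. bij_betw (unpair g) {..<2*m} {..<2*m}}"
    hence "(\<Sum>i<2*m. w (unpair g i)) = W"
      unfolding W_def by (intro sum.reindex_bij_betw) auto
    thus "(if (\<Sum>i<2*m. w (unpair g i)) = d
       then ?T (unpair g) else 0) =
       (if W = d then ?T (unpair g) else 0)" by simp
  qed
  also have "\<dots> = (\<Sum>p\<in>?P. if W = d
       then ?T p else 0)"
  proof (rule sum_over_unpair[OF N])
    fix e e' :: "nat \<Rightarrow> nat" assume ee: "\<And>i. i < 2*m \<Longrightarrow> e i = e' i"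
    have "alt_sum (2*m) C e = alt_sum (2*m) C e'" unfolding alt_sum_def by (simp add: ee)
    moreover have "(\<Prod>k<m. F (e (2*k)) (e (2*k+1))) = (\<Prod>k<m. F (e' (2*k)) (e' (2*k+1)))"
      by (intro prod.cong refl) (simp add: ee)
    ultimately show "(if W = d then ?T e else 0) =
      (if W = d then ?T e' else 0)" by simp
  qed
  also have "\<dots> = (\<Sum>p\<in>?P. if W = d
       then alt_sum (2*m) C id * (of_int (sign p) * (\<Prod>k<m. F (p (2*k)) (p (2*k+1)))) else 0)"
    by (intro sum.cong refl if_cong, drule CollectD) (simp only: alt_sum_perm mult_ac)
  also have "\<dots> = (if d = W then alt_sum (2*m) C id * pfsum m F else 0)"
  proof (cases "W = d")
    case True
    thus ?thesis unfolding pfsum_def sum_distrib_left by simp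
  qed auto
  finally show ?thesis .
qed

lemma alt_sum_triangular:
  fixes C T :: "nat \<Rightarrow> nat \<Rightarrow> 'a::idom"
  assumes T: "\<And>k j. k < n \<Longrightarrow> j < k \<Longrightarrow> T k j = 0" "\<And>j. j < n \<Longrightarrow> T j j = 1"
    and L: "\<And>i j. i < j \<Longrightarrow> j < n \<Longrightarrow> (\<Sum>k<n. C i k * T k j) = 0"
  shows "alt_sum n C id = (\<Prod>i<n. \<Sum>k<n. C i k * T k i)"
proof -
  let ?C = "mat n n (\<lambda>(i, j). C i j)" and ?T = "mat n n (\<lambda>(i, j). T i j)"
  have "alt_sum n C id = det (transpose_mat ?C)"
    unfolding alt_sum_det by (intro arg_cong[of _ _ det]) auto
  also have "\<dots> = det ?C" by (rule det_transpose[of _ n]) auto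
  also have "\<dots> = det ?C * det ?T"
  proof -
    have "det ?T = prod_list (diag_mat ?T)"
      by (rule det_upper_triangular[of _ n]) (auto simp: upper_triangular_def T)
    also have "diag_mat ?T = map (\<lambda>_. 1) [0..<n]"
      by (auto simp: diag_mat_def T)
    finally show ?thesis by (simp add: prod_list_replicate map_replicate_const)
  qed
  also have "\<dots> = det (?C * ?T)" by (rule det_mult[symmetric, of _ n]) auto
  also have "?C * ?T = mat n n (\<lambda>(i, j). \<Sum>k<n. C i k * T k j)" (is "_ = ?M")
    by (auto simp: scalar_prod_def atLeast0LessThan intro!: eq_matI sum.cong)
  also have "det ?M = prod_list (diag_mat ?M)"
    by (rule det_lower_triangular[of n]) (auto simp: L)
  also have "diag_mat ?M = map (\<lambda>i. \<Sum>k<n. C i k * T k i) [0..<n]"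
    by (auto simp: diag_mat_def)
  also have "prod_list \<dots> = (\<Prod>i<n. \<Sum>k<n. C i k * T k i)"
    by (simp add: prod.list_conv_set_nth atLeast0LessThan)
  finally show ?thesis .
qed

text \<open>
  In the Newton basis the Vandermonde matrix becomes triangular.
\<close>

definition newton_poly :: "(nat \<Rightarrow> 'a::idom) \<Rightarrow> nat \<Rightarrow> 'a poly" where
  "newton_poly c j = (\<Prod>l<j. [:- c l, 1:])"

lemma newton_poly: "degree (newton_poly c j) = j" "lead_coeff (newton_poly c j) = 1"
  "poly (newton_poly c j) x = (\<Prod>l<j. x - c l)"
proof -
  show "degree (newton_poly c j) = j" "poly (newton_poly c j) x = (\<Prod>l<j. x - c l)"
    unfolding newton_poly_def by (auto simp: degree_prod_eq_sum_degree poly_prod)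
  show "lead_coeff (newton_poly c j) = 1" unfolding newton_poly_def by (simp add: lead_coeff_prod)
qed

lemma newton_poly_sum:
  assumes "j < N"
  shows "(\<Sum>k<N. x ^ k * coeff (newton_poly c j) k) = (\<Prod>l<j. x - c l)"
proof -
  have "(\<Prod>l<j. x - c l) = (\<Sum>k\<le>j. coeff (newton_poly c j) k * x ^ k)"
    using poly_altdef[of "newton_poly c j" x] by (simp add: newton_poly)
  also have "\<dots> = (\<Sum>k<N. coeff (newton_poly c j) k * x ^ k)"
    by (rule sum.mono_neutral_left) (use assms newton_poly(1)[of c j] in \<open>auto intro!: coeff_eq_0\<close>)
  finally show ?thesis by (simp add: mult.commute)
qed

lemma newton_poly_coeff: "j < k \<Longrightarrow> coeff (newton_poly c j) k = 0" "coeff (newton_poly c j) j = 1"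
  using newton_poly(1,2)[of c j] by (auto intro: coeff_eq_0)

lemma vandermonde_snoc: "vandermonde (us @ [x]) = vandermonde us * (\<Prod>u\<leftarrow>us. x - u)"
  by (induction us) (auto simp: algebra_simps)

lemma vandermonde_prod: "vandermonde (map c [0..<n]) = (\<Prod>j<n. \<Prod>l<j. c j - c l)"
  by (induction n) (auto simp: vandermonde_snoc prod.list_conv_set_nth atLeast0LessThan)

lemma alt_sum_vandermonde: "alt_sum n (\<lambda>i k. c i ^ k) id = vandermonde (map c [0..<n])" for c :: "nat \<Rightarrow> 'a::idom"
proof -
  have "alt_sum n (\<lambda>i k. c i ^ k) id = (\<Prod>i<n. \<Sum>k<n. c i ^ k * coeff (newton_poly c i) k)"
    by (rule alt_sum_triangular) (auto simp: newton_poly_coeff newton_poly_sum)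
  thus ?thesis by (simp add: newton_poly_sum vandermonde_prod)
qed

text \<open>
  The Vandermonde matrix with a row and a column for the index 0 added; this is the shape of
  the problem for an odd number of lines.
\<close>

lemma alt_sum_vandermonde_border:
  fixes c :: "nat \<Rightarrow> 'a::idom"
  defines "C \<equiv> \<lambda>i k. if i = 0 \<or> k = 0 then (if i = k then 1 else 0) else c (i - 1) ^ (k - 1)"
  shows "alt_sum (Suc n) C id = vandermonde (map c [0..<n])"
proof -
  define T where "T k j = (if k = 0 \<or> j = 0 then (if k = j then 1 else 0) else coeff (newton_poly c (j - 1)) (k - 1))" for k j
  have L0: "(\<Sum>k<Suc n. C 0 k * T k j) = (if j = 0 then 1 else 0)" for j
    unfolding sum.lessThan_Suc_shift by (simp add: C_def T_def)
  have L: "(\<Sum>k<Suc n. C (Suc i) k * T k (Suc j)) = (\<Prod>l<j. c i - c l)" if "j < n" for i j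
    unfolding sum.lessThan_Suc_shift using newton_poly_sum[OF that] by (simp add: C_def T_def)
  have "alt_sum (Suc n) C id = (\<Prod>i<Suc n. \<Sum>k<Suc n. C i k * T k i)"
  proof (rule alt_sum_triangular)
    fix i j assume ij: "i < j" "j < Suc n"
    then obtain j' where j': "j = Suc j'" by (cases j) auto
    show "(\<Sum>k<Suc n. C i k * T k j) = 0"
    proof (cases i)
      case 0
      thus ?thesis using L0[of j] ij by simp
    next
      case (Suc i')
      show ?thesis unfolding j' Suc using L[of j' i'] ij j' Suc by (auto simp del: sum.lessThan_Suc)
    qed
  qed (auto simp: T_def newton_poly_coeff)
  also have "\<dots> = (\<Prod>i<n. \<Prod>l<i. c i - c l)"
    unfolding prod.lessThan_Suc_shift[of _ n] L0 by (simp del: sum.lessThan_Suc add: L)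
  finally show ?thesis by (simp add: vandermonde_prod)
qed

section \<open>The coefficients of the generating series\<close>

lemma coeff_uv_simps:
  "coeff_uv (F + G) i j = coeff_uv F i j + coeff_uv G i j"
  "coeff_uv (F - G) i j = coeff_uv F i j - coeff_uv G i j"
  "coeff_uv (const_uv c * F) i j = c * coeff_uv F i j"
  "coeff_uv (fps_u * F) i j = (if i = 0 then 0 else coeff_uv F (i - 1) j)"
  "coeff_uv (fps_v * F) i j = (if j = 0 then 0 else coeff_uv F i (j - 1))"
  "coeff_uv 1 i j = (if i = 0 \<and> j = 0 then 1 else 0)"
  "coeff_uv 0 i j = 0"
  by (auto simp: coeff_uv_def const_uv_def fps_u_def fps_v_def)

lemma fps_fps_eqI: "(\<And>i j. coeff_uv F i j = coeff_uv G i j) \<Longrightarrow> F = G"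
  by (auto simp: coeff_uv_def fps_eq_iff)

definition binom_power :: "'a::comm_ring_1 \<Rightarrow> nat \<Rightarrow> nat \<Rightarrow> 'a" where
  "binom_power r l a = of_nat (a choose l) * r ^ (a - l)"

text \<open>
  The coefficients of \<open>1 / ((1 - r * u) * (1 - r * v) - u * v)\<close>, the summand \<open>l\<close> being the
  contribution of \<open>(u * v) ^ l / ((1 - r * u) * (1 - r * v)) ^ (l + 1)\<close>.
\<close>

definition inv_den_coeff :: "'a::comm_ring_1 \<Rightarrow> nat \<Rightarrow> nat \<Rightarrow> 'a" where
  "inv_den_coeff r a b = (\<Sum>l\<le>a. binom_power r l a * binom_power r l b)"

lemma binom_power_0: "binom_power r l a = 0" if "a < l" using that by (simp add: binom_power_def binomial_eq_0)

lemma binom_power_Suc: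
  "binom_power r 0 (Suc a) = r * binom_power r 0 a"
  "binom_power r (Suc l) (Suc a) = r * binom_power r (Suc l) a + binom_power r l a"
proof -
  show "binom_power r 0 (Suc a) = r * binom_power r 0 a" by (simp add: binom_power_def)
  have "of_nat (a choose Suc l) * r ^ (a - l) = r * binom_power r (Suc l) a"
  proof (cases "Suc l \<le> a")
    case True
    hence "a - l = Suc (a - Suc l)" by simp
    thus ?thesis by (simp add: binom_power_def mult_ac)
  qed (simp add: binom_power_def binomial_eq_0)
  thus "binom_power r (Suc l) (Suc a) = r * binom_power r (Suc l) a + binom_power r l a"
    by (simp add: binom_power_def algebra_simps)
qed

lemma inv_den_coeff_extend: "a < N \<Longrightarrow> inv_den_coeff r a b = (\<Sum>l<N. binom_power r l a * binom_power r l b)"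
  unfolding inv_den_coeff_def by (rule sum.mono_neutral_left) (auto simp: binom_power_0)

lemma inv_den_coeff_sym: "inv_den_coeff r a b = inv_den_coeff r b a"
proof -
  have "inv_den_coeff r a b = (\<Sum>l<Suc (max a b). binom_power r l a * binom_power r l b)" by (rule inv_den_coeff_extend) simp
  also have "\<dots> = inv_den_coeff r b a" by (subst inv_den_coeff_extend[of b "Suc (max a b)"]) (auto simp: mult.commute)
  finally show ?thesis .
qed

lemma inv_den_coeff_0: "inv_den_coeff r a 0 = r ^ a"
proof -
  have "inv_den_coeff r a 0 = (\<Sum>l\<in>{0}. binom_power r l a * binom_power r l 0)"
    unfolding inv_den_coeff_def by (rule sum.mono_neutral_right) (auto simp: binom_power_0)
  thus ?thesis by (simp add: binom_power_def)
qed

text \<open>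
  Pascal's rule in both arguments: multiplying by \<open>1 - r * u\<close> and by \<open>1 - r * v\<close> shifts the
  summation index by one.
\<close>

lemma inv_den_coeff_rec:
  fixes r :: "'a::comm_ring_1"
  shows "inv_den_coeff r (Suc a) (Suc b) = r * inv_den_coeff r (Suc a) b + r * inv_den_coeff r a (Suc b) - (r\<^sup>2 - 1) * inv_den_coeff r a b"
proof -
  define x where "x l c = binom_power r l c" for l c
  have T: "inv_den_coeff r c d = x 0 c * x 0 d + (\<Sum>l<Suc (Suc a). x (Suc l) c * x (Suc l) d)" if "c \<le> Suc a" for c d
    using that unfolding x_def by (subst inv_den_coeff_extend[of c "Suc (Suc (Suc a))"]) (simp_all add: sum.lessThan_Suc_shift del: sum.lessThan_Suc)
  have T': "inv_den_coeff r a b = (\<Sum>l<Suc (Suc a). x l a * x l b)" unfolding x_def by (rule inv_den_coeff_extend) simp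
  have s: "x 0 (Suc c) = r * x 0 c" "x (Suc l) (Suc c) = r * x (Suc l) c + x l c" for l c
    by (simp_all add: x_def binom_power_Suc)
  let ?S = "\<lambda>f. \<Sum>l<Suc (Suc a). f l :: 'a"
  define p where "p = x 0 a * x 0 b"
  define P where "P = ?S (\<lambda>l. x (Suc l) a * x (Suc l) b)"
  define Q where "Q = ?S (\<lambda>l. x (Suc l) a * x l b)"
  define R where "R = ?S (\<lambda>l. x l a * x (Suc l) b)"
  define U where "U = ?S (\<lambda>l. x l a * x l b)"
  have "inv_den_coeff r (Suc a) (Suc b) = r * (r * p) + ?S (\<lambda>l. r * (r * (x (Suc l) a * x (Suc l) b))
      + r * (x (Suc l) a * x l b) + r * (x l a * x (Suc l) b) + x l a * x l b)"
    unfolding T[of "Suc a", OF order_refl] s p_def by (simp del: sum.lessThan_Suc add: algebra_simps)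
  hence 1: "inv_den_coeff r (Suc a) (Suc b) = r * (r * p) + (r * (r * P) + r * Q + r * R + U)"
    unfolding P_def Q_def R_def U_def by (simp only: sum.distrib sum_distrib_left)
  have "inv_den_coeff r (Suc a) b = r * p + ?S (\<lambda>l. r * (x (Suc l) a * x (Suc l) b) + x l a * x (Suc l) b)"
    unfolding T[of "Suc a", OF order_refl] s p_def by (simp del: sum.lessThan_Suc add: algebra_simps)
  hence 2: "inv_den_coeff r (Suc a) b = r * p + (r * P + R)"
    unfolding P_def R_def by (simp only: sum.distrib sum_distrib_left)
  have "inv_den_coeff r a (Suc b) = r * p + ?S (\<lambda>l. r * (x (Suc l) a * x (Suc l) b) + x (Suc l) a * x l b)"
    unfolding T[of a, OF le_SucI[OF order_refl]] s p_def by (simp del: sum.lessThan_Suc add: algebra_simps)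
  hence 3: "inv_den_coeff r a (Suc b) = r * p + (r * P + Q)"
    unfolding P_def Q_def by (simp only: sum.distrib sum_distrib_left)
  have 4: "inv_den_coeff r a b = p + P"
    unfolding T[of a, OF le_SucI[OF order_refl]] p_def P_def ..
  have 5: "inv_den_coeff r a b = U" unfolding U_def by (rule T')
  have "inv_den_coeff r (Suc a) (Suc b) = r * inv_den_coeff r (Suc a) b + r * inv_den_coeff r a (Suc b) - r * (r * (p + P)) + U"
    unfolding 1 2 3 by (simp add: algebra_simps)
  thus ?thesis unfolding 4[symmetric] 5[symmetric] by (simp add: power2_eq_square algebra_simps)
qed

definition inv_den_series :: "'a::comm_ring_1 \<Rightarrow> 'a fps fps" where
  "inv_den_series r = Abs_fps (\<lambda>i. Abs_fps (\<lambda>j. inv_den_coeff r i j))"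

lemma coeff_inv_den_series: "coeff_uv (inv_den_series r) i j = inv_den_coeff r i j"
  by (simp add: inv_den_series_def coeff_uv_def)

definition uv_den :: "'a::comm_ring_1 \<Rightarrow> 'a fps fps" where
  "uv_den r = (1 - const_uv r * fps_u) * (1 - const_uv r * fps_v) - fps_u * fps_v"

lemma const_uv_simps: "const_uv 1 = 1" "const_uv (a * b) = const_uv a * const_uv b"
   "const_uv (a + b) = const_uv a + const_uv b" "const_uv (a - b) = const_uv a - const_uv b" "const_uv (a ^ n) = const_uv a ^ n"
  by (auto simp: const_uv_def simp flip: fps_const_mult fps_const_power)

lemma uv_den_inv_den_series: "uv_den r * inv_den_series r = 1"
proof -
  have e: "uv_den r * inv_den_series r = inv_den_series r - const_uv r * (fps_u * inv_den_series r) - const_uv r * (fps_v * inv_den_series r)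
       + const_uv (r\<^sup>2 - 1) * (fps_u * (fps_v * inv_den_series r))"
    by (simp add: uv_den_def const_uv_simps algebra_simps power2_eq_square)
  have "coeff_uv (uv_den r * inv_den_series r) i j = coeff_uv 1 i j" for i j
  proof (cases i; cases j)
    fix a b assume "i = Suc a" "j = Suc b"
    thus ?thesis unfolding e coeff_uv_simps coeff_inv_den_series by (simp add: inv_den_coeff_rec)
  qed (auto simp: e coeff_uv_simps coeff_inv_den_series inv_den_coeff_0 inv_den_coeff_sym[of _ 0] simp del: One_nat_def)
  thus ?thesis by (rule fps_fps_eqI)
qed

definition dsasm_num :: "'a::comm_ring_1 \<Rightarrow> 'a \<Rightarrow> 'a fps fps" where
  "dsasm_num r s = (fps_v - fps_u) * (const_uv (s\<^sup>2) + const_uv r * (1 + fps_u) * (1 + fps_v) * inv_den_series r)"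

lemma dsasm_series_mult_uv: "dsasm_series r s * (1 - fps_u * fps_v) = dsasm_num r s" for r s :: "'a::field"
proof -
  define Y :: "'a fps fps" where "Y = const_uv r * (1 + fps_u) * (1 + fps_v)"
  have "Y / uv_den r = Y / uv_den r * (uv_den r * inv_den_series r)" by (simp add: uv_den_inv_den_series)
  also have "\<dots> = Y * inv_den_series r"
    using dsasm_series_denominators(2)[of Y r] by (simp add: uv_den_def mult.assoc[symmetric])
  finally have Y: "Y / uv_den r = Y * inv_den_series r" .
  have "dsasm_series r s * (1 - fps_u * fps_v) =
    ((fps_v - fps_u) / (1 - fps_u * fps_v) * (1 - fps_u * fps_v)) * ((const_uv s)\<^sup>2 + Y / uv_den r)"
    by (simp add: dsasm_series_def Let_def Y_def uv_den_def mult_ac)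
  also have "\<dots> = dsasm_num r s"
    unfolding dsasm_series_denominators(1) Y by (simp add: dsasm_num_def Y_def const_uv_simps)
  finally show ?thesis .
qed

lemma dsasm_series_mult:
  fixes r s :: "'a::field"
  shows "dsasm_series r s * ((1 - fps_u * fps_v) * uv_den r) =
     (fps_v - fps_u) * (const_uv (s\<^sup>2) * uv_den r + const_uv r * (1 + fps_u) * (1 + fps_v))"
proof -
  have "dsasm_series r s * ((1 - fps_u * fps_v) * uv_den r) = dsasm_num r s * uv_den r"
    by (simp only: mult.assoc[symmetric] dsasm_series_mult_uv)
  also have "\<dots> = (fps_v - fps_u) * (const_uv (s\<^sup>2) * uv_den r + const_uv r * (1 + fps_u) * (1 + fps_v) * (uv_den r * inv_den_series r))"
    by (simp add: dsasm_num_def algebra_simps)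
  finally show ?thesis by (simp add: uv_den_inv_den_series)
qed

text \<open>
  Dividing by \<open>1 - u * v\<close> sums along a diagonal.
\<close>

lemma coeff_dsasm_series_diag:
  fixes r s :: "'a::field"
  shows "coeff_uv (dsasm_series r s) i j = (\<Sum>k\<le>min i j. coeff_uv (dsasm_num r s) (i - k) (j - k))"
proof -
  have rec: "coeff_uv (dsasm_series r s) i j =
     coeff_uv (dsasm_num r s) i j + (if i = 0 \<or> j = 0 then 0 else coeff_uv (dsasm_series r s) (i - 1) (j - 1))" for i j
    unfolding dsasm_series_mult_uv[symmetric]
    by (simp add: right_diff_distrib mult.left_commute[of "dsasm_series r s"] mult.commute[of "dsasm_series r s"]
        mult.assoc coeff_uv_simps)
  show ?thesis
  proof (induction "min i j" arbitrary: i j)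
    case 0
    thus ?case using rec[of i j] by (auto simp: min_def split: if_splits)
  next
    case (Suc n)
    hence ij: "i \<noteq> 0" "j \<noteq> 0" "min (i - 1) (j - 1) = n" by auto
    have "coeff_uv (dsasm_series r s) i j = coeff_uv (dsasm_num r s) i j + coeff_uv (dsasm_series r s) (i - 1) (j - 1)"
      using rec[of i j] ij by simp
    also have "\<dots> = coeff_uv (dsasm_num r s) i j + (\<Sum>k\<le>n. coeff_uv (dsasm_num r s) (i - 1 - k) (j - 1 - k))"
      using Suc.hyps(1)[of "i - 1" "j - 1"] ij by simp
    also have "\<dots> = (\<Sum>k\<le>Suc n. coeff_uv (dsasm_num r s) (i - k) (j - k))"
      by (subst sum.atMost_Suc_shift) simp
    finally show ?case using Suc.hyps(2) by simp
  qed
qed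

text \<open>
  With the value 0 at negative arguments, shifts of the series need no case distinction.
\<close>

definition inv_den_coeff_int :: "'a::comm_ring_1 \<Rightarrow> int \<Rightarrow> int \<Rightarrow> 'a" where
  "inv_den_coeff_int r a b = (if a < 0 \<or> b < 0 then 0 else inv_den_coeff r (nat a) (nat b))"

lemma coeff_dsasm_num:
  "coeff_uv (dsasm_num r s) a b = s\<^sup>2 * ((if a = 0 \<and> b = 1 then 1 else 0) - (if a = 1 \<and> b = 0 then 1 else 0)) +
    r * (inv_den_coeff_int r (int a) (int b - 1) - inv_den_coeff_int r (int a - 1) (int b)
       + inv_den_coeff_int r (int a) (int b - 2) - inv_den_coeff_int r (int a - 2) (int b)
       + inv_den_coeff_int r (int a - 1) (int b - 2) - inv_den_coeff_int r (int a - 2) (int b - 1))"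
proof -
  let ?T = "inv_den_series r"
  have e: "dsasm_num r s = const_uv (s\<^sup>2) * (fps_v * 1 - fps_u * 1) + const_uv r *
     (fps_v * ?T - fps_u * ?T + fps_v * (fps_v * ?T) - fps_u * (fps_u * ?T)
       + fps_u * (fps_v * (fps_v * ?T)) - fps_u * (fps_u * (fps_v * ?T)))"
    by (simp add: dsasm_num_def algebra_simps)
  have n: "nat (int a - 1) = a - 1" "nat (int a - 2) = a - 1 - 1" "nat (int b - 1) = b - 1" "nat (int b - 2) = b - 1 - 1"
    by auto
  show ?thesis unfolding e coeff_uv_simps coeff_inv_den_series
    by (auto simp: inv_den_coeff_int_def n)
qed

lemma dsasm_series_skew: "coeff_uv (dsasm_series r s) j i = - coeff_uv (dsasm_series r s) i j" for r s :: "'a::field"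
proof -
  have t: "inv_den_coeff_int r a b = inv_den_coeff_int r b a" for a b using inv_den_coeff_sym[of r "nat a" "nat b"] by (auto simp: inv_den_coeff_int_def)
  have gen: "z * (p - q) + w * (x1 - x2 + x3 - x4 + x5 - x6) = - (z * (q - p) + w * (x2 - x1 + x4 - x3 + x6 - x5))"
    for z p q w x1 x2 x3 x4 x5 x6 :: 'a
    by (simp add: algebra_simps)
  have n: "coeff_uv (dsasm_num r s) b a = - coeff_uv (dsasm_num r s) a b" for a b
  proof -
    have c: "(a = 0 \<and> b = 1) = (b = 1 \<and> a = 0)" "(a = 1 \<and> b = 0) = (b = 0 \<and> a = 1)" by auto
    show ?thesis
      unfolding coeff_dsasm_num c t[of "int a" "int b - 1"] t[of "int a - 1" "int b"] t[of "int a" "int b - 2"]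
        t[of "int a - 2" "int b"] t[of "int a - 1" "int b - 2"] t[of "int a - 2" "int b - 1"]
      by (rule gen)
  qed
  have "(\<Sum>k\<le>min j i. coeff_uv (dsasm_num r s) (j - k) (i - k)) =
     (\<Sum>k\<le>min i j. - coeff_uv (dsasm_num r s) (i - k) (j - k))"
    unfolding min.commute[of j i] by (intro sum.cong refl n)
  thus ?thesis unfolding coeff_dsasm_series_diag sum_negf .
qed

lemma inv_den_coeff_int_binom:
  fixes r :: "'a::comm_ring_1"
  assumes "a \<le> int k"
  shows "r * inv_den_coeff_int r a b = (\<Sum>l\<le>k. of_nat (binom a (int l) * binom b (int l)) * r ^ nat (a + b + 1 - 2 * int l))"
proof (cases "a < 0 \<or> b < 0")
  case True
  thus ?thesis by (auto simp: inv_den_coeff_int_def binom_def intro!: sum.neutral)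
next
  case False
  then obtain a' b' where ab: "a = int a'" "b = int b'" by (metis nonneg_int_cases not_less)
  have "(\<Sum>l\<le>k. of_nat (binom a (int l) * binom b (int l)) * r ^ nat (a + b + 1 - 2 * int l))
     = (\<Sum>l\<le>k. r * (binom_power r l a' * binom_power r l b'))"
  proof (intro sum.cong refl)
    fix l
    show "of_nat (binom a (int l) * binom b (int l)) * r ^ nat (a + b + 1 - 2 * int l) = r * (binom_power r l a' * binom_power r l b')"
    proof (cases "l \<le> a' \<and> l \<le> b'")
      case True
      hence e: "nat (a + b + 1 - 2 * int l) = Suc ((a' - l) + (b' - l))" by (auto simp: ab)
      have "of_nat (binom a (int l) * binom b (int l)) = of_nat (a' choose l) * (of_nat (b' choose l) :: 'a)"
        using True by (simp add: binom_def ab)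
      thus ?thesis unfolding e binom_power_def power_Suc power_add by (simp only: mult_ac)
    qed (auto simp: binom_def ab binom_power_0 not_le)
  qed
  also have "\<dots> = r * inv_den_coeff r a' b'"
    using assms ab by (subst inv_den_coeff_extend[of a' "Suc k"]) (auto simp: sum_distrib_left lessThan_Suc_atMost)
  finally show ?thesis by (simp add: inv_den_coeff_int_def ab)
qed

definition explicit_coeff :: "'a::comm_ring_1 \<Rightarrow> 'a \<Rightarrow> nat \<Rightarrow> nat \<Rightarrow> 'a" where
  "explicit_coeff r s i j =
             s\<^sup>2 * (if i + 1 = j then 1 else 0) +
             (\<Sum>k\<le>i. \<Sum>l\<le>k. let d = int j - int i; K = int k; L = int l in
                 (of_nat (binom K L * binom (d + K - 1) L)
                    - of_nat (binom (K - 1) L * binom (d + K) L))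
                   * r ^ nat (d + 2 * K - 2 * L)
               + (of_nat (binom K L * binom (d + K - 2) L)
                    - of_nat (binom (K - 2) L * binom (d + K) L))
                   * r ^ nat (d + 2 * K - 2 * L - 1)
               + (of_nat (binom (K - 1) L * binom (d + K - 2) L)
                    - of_nat (binom (K - 2) L * binom (d + K - 1) L))
                   * r ^ nat (d + 2 * K - 2 * L - 2))"

lemma coeff_dsasm_series:
  fixes r s :: "'a::field"
  assumes "i < j"
  shows "coeff_uv (dsasm_series r s) i j = explicit_coeff r s i j"
proof -
  define d where "d = int j - int i"
  let ?t = "\<lambda>K L. (of_nat (binom K L * binom (d + K - 1) L) - of_nat (binom (K - 1) L * binom (d + K) L))
                   * r ^ nat (d + 2 * K - 2 * L)
               + (of_nat (binom K L * binom (d + K - 2) L) - of_nat (binom (K - 2) L * binom (d + K) L))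
                   * r ^ nat (d + 2 * K - 2 * L - 1)
               + (of_nat (binom (K - 1) L * binom (d + K - 2) L) - of_nat (binom (K - 2) L * binom (d + K - 1) L))
                   * r ^ nat (d + 2 * K - 2 * L - 2)"
  have "coeff_uv (dsasm_series r s) i j = (\<Sum>k\<le>i. coeff_uv (dsasm_num r s) (i - k) (j - k))"
    using assms by (simp add: coeff_dsasm_series_diag min_def)
  also have "\<dots> = (\<Sum>k\<le>i. coeff_uv (dsasm_num r s) k (j - i + k))"
    by (rule sum.reindex_bij_witness[of _ "\<lambda>k. i - k" "\<lambda>k. i - k"]) (use assms in auto)
  also have "\<dots> = (\<Sum>k\<le>i. s\<^sup>2 * (if k = 0 \<and> j - i = 1 then 1 else 0) + (\<Sum>l\<le>k. ?t (int k) (int l)))"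
  proof (intro sum.cong refl)
    fix k
    define K where "K = int k"
    have e: "int (j - i + k) = d + K" using assms by (simp add: d_def K_def)
    have t: "r * inv_den_coeff_int r a b = (\<Sum>l\<le>k. of_nat (binom a (int l) * binom b (int l)) * r ^ nat (a + b + 1 - 2 * int l))"
      if "a \<le> K" for a b using inv_den_coeff_int_binom[of a k r b] that by (simp add: K_def)
    have x: "K + (d + K - 1) + 1 - 2 * L = d + 2 * K - 2 * L" "K - 1 + (d + K) + 1 - 2 * L = d + 2 * K - 2 * L"
      "K + (d + K - 2) + 1 - 2 * L = d + 2 * K - 2 * L - 1" "K - 2 + (d + K) + 1 - 2 * L = d + 2 * K - 2 * L - 1"
      "K - 1 + (d + K - 2) + 1 - 2 * L = d + 2 * K - 2 * L - 2" "K - 2 + (d + K - 1) + 1 - 2 * L = d + 2 * K - 2 * L - 2" for L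
      by auto
    have le: "K \<le> K" "K - 1 \<le> K" "K - 2 \<le> K" by auto
    have "coeff_uv (dsasm_num r s) k (j - i + k) = s\<^sup>2 * (if k = 0 \<and> j - i = 1 then 1 else 0) +
       (r * inv_den_coeff_int r K (d + K - 1) - r * inv_den_coeff_int r (K - 1) (d + K)
       + (r * inv_den_coeff_int r K (d + K - 2) - r * inv_den_coeff_int r (K - 2) (d + K))
       + (r * inv_den_coeff_int r (K - 1) (d + K - 2) - r * inv_den_coeff_int r (K - 2) (d + K - 1)))"
      unfolding coeff_dsasm_num e K_def[symmetric] using assms by (auto simp: algebra_simps)
    also have "\<dots> = s\<^sup>2 * (if k = 0 \<and> j - i = 1 then 1 else 0) + (\<Sum>l\<le>k. ?t K (int l))"
      unfolding t[OF le(1)] t[OF le(2)] t[OF le(3)] x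
      by (simp only: sum.distrib[symmetric] sum_subtractf[symmetric] left_diff_distrib)
    finally show "coeff_uv (dsasm_num r s) k (j - i + k) =
        s\<^sup>2 * (if k = 0 \<and> j - i = 1 then 1 else 0) + (\<Sum>l\<le>k. ?t (int k) (int l))"
      by (simp only: K_def)
  qed
  also have "\<dots> = explicit_coeff r s i j"
  proof -
    have "(\<Sum>k\<le>i. s\<^sup>2 * (if k = 0 \<and> j - i = 1 then 1 else 0)) = (\<Sum>k\<in>{0::nat}. s\<^sup>2 * (if k = 0 \<and> j - i = 1 then 1 else 0))"
      by (rule sum.mono_neutral_right) auto
    also have "\<dots> = s\<^sup>2 * (if i + 1 = j then 1 else 0)" using assms by auto
    finally show ?thesis unfolding explicit_coeff_def Let_def d_def by (simp only: sum.distrib)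
  qed
  finally show ?thesis .
qed

section \<open>Letting all spectral parameters tend to zero\<close>

context comm_ring_hom
begin

lemma hom_weight_a: "hom (weight_a r x y) = weight_a (hom r) (hom x) (hom y)"
  by (simp add: weight_a_def hom_distribs)

lemma hom_pair_den: "hom (pair_den r x y) = pair_den (hom r) (hom x) (hom y)"
  by (simp add: pair_den_def hom_weight_a hom_distribs)

lemma hom_pair_num: "hom (pair_num r s x y) = pair_num (hom r) (hom s) (hom x) (hom y)"
  by (simp add: pair_num_def hom_weight_a hom_distribs)

lemma hom_cross_eq: "hom (cross_eq r x y) = cross_eq (hom r) (hom x) (hom y)"
  by (simp add: cross_eq_def hom_distribs)

lemma hom_vandermonde: "hom (vandermonde us) = vandermonde (map hom us)"
proof (induction us)
  case (Cons x us)
  have "hom (\<Prod>u\<leftarrow>us. u - x) = (\<Prod>u\<leftarrow>map hom us. u - hom x)" by (induction us) (auto simp: hom_distribs)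
  thus ?case using Cons by (simp add: hom_distribs)
qed simp

lemma hom_den_prod: "hom (den_prod r us) = den_prod (hom r) (map hom us)"
proof (induction us)
  case (Cons x us)
  have "hom (\<Prod>u\<leftarrow>us. pair_den r x u) = (\<Prod>u\<leftarrow>map hom us. pair_den (hom r) (hom x) u)"
    by (induction us) (auto simp: hom_distribs hom_pair_den)
  thus ?case using Cons by (simp add: hom_distribs)
qed simp

lemma hom_pfsum: "hom (pfsum m B) = pfsum m (\<lambda>i j. hom (B i j))"
  by (simp add: pfsum_def hom_distribs)

lemma hom_pfaffian: "hom (pfaffian a b B) = pfaffian a b (\<lambda>i j. hom (B i j))"
  by (simp add: pfaffian_def hom_distribs)

lemma hom_explicit_coeff: "hom (explicit_coeff r s i j) = explicit_coeff (hom r) (hom s) i j"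
  by (simp add: explicit_coeff_def Let_def hom_distribs)

lemma comm_ring_hom_eval_poly: "comm_ring_hom (\<lambda>p. poly (map_poly hom p) a)"
proof -
  interpret m: map_poly_comm_ring_hom hom ..
  show ?thesis by unfold_locales (simp_all add: hom_distribs)
qed

end

lemma pfaffian_cong:
  assumes "\<And>i j. i < j \<Longrightarrow> B i j = B' i j"
  shows "pfaffian a b B = pfaffian a b B'"
  unfolding pfaffian_def
  by (intro if_cong sum.cong arg_cong2[where f = "(*)"] prod.cong refl assms) (auto simp: pfaffian_perms_def)

text \<open>
  The power series that arises by substituting \<open>a * X\<close> and \<open>b * X\<close> for the two indeterminates.
\<close>

definition subst_uv :: "'a::comm_ring_1 \<Rightarrow> 'a \<Rightarrow> 'a fps fps \<Rightarrow> 'a fps" where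
  "subst_uv a b F = Abs_fps (\<lambda>d. \<Sum>k\<le>d. a ^ k * b ^ (d - k) * coeff_uv F k (d - k))"

lemma subst_uv_simps:
  "subst_uv a b (F + G) = subst_uv a b F + subst_uv a b G"
  "subst_uv a b (F - G) = subst_uv a b F - subst_uv a b G"
  "subst_uv a b (const_uv c * F) = fps_const c * subst_uv a b F"
  "subst_uv a b 1 = 1"
  "subst_uv a b (fps_u * F) = fps_const a * fps_X * subst_uv a b F"
  "subst_uv a b (fps_v * F) = fps_const b * fps_X * subst_uv a b F"
proof -
  show "subst_uv a b (F + G) = subst_uv a b F + subst_uv a b G"
    by (auto simp: subst_uv_def fps_eq_iff coeff_uv_simps distrib_left sum.distrib)
  show "subst_uv a b (F - G) = subst_uv a b F - subst_uv a b G"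
    by (auto simp: subst_uv_def fps_eq_iff coeff_uv_simps right_diff_distrib sum_subtractf)
  show "subst_uv a b (const_uv c * F) = fps_const c * subst_uv a b F"
    by (simp add: subst_uv_def fps_eq_iff coeff_uv_simps sum_distrib_left mult.left_commute mult.assoc)
  show "subst_uv a b 1 = 1"
  proof (rule fps_ext)
    fix d
    have "(\<Sum>k\<le>d. a ^ k * b ^ (d - k) * coeff_uv 1 k (d - k)) = (\<Sum>k\<in>{0}. a ^ k * b ^ (d - k) * coeff_uv 1 k (d - k))"
      by (rule sum.mono_neutral_right) (auto simp: coeff_uv_simps)
    thus "subst_uv a b 1 $ d = 1 $ d" by (simp add: subst_uv_def coeff_uv_simps)
  qed
  show "subst_uv a b (fps_u * F) = fps_const a * fps_X * subst_uv a b F"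
  proof (rule fps_ext)
    fix d
    show "subst_uv a b (fps_u * F) $ d = (fps_const a * fps_X * subst_uv a b F) $ d"
    proof (cases d)
      case (Suc e)
      have "subst_uv a b (fps_u * F) $ d = (\<Sum>k\<le>e. a ^ Suc k * b ^ (e - k) * coeff_uv F k (e - k))"
        unfolding subst_uv_def fps_nth_Abs_fps Suc sum.atMost_Suc_shift by (simp add: coeff_uv_simps)
      thus ?thesis by (simp add: Suc mult.assoc subst_uv_def sum_distrib_left)
    qed (simp add: subst_uv_def coeff_uv_simps mult.assoc)
  qed
  show "subst_uv a b (fps_v * F) = fps_const b * fps_X * subst_uv a b F"
  proof (rule fps_ext)
    fix d
    show "subst_uv a b (fps_v * F) $ d = (fps_const b * fps_X * subst_uv a b F) $ d"
    proof (cases d)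
      case (Suc e)
      have "subst_uv a b (fps_v * F) $ d = (\<Sum>k\<le>e. a ^ k * b ^ (d - k) * coeff_uv F k (d - k - 1))"
        unfolding subst_uv_def fps_nth_Abs_fps Suc sum.atMost_Suc
        by (simp add: coeff_uv_simps)
      also have "\<dots> = (\<Sum>k\<le>e. b * (a ^ k * b ^ (e - k) * coeff_uv F k (e - k)))"
        by (intro sum.cong refl) (auto simp: Suc Suc_diff_le mult_ac)
      finally show ?thesis by (simp add: Suc mult.assoc subst_uv_def sum_distrib_left)
    qed (simp add: subst_uv_def coeff_uv_simps mult.assoc)
  qed
qed

text \<open>
  The denominators are polynomials, so the equation that defines the series survives a
  substitution that is compatible with multiplication by the indeterminates and by constants.
\<close>

lemma subst_dsasm_series:
  fixes r s a b :: "'a::field"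
  defines "R \<equiv> fps_const r" and "S \<equiv> fps_const s"
  defines "U \<equiv> fps_const a * fps_X" and "V \<equiv> fps_const b * fps_X"
  shows "pair_den R U V * subst_uv a b (dsasm_series r s) = pair_num R S U V"
proof -
  have den: "uv_den r * F = F - const_uv r * (fps_u * F) - const_uv r * (fps_v * F) + const_uv (r\<^sup>2 - 1) * (fps_u * (fps_v * F))" for F
    by (simp add: uv_den_def const_uv_simps algebra_simps power2_eq_square)
  have c: "fps_const (r\<^sup>2 - 1) = R\<^sup>2 - 1" "fps_const (s\<^sup>2) = S\<^sup>2" by (auto simp: R_def S_def fps_const_power simp flip: fps_const_sub)
  have D: "subst_uv a b (uv_den r * F) = weight_a R U V * subst_uv a b F" for F
    unfolding den subst_uv_simps c R_def[symmetric] U_def[symmetric] V_def[symmetric] by (simp add: weight_a_def algebra_simps)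
  have "(1 - fps_u * fps_v) * (uv_den r * dsasm_series r s) =
     (fps_v - fps_u) * (const_uv (s\<^sup>2) * (uv_den r * 1) + const_uv r * (1 + fps_u) * (1 + fps_v))"
    using dsasm_series_mult[of r s] by (simp add: mult_ac)
  hence "uv_den r * dsasm_series r s - fps_u * (fps_v * (uv_den r * dsasm_series r s)) =
     const_uv (s\<^sup>2) * (fps_v * (uv_den r * 1)) - const_uv (s\<^sup>2) * (fps_u * (uv_den r * 1)) +
     const_uv r * (fps_v * 1 - fps_u * 1 + fps_v * (fps_v * 1) - fps_u * (fps_u * 1)
       + fps_u * (fps_v * (fps_v * 1)) - fps_u * (fps_u * (fps_v * 1)))" (is "?l = ?r")
    by (simp add: algebra_simps)
  hence "subst_uv a b ?l = subst_uv a b ?r" by (rule arg_cong)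
  hence "weight_a R U V * subst_uv a b (dsasm_series r s) - U * (V * (weight_a R U V * subst_uv a b (dsasm_series r s))) =
     S\<^sup>2 * (V * (weight_a R U V * 1)) - S\<^sup>2 * (U * (weight_a R U V * 1)) +
     R * (V * 1 - U * 1 + V * (V * 1) - U * (U * 1) + U * (V * (V * 1)) - U * (U * (V * 1)))"
    unfolding subst_uv_simps D c R_def[symmetric] U_def[symmetric] V_def[symmetric] .
  thus ?thesis by (simp add: pair_den_def pair_num_def algebra_simps)
qed

lemma diagonal_sum:
  fixes f :: "nat \<Rightarrow> nat \<Rightarrow> 'b::comm_monoid_add"
  assumes "d < M"
  shows "(\<Sum>(k, l)\<in>{..<M} \<times> {..<M}. if k + l = d then f k l else 0) = (\<Sum>k\<le>d. f k (d - k))"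
proof -
  have "(\<Sum>(k, l)\<in>{..<M} \<times> {..<M}. if k + l = d then f k l else 0) =
     (\<Sum>(k, l)\<in>(\<lambda>k. (k, d - k)) ` {..d}. f k l)"
    by (rule sum.mono_neutral_cong_right) (use assms in \<open>auto simp: image_iff\<close>)
  also have "\<dots> = (\<Sum>k\<le>d. f k (d - k))" by (subst sum.reindex) (auto simp: inj_on_def)
  finally show ?thesis .
qed

lemma bordered_sum:
  fixes h :: "nat \<Rightarrow> nat \<Rightarrow> 'b::comm_monoid_add"
  shows "(\<Sum>(k, l)\<in>{..<Suc M} \<times> {..<Suc M}. h k l) =
    h 0 0 + (\<Sum>l<M. h 0 (Suc l)) + ((\<Sum>k<M. h (Suc k) 0) + (\<Sum>(k, l)\<in>{..<M} \<times> {..<M}. h (Suc k) (Suc l)))"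
  unfolding sum.cartesian_product[symmetric] sum.lessThan_Suc_shift
  by (simp add: sum.distrib sum.lessThan_Suc_shift del: sum.lessThan_Suc)

lemma fps_mult_nth_lowest:
  fixes f g :: "'a::comm_ring_1 fps"
  assumes "\<And>d. d < W \<Longrightarrow> g $ d = 0"
  shows "(f * g) $ W = f $ 0 * g $ W"
proof -
  have "(f * g) $ W = (\<Sum>i\<in>{0}. f $ i * g $ (W - i))"
    unfolding fps_mult_nth by (rule sum.mono_neutral_right) (auto simp: assms)
  thus ?thesis by simp
qed

lemma vandermonde_monom:
  fixes c :: "nat \<Rightarrow> 'a::comm_ring_1"
  shows "vandermonde (map (\<lambda>i. fps_const (c i) * fps_X) [0..<n]) = fps_const (vandermonde (map c [0..<n])) * fps_X ^ (\<Sum>i<n. i)"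
proof -
  have "(\<Prod>l<j. fps_const (c j) * fps_X - fps_const (c l) * fps_X) = fps_const (\<Prod>l<j. c j - c l) * fps_X ^ j" for j
  proof -
    have "(\<Prod>l<j. fps_const (c j) * fps_X - fps_const (c l) * fps_X) = (\<Prod>l<j. fps_const (c j - c l) * fps_X)"
      by (simp add: left_diff_distrib flip: fps_const_sub)
    thus ?thesis by (simp add: prod.distrib fps_const_prod)
  qed
  thus ?thesis unfolding vandermonde_prod by (simp only: prod.distrib fps_const_prod power_sum)
qed

interpretation fls: comm_ring_hom "fps_to_fls :: 'a::comm_ring_1 fps \<Rightarrow> 'a fls"
  by unfold_locales (auto simp: fls_times_fps_to_fls)

interpretation nth0: comm_ring_hom "\<lambda>f :: 'a::comm_ring_1 fps. f $ 0"
  by unfold_locales (auto simp: fps_mult_nth_0)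

text \<open>
  The Pfaffian formula is applied over the field of Laurent series to the parameters
  \<open>c i * X\<close>. They are generic because each condition but \<open>x \<noteq> 0\<close> can be read off a
  nonzero constant coefficient. The formula then descends to power series, where the
  coefficients of \<open>X ^ W\<close> are compared.
\<close>

lemma part_fn0_zero_pfaffian:
  fixes r s :: "'a::field_char_0"
  assumes n: "n \<ge> 1" and r: "r \<noteq> 0" "1 + r \<noteq> 0" and s: "s \<noteq> 0"
  shows "part_fn0 r s (replicate n 0) = s ^ chi_odd n * pfaffian (chi_odd n) (n - 1) (coeff_uv (dsasm_series r s))"
proof -
  let ?e = "fps_to_fls :: 'a fps \<Rightarrow> 'a fls"
  define f where "f = coeff_uv (dsasm_series r s)"
  have f_skew: "f j i = - f i j" for i j unfolding f_def by (rule dsasm_series_skew)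
  \<comment> \<open>Starting at 1 because the parameters have to be nonzero.\<close>
  define c where "c i = (of_nat (Suc i) :: 'a)" for i
  have c: "c i \<noteq> 0" "c i = c j \<longleftrightarrow> i = j" for i j unfolding c_def by (simp_all del: of_nat_Suc)
  define x where "x i = fps_const (c i) * fps_X" for i
  define R where "R = fps_const r"
  define S where "S = fps_const s"
  define us where "us = map x [0..<n]"
  define K where "K i j = subst_uv (c i) (c j) (dsasm_series r s)" for i j
  have K: "pair_den R (x i) (x j) * K i j = pair_num R S (x i) (x j)" for i j
    unfolding R_def S_def x_def K_def by (rule subst_dsasm_series)
  have R0: "R $ 0 = r" and S0: "S $ 0 = s" by (auto simp: R_def S_def)
  have x0: "x i $ 0 = 0" for i by (simp add: x_def)
  have nz: "?e g \<noteq> 0" if "g $ 0 \<noteq> 0" for g :: "'a fps" using that by auto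
  let ?R = "?e R" and ?S = "?e S" and ?us = "map ?e us"
  have len: "length us = n" by (simp add: us_def)
  have gen: "generic ?R (set ?us)"
  proof -
    have "?e (x i) \<noteq> 0" for i using c(1)[of i] by (simp add: x_def)
    moreover have "?e (R - (R\<^sup>2 - 1) * x i) \<noteq> 0" for i
      by (rule nz) (use r in \<open>simp add: R0 x0 hom_distribs\<close>)
    moreover have "?e (pair_den R (x i) (x j)) \<noteq> 0" for i j
      by (rule nz) (simp add: nth0.hom_pair_den x0 R0 pair_den_def weight_a_def)
    moreover have "?e (cross_eq R (x i) (x j)) \<noteq> 0" for i j
      by (rule nz) (use r in \<open>simp add: nth0.hom_cross_eq x0 R0 cross_eq_def\<close>)
    moreover have "?e (x i - R * (1 + x i * x j) + (R\<^sup>2 - 1) * x j) \<noteq> 0" for i j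
      by (rule nz) (use r in \<open>simp add: R0 x0 hom_distribs\<close>)
    ultimately show ?thesis
      unfolding generic_def us_def by (simp add: hom_distribs fls.hom_pair_den fls.hom_cross_eq del: fps_to_fls_eq_0_iff) 
  qed
  have dist: "distinct ?us"
    by (auto simp: us_def distinct_map inj_on_def x_def c)
  have pair_entry: "pair_entry ?R ?S (?e (x i)) (?e (x j)) = ?e (K i j)" for i j
  proof -
    have "?e (pair_den R (x i) (x j)) \<noteq> 0"
      by (rule nz) (simp add: nth0.hom_pair_den x0 R0 pair_den_def weight_a_def)
    moreover have "?e (pair_den R (x i) (x j)) * ?e (K i j) = ?e (pair_num R S (x i) (x j))"
      unfolding K[symmetric] by (simp add: fls.hom_mult)
    ultimately show ?thesis unfolding pair_entry_def fls.hom_pair_den[symmetric] fls.hom_pair_num[symmetric]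
      by (simp add: nonzero_divide_eq_eq mult.commute)
  qed
  define W where "W = (\<Sum>i<n. i)"
  define v where "v = vandermonde (map c [0..<n])"
  have v0: "v \<noteq> 0" unfolding v_def vandermonde_prod by (auto simp: c)
  have vandermonde_us: "vandermonde us = fps_const v * fps_X ^ W"
    unfolding us_def x_def v_def W_def by (rule vandermonde_monom)
  have part_fn0_0: "part_fn0 R S us $ 0 = part_fn0 r s (replicate n 0)"
    unfolding nth0.hom_part_fn0 R0 S0 us_def by (simp add: comp_def x0 map_replicate_const)
  have lhs: "(of_nat k * vandermonde us * part_fn0 R S us) $ W = of_nat k * v * part_fn0 r s (replicate n 0)" for k
  proof -
    have "of_nat k * vandermonde us * part_fn0 R S us = fps_const (of_nat k * v) * (fps_X ^ W * part_fn0 R S us)"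
      unfolding vandermonde_us by (simp add: fps_of_nat[symmetric] mult.assoc del: fps_of_nat flip: fps_const_mult)
    hence "(of_nat k * vandermonde us * part_fn0 R S us) $ W = (fps_const (of_nat k * v) * (fps_X ^ W * part_fn0 R S us)) $ W"
      by (simp only:)
    also have "\<dots> = of_nat k * v * part_fn0 r s (replicate n 0)"
      unfolding fps_mult_left_const_nth by (simp add: fps_X_power_mult_nth part_fn0_0)
    finally show ?thesis .
  qed
  have q0: "den_prod R us $ 0 = 1"
  proof -
    have "den_prod r (replicate k 0) = 1" for k by (induction k) (auto simp: pair_den_def weight_a_def map_replicate_const)
    thus ?thesis unfolding nth0.hom_den_prod R0 us_def by (simp add: comp_def x0 map_replicate_const)
  qed
  have nth: "?us ! i = ?e (x i)" if "i < n" for i using that by (simp add: us_def)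
  have Kd: "K i j $ d = (\<Sum>(k, l)\<in>{..<M} \<times> {..<M}. if k + l = d then c i ^ k * c j ^ l * f k l else 0)"
    if "d < M" for i j d M
    unfolding diagonal_sum[OF that] by (simp add: K_def subst_uv_def f_def)
  show ?thesis
  proof (cases "even n")
    case True
    then obtain m where m: "n = 2 * m" by (elim evenE)
    have "of_nat (2 ^ m * fact m) * vandermonde ?us * part_fn0 ?R ?S ?us =
      den_prod ?R ?us *
      pfsum m (\<lambda>i j. pair_entry ?R ?S (?us ! i) (?us ! j))"
      by (rule partition_pfaffian_even[OF gen dist]) (simp add: len m)
    also have "pfsum m (\<lambda>i j. pair_entry ?R ?S (?us ! i) (?us ! j))
       = pfsum m (\<lambda>i j. ?e (K i j))"
      by (rule pfsum_cong) (simp only: nth pair_entry m)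
    finally have "?e (of_nat (2 ^ m * fact m) * vandermonde us * part_fn0 R S us) = ?e (den_prod R us * pfsum m K)"
      by (simp only: fls.hom_mult fls.hom_of_nat fls.hom_vandermonde fls.hom_part_fn0 fls.hom_den_prod fls.hom_pfsum)
    hence id: "of_nat (2 ^ m * fact m) * vandermonde us * part_fn0 R S us = den_prod R us * pfsum m K" by (simp only: fps_to_fls_eq_iff)
    have pf: "pfsum m K $ d = (if d = W then alt_sum (2*m) (\<lambda>i k. c i ^ k) id * pfsum m f else 0)" if "d \<le> W" for d
    proof -
      have Wm: "W = (\<Sum>i<2*m. i)" by (simp add: W_def m)
      show ?thesis
        unfolding Wm
        by (rule pfsum_lowest_coeff[where w = "\<lambda>i. i" and N = "Suc W + 2 * m"])
           (use that Wm in \<open>auto simp: mono_def intro!: Kd\<close>)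
    qed
    have "of_nat (2 ^ m * fact m) * v * part_fn0 r s (replicate n 0) = v * pfsum m f"
      unfolding lhs[symmetric] id
      by (subst fps_mult_nth_lowest) (auto simp: pf q0 v_def alt_sum_vandermonde m)
    also have "pfsum m f = of_nat (2 ^ m * fact m) * pfaffian 0 (n - 1) f"
    proof -
      have "pfsum m (\<lambda>i j. f (0 + i) (0 + j)) = of_nat (2 ^ m * fact m) * pfaffian 0 (n - 1) f"
        by (rule pfsum_pfaffian[OF _ f_skew]) (use m n in auto)
      thus ?thesis by (simp only: add_0)
    qed
    finally have "(of_nat (2 ^ m * fact m) * v) * part_fn0 r s (replicate n 0) = (of_nat (2 ^ m * fact m) * v) * pfaffian 0 (n - 1) f"
      by (simp only: mult_ac)
    moreover have "of_nat (2 ^ m * fact m) * v \<noteq> 0" using v0 by simp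
    ultimately show ?thesis using True by (simp add: chi_odd_def f_def)
  next
    case False
    then obtain m where m: "n = Suc (2 * m)" by (elim oddE) simp
    define B where "B = border (\<lambda>j. if j = 0 then 0 else 1) (\<lambda>i j. K (i - 1) (j - 1))"
    obtain e where e: "\<And>b. pfsum (Suc m) (border b (pair_entries ?R ?S ?us))
        = (\<Sum>j\<in>{1..<2*Suc m}. e j * b j)"
      using pfsum_border[of "Suc m"] by force
    have "of_nat (2 ^ Suc m * fact (Suc m)) * vandermonde ?us * part_fn0 ?R ?S ?us =
      ?S * den_prod ?R ?us *
      pfsum (Suc m) (border (\<lambda>_. 1) (pair_entries ?R ?S ?us))"
    proof (rule partition_pfaffian_odd[OF gen dist])
      show "?S \<noteq> 0" using s by (simp add: S_def)
      fix u assume "u \<in> set ?us"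
      then obtain i where i: "u = ?e (x i)" by (auto simp: us_def)
      have "?e (pair_den R (-1) (x i)) \<noteq> 0"
        by (rule nz) (use r in \<open>simp add: nth0.hom_pair_den x0 R0 pair_den_def weight_a_def\<close>)
      thus "pair_den ?R (-1) u \<noteq> 0" by (simp add: i fls.hom_pair_den)
    qed (simp add: len m)
    also have "pfsum (Suc m) (border (\<lambda>_. 1) (pair_entries ?R ?S ?us)) =
       pfsum (Suc m) (border (\<lambda>j. if j = 0 then 0 else 1) (pair_entries ?R ?S ?us))"
      unfolding e by (intro sum.cong) auto
    also have "\<dots> = pfsum (Suc m) (\<lambda>i j. ?e (B i j))"
    proof (rule pfsum_cong)
      fix i j assume "i < 2 * Suc m" "j < 2 * Suc m"
      hence ij: "i - 1 < n" "j - 1 < n" using m by auto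
      have k: "pair_entries ?R ?S ?us i j = ?e (K (i - 1) (j - 1))"
        unfolding pair_entries_def nth[OF ij(1)] nth[OF ij(2)] by (rule pair_entry)
      show "border (\<lambda>j. if j = 0 then 0 else 1) (pair_entries ?R ?S ?us) i j = ?e (B i j)"
        unfolding B_def border_def k by simp
    qed
    finally have "?e (of_nat (2 ^ Suc m * fact (Suc m)) * vandermonde us * part_fn0 R S us) = ?e (S * den_prod R us * pfsum (Suc m) B)"
      by (simp only: fls.hom_mult fls.hom_of_nat fls.hom_vandermonde fls.hom_part_fn0 fls.hom_den_prod fls.hom_pfsum)
    hence id: "of_nat (2 ^ Suc m * fact (Suc m)) * vandermonde us * part_fn0 R S us = S * den_prod R us * pfsum (Suc m) B"
      by (simp only: fps_to_fls_eq_iff)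
    define C where "C i k = (if i = 0 \<or> k = 0 then (if i = k then 1 else 0) else c (i - 1) ^ (k - 1))" for i k :: nat
    \<comment> \<open>Index 0 stands for the additional line, index \<open>k + 1\<close> for the power \<open>X ^ k\<close>; hence the
    weights \<open>i - 1\<close>, which count index 0 with weight 0.\<close>
    define F where "F k l = (if k = 0 then (if l = 1 then 1 else 0) else if l = 0 then (if k = 1 then - 1 else 0) else f (k - 1) (l - 1))" for k l :: nat
    have WW: "W = (\<Sum>i<2*Suc m. i - 1)"
    proof -
      have "(\<Sum>i<2*Suc m. i - 1) = (\<Sum>i<Suc n. i - 1)" by (simp add: m)
      also have "\<dots> = W" unfolding sum.lessThan_Suc_shift W_def by simp
      finally show ?thesis ..
    qed
    have Bd: "B i j $ d = (\<Sum>(k, l)\<in>{..<Suc M} \<times> {..<Suc M}. if (k - 1) + (l - 1) = d then C i k * C j l * F k l else 0)"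
      if M: "d < M" for i j d M
    proof -
      let ?h = "\<lambda>k l. if (k - 1) + (l - 1) = d then C i k * C j l * F k l else 0"
      have one: "(\<Sum>l<M. if l = d \<and> l = 0 then a l else 0) = (if d = 0 then a 0 else 0)" for a :: "nat \<Rightarrow> 'a"
      proof -
        have "(\<Sum>l<M. if l = d \<and> l = 0 then a l else 0) = (\<Sum>l\<in>{0}. if l = d \<and> l = 0 then a l else 0)"
          by (rule sum.mono_neutral_right) (use M in auto)
        thus ?thesis by auto
      qed
      have h0: "?h 0 (Suc l) = (if l = d \<and> l = 0 then C i 0 * C j 1 else 0)"
        "?h (Suc l) 0 = (if l = d \<and> l = 0 then - (C i 1 * C j 0) else 0)" for l
        by (auto simp: F_def)
      have "(\<Sum>(k, l)\<in>{..<Suc M} \<times> {..<Suc M}. ?h k l) =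
        (if d = 0 then C i 0 * C j 1 else 0) + ((if d = 0 then - (C i 1 * C j 0) else 0) +
         (\<Sum>(k, l)\<in>{..<M} \<times> {..<M}. ?h (Suc k) (Suc l)))"
        unfolding bordered_sum h0 one by (simp add: F_def)
      also have "\<dots> = B i j $ d"
      proof (cases "i = 0 \<or> j = 0")
        case True
        have "(\<Sum>(k, l)\<in>{..<M} \<times> {..<M}. ?h (Suc k) (Suc l)) = 0"
          using True by (intro sum.neutral) (auto simp: C_def)
        thus ?thesis using True by (auto simp: B_def border_def C_def)
      next
        case False
        have "(\<Sum>(k, l)\<in>{..<M} \<times> {..<M}. ?h (Suc k) (Suc l)) = K (i - 1) (j - 1) $ d"
          unfolding Kd[OF M] using False by (intro sum.cong refl) (auto simp: C_def F_def)
        thus ?thesis using False by (simp add: B_def border_def C_def)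
      qed
      finally show ?thesis ..
    qed
    have pf: "pfsum (Suc m) B $ d = (if d = W then alt_sum (2 * Suc m) C id * pfsum (Suc m) F else 0)" if "d \<le> W" for d
      unfolding WW
    proof (rule pfsum_lowest_coeff[where w = "\<lambda>i. i - 1" and N = "Suc (Suc W + 2 * Suc m)"])
      show "mono (\<lambda>i :: nat. i - 1)" by (auto simp: mono_def)
      show "d \<le> (\<Sum>i<2 * Suc m. i - 1)" using that WW by simp
      fix i j d' assume "d' \<le> (\<Sum>i<2 * Suc m. i - 1)"
      thus "B i j $ d' = (\<Sum>(k, l)\<in>{..<Suc (Suc W + 2 * Suc m)} \<times> {..<Suc (Suc W + 2 * Suc m)}.
          if k - 1 + (l - 1) = d' then C i k * C j l * F k l else 0)"
        unfolding WW[symmetric] by (intro Bd) simp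
    qed auto
    have "f i i = 0" for i using f_skew[of i i] unfolding eq_neg_iff_add_eq_0 mult_2[symmetric] by simp
    hence F_skew: "F j i = - F i j" for i j by (auto simp: F_def intro: f_skew)
    have "pfsum (Suc m) F = of_nat (2 * Suc m) * F 0 1 * pfsum m (\<lambda>i j. F (i + 2) (j + 2))"
      by (rule pfsum_first_pair[OF F_skew]) (auto simp: F_def)
    also have "(\<lambda>i j. F (i + 2) (j + 2)) = (\<lambda>i j. f (1 + i) (1 + j))" by (auto simp: F_def fun_eq_iff)
    also have "pfsum m (\<lambda>i j. f (1 + i) (1 + j)) = of_nat (2 ^ m * fact m) * pfaffian 1 (n - 1) f"
      by (rule pfsum_pfaffian[OF _ f_skew]) (auto simp: m)
    finally have pF: "pfsum (Suc m) F = of_nat (2 ^ Suc m * fact (Suc m)) * pfaffian 1 (n - 1) f"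
    proof -
      assume a: "pfsum (Suc m) F = of_nat (2 * Suc m) * F 0 1 * (of_nat (2 ^ m * fact m) * pfaffian 1 (n - 1) f)"
      have "of_nat (2 ^ Suc m * fact (Suc m)) = of_nat (2 * Suc m) * (of_nat (2 ^ m * fact m) :: 'a)"
        by (simp only: flip: of_nat_mult) (simp add: algebra_simps)
      thus ?thesis unfolding a by (simp add: F_def mult.assoc)
    qed
    have al: "alt_sum (2 * Suc m) C id = v"
      using alt_sum_vandermonde_border[of n c] by (simp add: C_def[abs_def] v_def m)
    have "of_nat (2 ^ Suc m * fact (Suc m)) * v * part_fn0 r s (replicate n 0) = (S * den_prod R us * pfsum (Suc m) B) $ W"
      by (simp only: lhs[symmetric] id)
    also have "\<dots> = (fps_const s * (den_prod R us * pfsum (Suc m) B)) $ W"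
      by (simp only: S_def mult.assoc)
    also have "\<dots> = s * (v * pfsum (Suc m) F)"
    proof -
      have "pfsum (Suc m) B $ W = v * pfsum (Suc m) F"
        by (simp only: pf[OF order_refl] al refl if_True)
      moreover have "pfsum (Suc m) B $ d = 0" if "d < W" for d
        using pf[of d] that by simp
      ultimately show ?thesis
        unfolding fps_mult_left_const_nth by (simp only: fps_mult_nth_lowest q0 mult_1)
    qed
    finally have "(of_nat (2 ^ Suc m * fact (Suc m)) * v) * part_fn0 r s (replicate n 0) =
       (of_nat (2 ^ Suc m * fact (Suc m)) * v) * (s * pfaffian 1 (n - 1) f)"
      unfolding pF by (simp only: mult_ac)
    moreover have "of_nat (2 ^ Suc m * fact (Suc m)) * v \<noteq> 0"
      using v0 by (simp only: mult_eq_0_iff of_nat_eq_0_iff) simp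
    ultimately have "part_fn0 r s (replicate n 0) = s * pfaffian 1 (n - 1) f" by (metis mult_left_cancel)
    thus ?thesis using False by (simp add: chi_odd_def f_def)
  qed
qed

text \<open>
  Both sides are the values of integer polynomials in \<open>r\<close> and \<open>s\<close>; so it is enough to compare
  these polynomials, and this can be done in their field of fractions, which has
  characteristic 0.
\<close>

lemma X_gf_pfaffian_explicit:
  fixes r s :: "'a::comm_ring_1"
  assumes n: "n \<ge> 1"
  shows "X_gf n r s 1 = s ^ chi_odd n * pfaffian (chi_odd n) (n - 1) (explicit_coeff r s)"
proof -
  define R :: "int poly poly" where "R = [:[:0, 1:]:]"
  define S :: "int poly poly" where "S = [:0, 1:]"
  interpret fr: comm_ring_hom "to_fract :: int poly poly \<Rightarrow> int poly poly fract"
    by unfold_locales auto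
  have "part_fn0 (to_fract R) (to_fract S) (replicate n 0) =
     to_fract S ^ chi_odd n * pfaffian (chi_odd n) (n - 1) (coeff_uv (dsasm_series (to_fract R) (to_fract S)))"
  proof (rule part_fn0_zero_pfaffian[OF n])
    show "to_fract R \<noteq> 0" "to_fract S \<noteq> 0" by (auto simp: R_def S_def)
    have "1 + R \<noteq> 0" by (simp add: R_def one_pCons)
    thus "1 + to_fract R \<noteq> 0" by (metis to_fract_1 to_fract_add to_fract_eq_0_iff)
  qed
  also have "pfaffian (chi_odd n) (n - 1) (coeff_uv (dsasm_series (to_fract R) (to_fract S))) =
     pfaffian (chi_odd n) (n - 1) (\<lambda>i j. to_fract (explicit_coeff R S i j))"
    by (rule pfaffian_cong) (simp only: coeff_dsasm_series fr.hom_explicit_coeff)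
  finally have "to_fract (part_fn0 R S (replicate n 0)) = to_fract (S ^ chi_odd n * pfaffian (chi_odd n) (n - 1) (explicit_coeff R S))"
    by (simp add: fr.hom_part_fn0 hom_distribs fr.hom_pfaffian)
  hence id: "part_fn0 R S (replicate n 0) = S ^ chi_odd n * pfaffian (chi_odd n) (n - 1) (explicit_coeff R S)"
    by (simp only: to_fract_eq_iff)
  interpret e1: comm_ring_hom "\<lambda>q. poly (map_poly (of_int :: int \<Rightarrow> 'a) q) r"
    by (rule of_int_hom.comm_ring_hom_eval_poly)
  interpret e2: comm_ring_hom "\<lambda>p. poly (map_poly (\<lambda>q. poly (map_poly (of_int :: int \<Rightarrow> 'a) q) r) p) s"
    by (rule e1.comm_ring_hom_eval_poly)
  let ?e = "\<lambda>p. poly (map_poly (\<lambda>q. poly (map_poly (of_int :: int \<Rightarrow> 'a) q) r) p) s"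
  have RS: "?e R = r" "?e S = s" by (simp_all add: R_def S_def)
  have "?e (part_fn0 R S (replicate n 0)) = ?e (S ^ chi_odd n * pfaffian (chi_odd n) (n - 1) (explicit_coeff R S))"
    by (simp only: id)
  hence "part_fn0 r s (replicate n 0) = s ^ chi_odd n * pfaffian (chi_odd n) (n - 1) (explicit_coeff r s)"
    by (simp only: e2.hom_part_fn0 e2.hom_mult e2.hom_power e2.hom_pfaffian e2.hom_explicit_coeff RS map_replicate e2.hom_zero)
  thus ?thesis by (simp only: X_gf_partition)
qed

theorem theorem4p1:
  fixes n :: nat and r s :: "'a::field"
  assumes "n \<ge> 1"
  shows "X_gf n r s 1 =
           s ^ chi_odd n * pfaffian (chi_odd n) (n - 1) (coeff_uv (dsasm_series r s)) \<and>
         (\<forall>i j. i < j \<longrightarrow>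
           coeff_uv (dsasm_series r s) i j =
             s\<^sup>2 * (if i + 1 = j then 1 else 0) +
             (\<Sum>k\<le>i. \<Sum>l\<le>k. let d = int j - int i; K = int k; L = int l in
                 (of_nat (binom K L * binom (d + K - 1) L)
                    - of_nat (binom (K - 1) L * binom (d + K) L))
                   * r ^ nat (d + 2 * K - 2 * L)
               + (of_nat (binom K L * binom (d + K - 2) L)
                    - of_nat (binom (K - 2) L * binom (d + K) L))
                   * r ^ nat (d + 2 * K - 2 * L - 1)
               + (of_nat (binom (K - 1) L * binom (d + K - 2) L)
                    - of_nat (binom (K - 2) L * binom (d + K - 1) L))
                   * r ^ nat (d + 2 * K - 2 * L - 2)))"
proof (intro conjI allI impI)
  have "pfaffian (chi_odd n) (n - 1) (coeff_uv (dsasm_series r s)) = pfaffian (chi_odd n) (n - 1) (explicit_coeff r s)"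
    by (rule pfaffian_cong) (rule coeff_dsasm_series)
  thus "X_gf n r s 1 = s ^ chi_odd n * pfaffian (chi_odd n) (n - 1) (coeff_uv (dsasm_series r s))"
    using X_gf_pfaffian_explicit[OF assms] by simp
qed (rule coeff_dsasm_series[unfolded explicit_coeff_def])

end
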